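(* Let $\lambda\in(-1/2,\infty)$ be fixed. For $n\ge1$ consider the following two point processes in $[-1,1]$, each with $n+3$ points: (1) generate $n+3$ points using the $\lambda$-Gegenbauer determinantal point process with $n+3$ points; (2) generate $n+1$ points using the $\lambda$-Gegenbauer determinantal point process with $n+1$ points, and add the two extreme points $+1$ and $-1$. Let $E_1(\lambda,n)$ and $E_2(\lambda,n)$ be the expected logarithmic energies of the outputs of (1) and (2), respectively. Then $E_1(\lambda,n)-E_2(\lambda,n)=o(n)$ as $n\to\infty$. Moreover, if $\lambda=0$ then $E_1(0,n)<E_2(0,n)$, the difference being in the term of order $\log n$, i.e. $E_2(0,n)-E_1(0,n)$ is of exact order $\log n$ as $n\to\infty$.
   Context: The logarithmic energy of distinct points $x_1,\dots,x_N$ is $-\sum_{i\ne j}\log|x_i-x_j|$ (sum over ordered pairs). Let $w^\lambda(x)=\frac{\Gamma(\lambda+1)}{\sqrt{\pi}\,\Gamma(\lambda+1/2)}(1-x^2)^{\lambda-1/2}$, let $\widehat C^\lambda_k$ ($k\ge 0$, degree $k$) be the orthonormal polynomials with respect to $w^\lambda dx$ on $[-1,1]$ (normalized Gegenbauer polynomials; Chebyshev for $\lambda=0$), and $K_n^\lambda(x,y)=\sum_{k=0}^n\widehat C_k^\lambda(x)\widehat C_k^\lambda(y)$. The $\lambda$-Gegenbauer determinantal point process with $n+1$ points is the determinantal point process on $[-1,1]$ with kernel $K_n^\lambda$ with respect to the measure $w^\lambda dx$; it almost surely outputs $n+1$ distinct points, with $\mathrm E\sum_{i}g(x_i)=\int_{-1}^1K_n^\lambda(x,x)g(x)w^\lambda(x)dx$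 and $\mathrm E\sum_{i\ne j}f(x_i,x_j)=\iint_{[-1,1]^2}(K_n^\lambda(x,x)K_n^\lambda(y,y)-K_n^\lambda(x,y)^2)f(x,y)w^\lambda(x)w^\lambda(y)\,dx\,dy$. *)

theory Defs
  imports
    "HOL-Probability.Probability"
    "HOL-Computational_Algebra.Polynomial"
    "HOL-Library.Landau_Symbols"
    "Jordan_Normal_Form.Determinant"
begin

definition log_energy :: "real set \<Rightarrow> real" where
  "log_energy S = - (\<Sum>(x, y) \<in> {(x, y). x \<in> S \<and> y \<in> S \<and> x \<noteq> y}. ln \<bar>x - y\<bar>)"

definition expected_log_energy :: "'w measure \<Rightarrow> ('w \<Rightarrow> real set) \<Rightarrow> real" where
  "expected_log_energy M X = (\<integral>\<omega>. log_energy (X \<omega>) \<partial>M)"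

(* On the null set {-1, 1} the value of powr is irrelevant. *)
definition gegenbauer_weight :: "real \<Rightarrow> real \<Rightarrow> real" where
  "gegenbauer_weight lam x =
     Gamma (lam + 1) / (sqrt pi * Gamma (lam + 1 / 2)) * (1 - x\<^sup>2) powr (lam - 1 / 2)"

definition gegenbauer_measure :: "real \<Rightarrow> real measure" where
  "gegenbauer_measure lam =
     density lborel (\<lambda>x. ennreal (indicator {-1..1} x * gegenbauer_weight lam x))"

(* Each polynomial is determined up to sign, so the kernel below does not depend on the choice. *)
definition normalized_gegenbauer :: "real \<Rightarrow> (nat \<Rightarrow> real poly) \<Rightarrow> bool" where
  "normalized_gegenbauer lam C \<longleftrightarrow>
     (\<forall>k. degree (C k) = k) \<and>
     (\<forall>i j. (\<integral>x. poly (C i) x * poly (C j) x \<partial>gegenbauer_measure lam) = (if i = j then 1 else 0))"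

definition gegenbauer_kernel :: "(nat \<Rightarrow> real poly) \<Rightarrow> nat \<Rightarrow> real \<Rightarrow> real \<Rightarrow> real" where
  "gegenbauer_kernel C n x y = (\<Sum>k\<le>n. poly (C k) x * poly (C k) y)"

(* On a compact state space S, a locally finite configuration is finite; configurations
   are sets, so the process is simple. *)
definition simple_point_process :: "'w measure \<Rightarrow> real set \<Rightarrow> ('w \<Rightarrow> real set) \<Rightarrow> bool" where
  "simple_point_process M S X \<longleftrightarrow>
     prob_space M \<and>
     (\<forall>\<omega> \<in> space M. finite (X \<omega>) \<and> X \<omega> \<subseteq> S) \<and>
     (\<forall>B \<in> sets borel. (\<lambda>\<omega>. card (X \<omega> \<inter> B)) \<in> measurable M (count_space UNIV))"

(* The joint intensities with respect to \<mu> are \<rho>_k(x_0, ..., x_(k-1)) = det (K x_i x_j):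
   for disjoint Borel sets D_0, ..., D_(k-1), the expectation of the product of the numbers
   of points in the D_i is the integral of \<rho>_k over the product of the D_i. *)
definition determinantal_point_process ::
    "'w measure \<Rightarrow> real set \<Rightarrow> real measure \<Rightarrow> (real \<Rightarrow> real \<Rightarrow> real) \<Rightarrow> ('w \<Rightarrow> real set) \<Rightarrow> bool" where
  "determinantal_point_process M S \<mu> K X \<longleftrightarrow>
     simple_point_process M S X \<and>
     (\<forall>k D. (\<forall>i<k. D i \<in> sets borel) \<and> disjoint_family_on D {..<k} \<longrightarrow>
        (\<integral>\<^sup>+\<omega>. (\<Prod>i<k. of_nat (card (X \<omega> \<inter> D i))) \<partial>M) =
        (\<integral>\<^sup>+x \<in> PiE {..<k} D. ennreal (Determinant.det (Matrix.mat k k (\<lambda>(i, j). K (x i) (x j))))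
           \<partial>PiM {..<k} (\<lambda>_. \<mu>)))"

(* The kernel of index n is a projection of rank n + 1, so this process has n + 1 points
   almost surely. *)
definition gegenbauer_dpp ::
    "real \<Rightarrow> (nat \<Rightarrow> real poly) \<Rightarrow> nat \<Rightarrow> 'w measure \<Rightarrow> ('w \<Rightarrow> real set) \<Rightarrow> bool" where
  "gegenbauer_dpp lam C n M X \<longleftrightarrow>
     determinantal_point_process M {-1..1} (gegenbauer_measure lam) (gegenbauer_kernel C n) X"

end

theory Submission
  imports Defs
begin

text \<open>
  Let \<open>\<mu>\<close> be the Gegenbauer measure, \<open>p\<^sub>k\<close> the orthonormal polynomials and
  \<open>u\<^sub>m(x) = K\<^sub>m(x,x)\<close>. Adding one polynomial to the kernel changes the expected energy by
  \<open>-2 (J1 - J2)\<close> with \<open>J1 = \<integral>\<integral> ln |x-y| u\<^sub>m(x) p(y)\<^sup>2\<close>, \<open>J2 = \<integral>\<integral> ln |x-y| K\<^sub>m(x,y) p(x) p(y)\<close> and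
  \<open>p = p\<^sub>m\<^sub>+\<^sub>1\<close>, while the two added end points contribute \<open>-2 (\<Phi>\<^sub>n(1) + \<Phi>\<^sub>n(-1)) - 2 ln 2\<close>, where
  \<open>\<Phi>\<^sub>m(y) = \<integral> ln |x-y| u\<^sub>m(x) d\<mu>(x)\<close>. So it suffices that \<open>\<Phi>\<^sub>m(y) = -m ln 2 + o(m)\<close> uniformly
  in \<open>y\<close> and that \<open>J2 = o(m)\<close>.

  Both follow by replacing \<open>ln |x-y|\<close> with an Abel mean of its Chebyshev expansion
  \<open>- ln 2 - \<Sum> (2/j) T\<^sub>j(x) T\<^sub>j(y)\<close>, with an error at most \<open>\<epsilon> |x-y| powr -e\<close>. The error is controlled
  by the Christoffel function bound \<open>u\<^sub>m(x) (1-x\<^sup>2) powr (max \<lambda> 0) \<le> B m\<close>; the moments of \<open>T\<^sub>j\<close>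
  against \<open>u\<^sub>m d\<mu>\<close> are bounded in \<open>m\<close> by a virial identity for the Gegenbauer equation, and in
  \<open>J2\<close> Bessel's inequality bounds each term. For \<open>\<lambda> = 0\<close> the same expansion evaluates every integral
  exactly, in terms of harmonic numbers.
\<close>

subsection \<open>Point processes: Campbell formulas\<close>

text \<open>Weak convergence of \<open>u m\<close> d\<mu> / (m + 1) to the arcsine law would not
  suffice: ln is unbounded, and for \<lambda> > 0 the function \<open>u m\<close> grows faster than
  m at the end points, exactly where the two extra points are put. The exponent
  \<open>max lam 0\<close> makes the Christoffel bound usable: with it the density of
  \<open>u m\<close> d\<mu> is at most a multiple of m times (1 - x^2) powr -b, and \<lambda> > -1/2
  says precisely that b < 1. This leaves room for a small power |x-y| powr -e, uniformly up to y = 1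
  and y = -1. Uniformity in y is what produces the cancellation. \<open>J1 m\<close> is the average
  of \<open>\<Phi> m\<close> against the probability density p^2, so it has the same main term -m ln
  2 as the end point values; in E1 - E2 the two increments -2 \<open>J1\<close> therefore cancel 2
  (\<open>\<Phi> n 1\<close> + \<open>\<Phi> n (- 1)\<close>) to leading order. In the approximation
  of ln the parameters r and J depend on the tolerance only and are fixed before m. Hence the
  polynomial part contributes a bounded amount, and all growth in m sits in the small
  remainder.\<close>

lemma det_mat_1: "Determinant.det (Matrix.mat 1 1 f) = f (0, 0)"
  for f :: "nat \<times> nat \<Rightarrow> 'a::comm_ring_1"
  by (subst det_single) auto

lemma det_mat_2:
  "Determinant.det (Matrix.mat 2 2 f) = f (0, 0) * f (1, 1) - f (0, 1) * f (1, 0)"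
  for f :: "nat \<times> nat \<Rightarrow> 'a::comm_ring_1"
proof -
  have "{0..<2::nat} = {0, 1}" by auto
  then show ?thesis
    by (simp add: Determinant.det_def sum_over_permutations_insert sign_swap_id
        del: One_nat_def)
qed

definition rho2 :: "(real \<Rightarrow> real \<Rightarrow> real) \<Rightarrow> real \<times> real \<Rightarrow> real" where
  "rho2 K z = K (fst z) (fst z) * K (snd z) (snd z) - K (fst z) (snd z) * K (snd z) (fst z)"

lemma sum_finite_nn_integral:
  fixes g :: "'a \<Rightarrow> ennreal"
  assumes "finite X" shows "(\<Sum>x\<in>X. g x) = (\<integral>\<^sup>+x. g x \<partial>count_space X)"
  by (simp add: assms nn_integral_count_space_finite)

text \<open>A monotone class argument from indicators to nonnegative functions. Measurability of the
  random sum is carried along with the identity, since a point process comes only with measurable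
  counts.\<close>

lemma campbell_functions:
  fixes N :: "'b measure" and \<rho> :: "'b \<Rightarrow> ennreal" and Z :: "'w \<Rightarrow> 'b set"
  assumes fin: "\<And>\<omega>. \<omega> \<in> space M \<Longrightarrow> finite (Z \<omega>)"
    and [measurable]: "\<rho> \<in> borel_measurable N" and N: "space N = UNIV"
    and sets: "\<And>A. A \<in> sets N \<Longrightarrow> (\<lambda>\<omega>. \<Sum>z\<in>Z \<omega>. indicator A z :: ennreal) \<in> borel_measurable M \<and>
      (\<integral>\<^sup>+\<omega>. (\<Sum>z\<in>Z \<omega>. indicator A z) \<partial>M) = (\<integral>\<^sup>+z. indicator A z * \<rho> z \<partial>N)"
    and g: "g \<in> borel_measurable N"
  shows "(\<lambda>\<omega>. \<Sum>z\<in>Z \<omega>. g z) \<in> borel_measurable M \<and>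
    (\<integral>\<^sup>+\<omega>. (\<Sum>z\<in>Z \<omega>. g z) \<partial>M) = (\<integral>\<^sup>+z. g z * \<rho> z \<partial>N)"
  using g
proof (induction rule: borel_measurable_induct)
  case (cong f g)
  then show ?case by (simp add: N)
next
  case (set A)
  then show ?case by (rule sets)
next
  case (mult u c)
  note [measurable] = mult(2) conjunct1[OF mult(4)]
  have "(\<lambda>\<omega>. c * (\<Sum>z\<in>Z \<omega>. u z)) \<in> borel_measurable M"
    by measurable
  with mult show ?case
    by (simp add: sum_distrib_left[symmetric] nn_integral_cmult mult.assoc)
next
  case (add u v)
  note [measurable] = add.hyps(1,3) conjunct1[OF add.IH(1)] conjunct1[OF add.IH(2)]
  have "(\<lambda>\<omega>. (\<Sum>z\<in>Z \<omega>. v z) + (\<Sum>z\<in>Z \<omega>. u z)) \<in> borel_measurable M"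
    by measurable
  with add show ?case
    by (simp add: sum.distrib nn_integral_add distrib_right)
next
  case (seq U)
  note [measurable] = seq(1)
  \<comment> \<open>A finite sum is an integral over counting measure, so monotone convergence
    exchanges it with the supremum.\<close>
  have *: "(\<Sum>z\<in>Z \<omega>. (SUP i. U i) z) = (SUP i. \<Sum>z\<in>Z \<omega>. U i z)" if "\<omega> \<in> space M" for \<omega>
    using fin[OF that] seq(3)
    by (simp add: sum_finite_nn_integral SUP_apply[abs_def] nn_integral_monotone_convergence_SUP image_image)
  have inc: "incseq (\<lambda>i \<omega>. \<Sum>z\<in>Z \<omega>. U i z)"
    using seq(3) by (auto simp: incseq_def le_fun_def intro!: sum_mono)
  have m: "(\<lambda>\<omega>. \<Sum>z\<in>Z \<omega>. U i z) \<in> borel_measurable M" for i using seq by auto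
  have "(\<integral>\<^sup>+\<omega>. (\<Sum>z\<in>Z \<omega>. (SUP i. U i) z) \<partial>M) = (\<integral>\<^sup>+\<omega>. (SUP i. \<Sum>z\<in>Z \<omega>. U i z) \<partial>M)"
    by (rule nn_integral_cong) (rule *)
  also have "\<dots> = (SUP i. \<integral>\<^sup>+\<omega>. (\<Sum>z\<in>Z \<omega>. U i z) \<partial>M)"
    by (rule nn_integral_monotone_convergence_SUP[OF inc m])
  also have "\<dots> = (SUP i. \<integral>\<^sup>+z. U i z * \<rho> z \<partial>N)" using seq by simp
  also have "\<dots> = (\<integral>\<^sup>+z. (SUP i. U i z * \<rho> z) \<partial>N)"
    using seq(3) by (intro nn_integral_monotone_convergence_SUP[symmetric])
      (auto simp: incseq_def le_fun_def intro!: mult_right_mono)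
  also have "\<dots> = (\<integral>\<^sup>+z. (SUP i. U i) z * \<rho> z \<partial>N)"
    by (simp add: SUP_mult_right_ennreal[symmetric] image_image)
  finally have "(\<integral>\<^sup>+\<omega>. (\<Sum>z\<in>Z \<omega>. (SUP i. U i) z) \<partial>M) = (\<integral>\<^sup>+z. (SUP i. U i) z * \<rho> z \<partial>N)" .
  moreover have "(\<lambda>\<omega>. \<Sum>z\<in>Z \<omega>. (SUP i. U i) z) \<in> borel_measurable M"
    using m by (subst measurable_cong[OF *]) auto
  ultimately show ?case by simp
qed

text \<open>The assumption \<open>rho2_finite\<close> makes the subtraction in the complement step
  of the Dynkin argument below legitimate in \<open>ennreal\<close>.\<close>

locale dpp =
  fixes M :: "'w measure" and S :: "real set" and \<mu> :: "real measure"
    and K :: "real \<Rightarrow> real \<Rightarrow> real" and X :: "'w \<Rightarrow> real set"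
  assumes dpp: "determinantal_point_process M S \<mu> K X"
    and sets_mu [measurable_cong]: "sets \<mu> = sets borel"
    and sf: "sigma_finite_measure \<mu>"
    and K_measurable [measurable]: "case_prod K \<in> borel_measurable (borel \<Otimes>\<^sub>M borel)"
    and rho2_finite: "(\<integral>\<^sup>+z. ennreal (rho2 K z) \<partial>(\<mu> \<Otimes>\<^sub>M \<mu>)) < \<infinity>"
begin

sublocale prob_space M
  using dpp by (simp add: determinantal_point_process_def simple_point_process_def)

sublocale mu: sigma_finite_measure \<mu> by (rule sf)
sublocale mu2: pair_sigma_finite \<mu> \<mu> ..
sublocale mup: product_sigma_finite "\<lambda>_::nat. \<mu>" ..

lemma space_mu [simp]: "space \<mu> = UNIV"
  using sets_eq_imp_space_eq[OF sets_mu] by simp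

lemma X_finite: "\<omega> \<in> space M \<Longrightarrow> finite (X \<omega>)"
  using dpp by (simp add: determinantal_point_process_def simple_point_process_def)

lemma card_measurable [measurable]:
  "B \<in> sets borel \<Longrightarrow> (\<lambda>\<omega>. card (X \<omega> \<inter> B)) \<in> measurable M (count_space UNIV)"
  using dpp by (simp add: determinantal_point_process_def simple_point_process_def)

lemma intensities:
  assumes "\<And>i. i < k \<Longrightarrow> D i \<in> sets borel" "disjoint_family_on D {..<k}"
  shows "(\<integral>\<^sup>+\<omega>. (\<Prod>i<k. of_nat (card (X \<omega> \<inter> D i))) \<partial>M) =
        (\<integral>\<^sup>+x \<in> PiE {..<k} D. ennreal (Determinant.det (Matrix.mat k k (\<lambda>(i, j). K (x i) (x j))))
           \<partial>PiM {..<k} (\<lambda>_. \<mu>))"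
  using dpp assms by (simp add: determinantal_point_process_def)

lemma rho2_measurable [measurable]: "rho2 K \<in> borel_measurable (borel \<Otimes>\<^sub>M borel)"
  unfolding rho2_def[abs_def] by measurable

lemma intensity1:
  assumes [measurable]: "D \<in> sets borel"
  shows "(\<integral>\<^sup>+\<omega>. of_nat (card (X \<omega> \<inter> D)) \<partial>M) = (\<integral>\<^sup>+x. ennreal (K x x) * indicator D x \<partial>\<mu>)"
proof -
  have [measurable]: "(\<lambda>x. ennreal (K x x) * indicator D x) \<in> borel_measurable \<mu>"
    by measurable
  have eq: "{..<1::nat} = {0}" by auto
  have "(\<integral>\<^sup>+\<omega>. of_nat (card (X \<omega> \<inter> D)) \<partial>M) =
      (\<integral>\<^sup>+x \<in> PiE {..<1} (\<lambda>_. D). ennreal (Determinant.det (Matrix.mat 1 1 (\<lambda>(i, j). K (x i) (x j))))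
           \<partial>PiM {..<1::nat} (\<lambda>_. \<mu>))"
    using intensities[of 1 "\<lambda>_. D"] by (simp add: disjoint_family_on_def)
  also have "\<dots> = (\<integral>\<^sup>+x. ennreal (K (x 0) (x 0)) * indicator D (x 0) \<partial>PiM {0::nat} (\<lambda>_. \<mu>))"
    unfolding eq
    by (intro nn_integral_cong) (auto simp: det_mat_1[unfolded One_nat_def] space_PiM PiE_def indicator_def Pi_def)
  also have "\<dots> = (\<integral>\<^sup>+x. ennreal (K x x) * indicator D x \<partial>\<mu>)"
    by (rule mup.product_nn_integral_singleton) simp
  finally show ?thesis .
qed

lemma intensity2:
  assumes [measurable]: "D \<in> sets borel" "D' \<in> sets borel" and disj: "D \<inter> D' = {}"
  shows "(\<integral>\<^sup>+\<omega>. of_nat (card (X \<omega> \<inter> D)) * of_nat (card (X \<omega> \<inter> D')) \<partial>M)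
    = (\<integral>\<^sup>+z. ennreal (rho2 K z) * indicator (D \<times> D') z \<partial>(\<mu> \<Otimes>\<^sub>M \<mu>))"
proof -
  define E where "E = (\<lambda>i::nat. if i = 0 then D else D')"
  have eq: "{..<2::nat} = {0, 1}" by auto
  have "(\<integral>\<^sup>+\<omega>. of_nat (card (X \<omega> \<inter> D)) * of_nat (card (X \<omega> \<inter> D')) \<partial>M) =
      (\<integral>\<^sup>+x \<in> PiE {..<2} E. ennreal (Determinant.det (Matrix.mat 2 2 (\<lambda>(i, j). K (x i) (x j))))
           \<partial>PiM {..<2::nat} (\<lambda>_. \<mu>))"
    using intensities[of 2 E] disj assms
    by (simp add: disjoint_family_on_def E_def eq Int_commute)
  also have "\<dots> = (\<integral>\<^sup>+x. ennreal (rho2 K (x 0, x 1)) * indicator (D \<times> D') (x 0, x 1) \<partial>PiM {0, 1::nat} (\<lambda>_. \<mu>))"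
    unfolding eq
    by (intro nn_integral_cong)
       (auto simp: det_mat_2 rho2_def E_def space_PiM PiE_def indicator_def Pi_def)
  also have "\<dots> = (\<integral>\<^sup>+z. (\<lambda>x y. ennreal (rho2 K (x, y)) * indicator (D \<times> D') (x, y)) (fst z) (snd z) \<partial>(\<mu> \<Otimes>\<^sub>M \<mu>))"
    by (rule mup.product_nn_integral_pair) auto
  finally show ?thesis by simp
qed

lemma campbell1:
  assumes "g \<in> borel_measurable \<mu>"
  shows "(\<lambda>\<omega>. \<Sum>x\<in>X \<omega>. g x) \<in> borel_measurable M \<and>
    (\<integral>\<^sup>+\<omega>. (\<Sum>x\<in>X \<omega>. g x) \<partial>M) = (\<integral>\<^sup>+x. g x * ennreal (K x x) \<partial>\<mu>)"
proof (rule campbell_functions[OF X_finite _ space_mu _ assms])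
  fix A assume "A \<in> sets \<mu>"
  then have A [measurable]: "A \<in> sets borel" by (simp add: sets_mu)
  have "(\<Sum>x\<in>X \<omega>. indicator A x) = (of_nat (card (X \<omega> \<inter> A)) :: ennreal)" if "\<omega> \<in> space M" for \<omega>
    using X_finite[OF that] by (simp add: sum.If_cases indicator_def)
  then show "(\<lambda>\<omega>. \<Sum>x\<in>X \<omega>. indicator A x :: ennreal) \<in> borel_measurable M \<and>
      (\<integral>\<^sup>+\<omega>. (\<Sum>x\<in>X \<omega>. indicator A x) \<partial>M) = (\<integral>\<^sup>+x. indicator A x * ennreal (K x x) \<partial>\<mu>)"
    using intensity1[OF A] by (simp cong: measurable_cong nn_integral_cong add: mult.commute)
qed measurable

text \<open>The joint intensities are given only on products of disjoint sets. Inside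
  \<open>I \<times> J\<close> with disjoint sides every rectangle is of this kind, so the rectangles
  form an intersection-stable generator on which the formula is known, and Dynkin's theorem gives
  all Borel sets.\<close>

lemma campbell2_rect_set:
  assumes I [measurable]: "I \<in> sets borel" and J [measurable]: "J \<in> sets borel" and disj: "I \<inter> J = {}"
    and A: "A \<in> sets (borel \<Otimes>\<^sub>M borel)"
  shows "(\<lambda>\<omega>. \<Sum>z\<in>X \<omega> \<times> X \<omega> \<inter> I \<times> J. indicator A z :: ennreal) \<in> borel_measurable M \<and>
    (\<integral>\<^sup>+\<omega>. (\<Sum>z\<in>X \<omega> \<times> X \<omega> \<inter> I \<times> J. indicator A z) \<partial>M) =
    (\<integral>\<^sup>+z. indicator A z * (ennreal (rho2 K z) * indicator (I \<times> J) z) \<partial>(\<mu> \<Otimes>\<^sub>M \<mu>))"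
  (is "?N A \<in> _ \<and> ?L A = ?R A")
proof -
  let ?G = "{a \<times> b | a b. a \<in> sets (borel :: real measure) \<and> b \<in> sets (borel :: real measure)}"
  have A': "A \<in> sigma_sets UNIV ?G"
    using A by (simp add: sets_pair_measure)
  have meas: "B \<in> sets (borel \<Otimes>\<^sub>M borel)" if "B \<in> sigma_sets UNIV ?G" for B
    using that by (simp add: sets_pair_measure)
  have G: "Int_stable ?G" by (rule Int_stable_pair_measure_generator)
  have rect: "?N (a \<times> b) \<in> borel_measurable M \<and> ?L (a \<times> b) = ?R (a \<times> b)"
    if [measurable]: "a \<in> sets borel" "b \<in> sets borel" for a b
  proof -
    have N: "?N (a \<times> b) \<omega> = of_nat (card (X \<omega> \<inter> (I \<inter> a))) * of_nat (card (X \<omega> \<inter> (J \<inter> b)))"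
      if "\<omega> \<in> space M" for \<omega>
    proof -
      have "?N (a \<times> b) \<omega> = of_nat (card ((X \<omega> \<times> X \<omega> \<inter> I \<times> J) \<inter> (a \<times> b)))"
        using X_finite[OF that] by (simp add: sum.If_cases indicator_def)
      also have "(X \<omega> \<times> X \<omega> \<inter> I \<times> J) \<inter> (a \<times> b) = (X \<omega> \<inter> (I \<inter> a)) \<times> (X \<omega> \<inter> (J \<inter> b))"
        by auto
      finally show ?thesis by (simp add: card_cartesian_product)
    qed
    have "?L (a \<times> b) = (\<integral>\<^sup>+z. ennreal (rho2 K z) * indicator ((I \<inter> a) \<times> (J \<inter> b)) z \<partial>(\<mu> \<Otimes>\<^sub>M \<mu>))"
      using disj by (subst intensity2[symmetric]) (auto intro!: nn_integral_cong simp: N)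
    also have "\<dots> = ?R (a \<times> b)"
      by (intro nn_integral_cong) (auto simp: indicator_def)
    finally show ?thesis by (simp cong: measurable_cong add: N)
  qed
  have U: "UNIV = (UNIV \<times> UNIV :: (real \<times> real) set)" by simp
  have G': "?G \<subseteq> Pow UNIV" by simp
  from G G' A' show ?thesis
  proof (induction rule: sigma_sets_induct_disjoint)
    case (basic A)
    then show ?case using rect by auto
  next
    case empty
    then show ?case by simp
  next
    case (compl A)
    note [measurable] = meas[OF compl(1)]
    have U': "?N UNIV \<in> borel_measurable M \<and> ?L UNIV = ?R UNIV"
      unfolding U by (rule rect) auto
    have fin: "?R A < \<infinity>"
      by (rule le_less_trans[OF nn_integral_mono rho2_finite]) (auto simp: indicator_def)
    \<comment> \<open>Cancellation in \<open>ennreal\<close> needs finite values: configurations are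
      finite, and the integrals are finite by \<open>rho2_finite\<close>.\<close>
    have N: "?N (UNIV - A) \<omega> = ?N UNIV \<omega> - ?N A \<omega>" if "\<omega> \<in> space M" for \<omega>
    proof -
      have "?N UNIV \<omega> = ?N (UNIV - A) \<omega> + ?N A \<omega>"
        unfolding sum.distrib[symmetric] by (intro sum.cong) (auto simp: indicator_def)
      moreover have "?N A \<omega> < \<infinity>" using X_finite[OF that]
        by (auto simp: indicator_def of_nat_less_top)
      ultimately show ?thesis by (simp add: ennreal_add_diff_cancel_right)
    qed
    have le: "?N A \<omega> \<le> ?N UNIV \<omega>" for \<omega> by (intro sum_mono) (auto simp: indicator_def)
    have "?L (UNIV - A) = (\<integral>\<^sup>+\<omega>. ?N UNIV \<omega> - ?N A \<omega> \<partial>M)"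
      by (rule nn_integral_cong) (rule N)
    also have "\<dots> = ?L UNIV - ?L A"
      using U' compl fin by (intro nn_integral_diff AE_I2 le) auto
    also have "\<dots> = ?R UNIV - ?R A" using U' compl by simp
    also have "\<dots> = (\<integral>\<^sup>+z. indicator UNIV z * (ennreal (rho2 K z) * indicator (I \<times> J) z)
         - indicator A z * (ennreal (rho2 K z) * indicator (I \<times> J) z) \<partial>(\<mu> \<Otimes>\<^sub>M \<mu>))"
      using fin by (intro nn_integral_diff[symmetric]) (auto simp: indicator_def)
    also have "\<dots> = ?R (UNIV - A)"
      by (intro nn_integral_cong) (auto simp: indicator_def)
    finally have "?L (UNIV - A) = ?R (UNIV - A)" .
    moreover note [measurable] = conjunct1[OF U'] conjunct1[OF compl(2)]
    have "(\<lambda>\<omega>. ?N UNIV \<omega> - ?N A \<omega>) \<in> borel_measurable M" by measurable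
    then have "?N (UNIV - A) \<in> borel_measurable M"
      by (subst measurable_cong[OF N])
    ultimately show ?case by blast
  next
    case (union A)
    have [measurable]: "A i \<in> sets (borel \<Otimes>\<^sub>M borel)" for i
      using union(2) by (intro meas) auto
    have ind: "indicator (\<Union>i. A i) z = (\<Sum>i. indicator (A i) z :: ennreal)" for z
      using suminf_indicator[OF union(1)] by simp
    have N: "?N (\<Union>i. A i) \<omega> = (\<Sum>i. ?N (A i) \<omega>)" for \<omega>
      unfolding ind by (rule suminf_sum[symmetric]) auto
    have "?L (\<Union>i. A i) = (\<Sum>i. ?L (A i))"
      unfolding N using union(3) by (intro nn_integral_suminf) auto
    also have "\<dots> = (\<Sum>i. ?R (A i))" using union(3) by simp
    also have "\<dots> = ?R (\<Union>i. A i)"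
      unfolding ind ennreal_suminf_multc[symmetric] by (intro nn_integral_suminf[symmetric]) auto
    finally have "?L (\<Union>i. A i) = ?R (\<Union>i. A i)" .
    moreover note [measurable] = conjunct1[OF union(3)]
    have "?N (\<Union>i. A i) \<in> borel_measurable M"
      unfolding N by measurable
    ultimately show ?case by blast
  qed
qed

lemma campbell2_rect:
  assumes I [measurable]: "I \<in> sets borel" and J [measurable]: "J \<in> sets borel" and disj: "I \<inter> J = {}"
    and g: "g \<in> borel_measurable (\<mu> \<Otimes>\<^sub>M \<mu>)"
  shows "(\<lambda>\<omega>. \<Sum>z\<in>X \<omega> \<times> X \<omega> \<inter> I \<times> J. g z :: ennreal) \<in> borel_measurable M \<and>
    (\<integral>\<^sup>+\<omega>. (\<Sum>z\<in>X \<omega> \<times> X \<omega> \<inter> I \<times> J. g z) \<partial>M) =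
    (\<integral>\<^sup>+z. g z * (ennreal (rho2 K z) * indicator (I \<times> J) z) \<partial>(\<mu> \<Otimes>\<^sub>M \<mu>))"
proof (rule campbell_functions[OF _ _ _ _ g])
  fix A assume "A \<in> sets (\<mu> \<Otimes>\<^sub>M \<mu>)"
  then have "A \<in> sets (borel \<Otimes>\<^sub>M borel)"
    by (simp cong: sets_pair_measure_cong add: sets_mu)
  then show "(\<lambda>\<omega>. \<Sum>z\<in>X \<omega> \<times> X \<omega> \<inter> I \<times> J. indicator A z :: ennreal) \<in> borel_measurable M \<and>
    (\<integral>\<^sup>+\<omega>. (\<Sum>z\<in>X \<omega> \<times> X \<omega> \<inter> I \<times> J. indicator A z) \<partial>M) =
    (\<integral>\<^sup>+z. indicator A z * (ennreal (rho2 K z) * indicator (I \<times> J) z) \<partial>(\<mu> \<Otimes>\<^sub>M \<mu>))"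
    by (rule campbell2_rect_set[OF I J disj])
qed (auto simp: X_finite space_pair_measure)

end

text \<open>Two distinct reals are separated by a rational q, hence lie in two complementary
  half-lines cut at q; countably many q suffice.\<close>

lemma off_diagonal_rectangles:
  obtains I J :: "nat \<Rightarrow> real set"
  where "\<And>i. I i \<in> sets borel" "\<And>i. J i \<in> sets borel" "\<And>i. I i \<inter> J i = {}"
    and "(\<Union>i. I i \<times> J i) = {z. fst z \<noteq> snd z}"
proof -
  define R where "R = (\<lambda>q::real. ({..<q}, {q..})) ` \<rat> \<union> (\<lambda>q::real. ({q..}, {..<q})) ` \<rat>"
  have c: "countable R" unfolding R_def by (intro countable_Un countable_image countable_rat)
  have ne: "R \<noteq> {}" unfolding R_def using Rats_0 by blast
  define f where "f = from_nat_into R"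
  have f: "range f = R" unfolding f_def using c ne by (rule range_from_nat_into[rotated])
  have fi: "f i \<in> R" for i using f by auto
  show ?thesis
  proof
    show "fst (f i) \<in> sets borel" "snd (f i) \<in> sets borel" "fst (f i) \<inter> snd (f i) = {}" for i
      using fi[of i] by (auto simp: R_def)
    have "(\<Union>i. fst (f i) \<times> snd (f i)) = (\<Union>r\<in>R. fst r \<times> snd r)"
      unfolding f[symmetric] by auto
    also have "\<dots> = {z. fst z \<noteq> snd z}"
    proof safe
      fix x y :: real assume "fst (x, y) \<noteq> snd (x, y)"
      then consider "x < y" | "y < x" by fastforce
      then show "(x, y) \<in> (\<Union>r\<in>R. fst r \<times> snd r)"
      proof cases
        case 1
        then obtain q where "q \<in> \<rat>" "x < q" "q < y" using Rats_dense_in_real by blast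
        then show ?thesis unfolding R_def by (intro UN_I[of "({..<q}, {q..})"]) auto
      next
        case 2
        then obtain q where "q \<in> \<rat>" "y < q" "q < x" using Rats_dense_in_real by blast
        then show ?thesis unfolding R_def by (intro UN_I[of "({q..}, {..<q})"]) auto
      qed
    qed (auto simp: R_def)
    finally show "(\<Union>i. fst (f i) \<times> snd (f i)) = {z. fst z \<noteq> snd z}" .
  qed
qed

context dpp
begin

text \<open>The covering rectangles are made disjoint. The pieces \<open>B i\<close> are no longer
  rectangles, but each lies inside one, so \<open>campbell2_rect\<close> applies to \<open>g\<close>
  cut off by the indicator of \<open>B i\<close>.\<close>

lemma campbell2:
  assumes g [measurable]: "g \<in> borel_measurable (\<mu> \<Otimes>\<^sub>M \<mu>)"
  shows "(\<lambda>\<omega>. \<Sum>z\<in>{z\<in>X \<omega> \<times> X \<omega>. fst z \<noteq> snd z}. g z :: ennreal) \<in> borel_measurable M \<and>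
    (\<integral>\<^sup>+\<omega>. (\<Sum>z\<in>{z\<in>X \<omega> \<times> X \<omega>. fst z \<noteq> snd z}. g z) \<partial>M) =
    (\<integral>\<^sup>+z. g z * ennreal (rho2 K z) \<partial>(\<mu> \<Otimes>\<^sub>M \<mu>))"
proof -
  obtain I J :: "nat \<Rightarrow> real set" where I [measurable]: "\<And>i. I i \<in> sets borel" and J [measurable]: "\<And>i. J i \<in> sets borel"
    and disj: "\<And>i. I i \<inter> J i = {}" and UN: "(\<Union>i. I i \<times> J i) = {z. fst z \<noteq> snd z}"
    by (rule off_diagonal_rectangles) (rule that)
  define B where "B = disjointed (\<lambda>i. I i \<times> J i)"
  have B [measurable]: "B i \<in> sets (borel \<Otimes>\<^sub>M borel)" for i
    unfolding B_def disjointed_def by measurable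
  have Bs: "indicator (B i) z * indicator (I i \<times> J i) z = (indicator (B i) z :: ennreal)" for i z
    unfolding B_def disjointed_def by (auto simp: indicator_def)
  have Bsum: "(\<Sum>i. indicator (B i) z * c) = (if fst z \<noteq> snd z then c else 0)" for z and c :: ennreal
  proof -
    have "(\<Sum>i. indicator (B i) z * c) = indicator (\<Union>i. B i) z * c"
      using suminf_indicator[OF disjoint_family_disjointed[of "\<lambda>i. I i \<times> J i"], folded B_def, of z]
      by simp
    also have "(\<Union>i. B i) = {z. fst z \<noteq> snd z}"
      unfolding B_def UN_disjointed_eq UN ..
    finally show ?thesis by (auto simp: indicator_def)
  qed
  have *: "(\<lambda>\<omega>. \<Sum>z\<in>X \<omega> \<times> X \<omega>. indicator (B i) z * g z :: ennreal) \<in> borel_measurable M \<and>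
    (\<integral>\<^sup>+\<omega>. (\<Sum>z\<in>X \<omega> \<times> X \<omega>. indicator (B i) z * g z) \<partial>M) =
    (\<integral>\<^sup>+z. indicator (B i) z * (g z * ennreal (rho2 K z)) \<partial>(\<mu> \<Otimes>\<^sub>M \<mu>))" for i
  proof -
    have "indicator (B i) z * g z * (ennreal (rho2 K z) * indicator (I i \<times> J i) z)
        = indicator (B i) z * indicator (I i \<times> J i) z * (g z * ennreal (rho2 K z))" for z
      by (simp only: mult_ac)
    then have e: "indicator (B i) z * g z * (ennreal (rho2 K z) * indicator (I i \<times> J i) z)
        = indicator (B i) z * (g z * ennreal (rho2 K z))" for z unfolding Bs .
    have "(\<Sum>z\<in>X \<omega> \<times> X \<omega> \<inter> I i \<times> J i. indicator (B i) z * g z) = (\<Sum>z\<in>X \<omega> \<times> X \<omega>. indicator (B i) z * g z)"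
      if "\<omega> \<in> space M" for \<omega>
      using X_finite[OF that]
      by (intro sum.mono_neutral_left) (auto simp: B_def disjointed_def indicator_def)
    then show ?thesis
      using campbell2_rect[OF I[of i] J[of i] disj[of i], of "\<lambda>z. indicator (B i) z * g z"]
      by (simp add: e cong: measurable_cong nn_integral_cong)
  qed
  have N: "(\<Sum>z\<in>{z\<in>X \<omega> \<times> X \<omega>. fst z \<noteq> snd z}. g z) = (\<Sum>i. \<Sum>z\<in>X \<omega> \<times> X \<omega>. indicator (B i) z * g z)"
    if "\<omega> \<in> space M" for \<omega>
  proof -
    have "(\<Sum>i. \<Sum>z\<in>X \<omega> \<times> X \<omega>. indicator (B i) z * g z) = (\<Sum>z\<in>X \<omega> \<times> X \<omega>. \<Sum>i. indicator (B i) z * g z)"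
      by (rule suminf_sum) auto
    also have "\<dots> = (\<Sum>z\<in>{z\<in>X \<omega> \<times> X \<omega>. fst z \<noteq> snd z}. g z)"
      unfolding Bsum using X_finite[OF that] by (intro sum.inter_filter[symmetric]) auto
    finally show ?thesis ..
  qed
  have "(\<integral>\<^sup>+\<omega>. (\<Sum>z\<in>{z\<in>X \<omega> \<times> X \<omega>. fst z \<noteq> snd z}. g z) \<partial>M) =
     (\<integral>\<^sup>+\<omega>. (\<Sum>i. \<Sum>z\<in>X \<omega> \<times> X \<omega>. indicator (B i) z * g z) \<partial>M)"
    by (rule nn_integral_cong) (rule N)
  also have "\<dots> = (\<Sum>i. \<integral>\<^sup>+\<omega>. (\<Sum>z\<in>X \<omega> \<times> X \<omega>. indicator (B i) z * g z) \<partial>M)"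
    using * by (intro nn_integral_suminf) auto
  also have "\<dots> = (\<Sum>i. \<integral>\<^sup>+z. indicator (B i) z * (g z * ennreal (rho2 K z)) \<partial>(\<mu> \<Otimes>\<^sub>M \<mu>))"
    using * by simp
  also have "\<dots> = (\<integral>\<^sup>+z. (\<Sum>i. indicator (B i) z * (g z * ennreal (rho2 K z))) \<partial>(\<mu> \<Otimes>\<^sub>M \<mu>))"
    by (intro nn_integral_suminf[symmetric]) auto
  also have "\<dots> = (\<integral>\<^sup>+z. g z * ennreal (rho2 K z) \<partial>(\<mu> \<Otimes>\<^sub>M \<mu>))"
    \<comment> \<open>On the diagonal the two-point intensity vanishes (a determinant with equal
      rows), so the missing diagonal costs nothing.\<close>
    unfolding Bsum by (intro nn_integral_cong) (auto simp: rho2_def)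
  finally have 1: "(\<integral>\<^sup>+\<omega>. (\<Sum>z\<in>{z\<in>X \<omega> \<times> X \<omega>. fst z \<noteq> snd z}. g z) \<partial>M) =
    (\<integral>\<^sup>+z. g z * ennreal (rho2 K z) \<partial>(\<mu> \<Otimes>\<^sub>M \<mu>))" .
  have "(\<lambda>\<omega>. \<Sum>i. \<Sum>z\<in>X \<omega> \<times> X \<omega>. indicator (B i) z * g z) \<in> borel_measurable M"
    using * by (intro borel_measurable_suminf_order) auto
  then have "(\<lambda>\<omega>. \<Sum>z\<in>{z\<in>X \<omega> \<times> X \<omega>. fst z \<noteq> snd z}. g z) \<in> borel_measurable M"
    by (subst measurable_cong[OF N])
  then show ?thesis using 1 by blast
qed

end

text \<open>Hypothesis \<open>C\<close> has the shape shared by \<open>campbell1\<close> and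
  \<open>campbell2\<close>, so one passage from nonnegative to integrable functions serves the
  one-point and the two-point formula.\<close>

lemma campbell_real:
  fixes f :: "'b \<Rightarrow> real"
  assumes C: "\<And>g::'b \<Rightarrow> ennreal. g \<in> borel_measurable N \<Longrightarrow> (\<lambda>\<omega>. \<Sum>z\<in>Z \<omega>. g z) \<in> borel_measurable M \<and>
      (\<integral>\<^sup>+\<omega>. (\<Sum>z\<in>Z \<omega>. g z) \<partial>M) = (\<integral>\<^sup>+z. g z * ennreal (\<rho> z) \<partial>N)"
    and rho: "\<rho> \<in> borel_measurable N" "\<And>z. \<rho> z \<ge> 0"
    and f [measurable]: "f \<in> borel_measurable N" and int: "integrable N (\<lambda>z. f z * \<rho> z)"
  shows "integrable M (\<lambda>\<omega>. \<Sum>z\<in>Z \<omega>. f z)" "(\<integral>\<omega>. (\<Sum>z\<in>Z \<omega>. f z) \<partial>M) = (\<integral>z. f z * \<rho> z \<partial>N)"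
proof -
  note [measurable] = rho(1)
  have nn: "integrable M (\<lambda>\<omega>. \<Sum>z\<in>Z \<omega>. g z) \<and> (\<integral>\<omega>. (\<Sum>z\<in>Z \<omega>. g z) \<partial>M) = (\<integral>z. g z * \<rho> z \<partial>N)"
    if [measurable]: "g \<in> borel_measurable N" and g0: "\<And>z. g z \<ge> 0" and gi: "integrable N (\<lambda>z. g z * \<rho> z)"
    for g :: "'b \<Rightarrow> real"
  proof -
    have e: "(\<Sum>z\<in>Z \<omega>. ennreal (g z)) = ennreal (\<Sum>z\<in>Z \<omega>. g z)" for \<omega>
      using g0 by (simp add: sum_ennreal)
    have "(\<lambda>\<omega>. \<Sum>z\<in>Z \<omega>. ennreal (g z)) \<in> borel_measurable M" using C[of "\<lambda>z. ennreal (g z)"] by simp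
    then have "(\<lambda>\<omega>. enn2real (\<Sum>z\<in>Z \<omega>. ennreal (g z))) \<in> borel_measurable M" by measurable
    then have m: "(\<lambda>\<omega>. \<Sum>z\<in>Z \<omega>. g z) \<in> borel_measurable M"
      using g0 by (simp add: e sum_nonneg)
    have "(\<integral>\<^sup>+\<omega>. ennreal (\<Sum>z\<in>Z \<omega>. g z) \<partial>M) = (\<integral>\<^sup>+z. ennreal (g z * \<rho> z) \<partial>N)"
      using C[of "\<lambda>z. ennreal (g z)"] by (simp add: e ennreal_mult' g0)
    also have "\<dots> = ennreal (\<integral>z. g z * \<rho> z \<partial>N)"
      using gi g0 rho(2) by (intro nn_integral_eq_integral) auto
    finally have h: "(\<integral>\<^sup>+\<omega>. ennreal (\<Sum>z\<in>Z \<omega>. g z) \<partial>M) = ennreal (\<integral>z. g z * \<rho> z \<partial>N)" .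
    have "integrable M (\<lambda>\<omega>. \<Sum>z\<in>Z \<omega>. g z)"
      using m h g0 by (intro integrableI_nonneg) (auto intro!: AE_I2 sum_nonneg)
    moreover have "(\<integral>\<omega>. (\<Sum>z\<in>Z \<omega>. g z) \<partial>M) = (\<integral>z. g z * \<rho> z \<partial>N)"
      using h m g0 rho(2)
      by (subst integral_eq_nn_integral) (auto intro!: AE_I2 sum_nonneg integral_nonneg_AE)
    ultimately show ?thesis by simp
  qed
  have i1: "integrable N (\<lambda>z. max (f z) 0 * \<rho> z)"
    by (rule Bochner_Integration.integrable_bound[OF int])
       (auto intro!: AE_I2 mult_right_mono simp: abs_mult rho(2))
  have i2: "integrable N (\<lambda>z. max (- f z) 0 * \<rho> z)"
    by (rule Bochner_Integration.integrable_bound[OF int])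
       (auto intro!: AE_I2 mult_right_mono simp: abs_mult rho(2))
  have n1: "integrable M (\<lambda>\<omega>. \<Sum>z\<in>Z \<omega>. max (f z) 0)" "(\<integral>\<omega>. (\<Sum>z\<in>Z \<omega>. max (f z) 0) \<partial>M) = (\<integral>z. max (f z) 0 * \<rho> z \<partial>N)"
    using nn[of "\<lambda>z. max (f z) 0"] i1 by auto
  have n2: "integrable M (\<lambda>\<omega>. \<Sum>z\<in>Z \<omega>. max (- f z) 0)" "(\<integral>\<omega>. (\<Sum>z\<in>Z \<omega>. max (- f z) 0) \<partial>M) = (\<integral>z. max (- f z) 0 * \<rho> z \<partial>N)"
    using nn[of "\<lambda>z. max (- f z) 0"] i2 by auto
  have s: "(\<Sum>z\<in>Z \<omega>. f z) = (\<Sum>z\<in>Z \<omega>. max (f z) 0) - (\<Sum>z\<in>Z \<omega>. max (- f z) 0)" for \<omega>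
    unfolding sum_subtractf[symmetric] by (intro sum.cong) auto
  show "integrable M (\<lambda>\<omega>. \<Sum>z\<in>Z \<omega>. f z)" unfolding s using n1 n2 by simp
  have "(\<integral>\<omega>. (\<Sum>z\<in>Z \<omega>. f z) \<partial>M) = (\<integral>z. max (f z) 0 * \<rho> z \<partial>N) - (\<integral>z. max (- f z) 0 * \<rho> z \<partial>N)"
    unfolding s using n1 n2 by simp
  also have "\<dots> = (\<integral>z. max (f z) 0 * \<rho> z - max (- f z) 0 * \<rho> z \<partial>N)"
    using i1 i2 by simp
  also have "\<dots> = (\<integral>z. f z * \<rho> z \<partial>N)"
    by (intro Bochner_Integration.integral_cong) (auto simp: max_def)
  finally show "(\<integral>\<omega>. (\<Sum>z\<in>Z \<omega>. f z) \<partial>M) = (\<integral>z. f z * \<rho> z \<partial>N)" .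
qed

subsection \<open>The Gegenbauer measure\<close>

lemma nn_integral_abs_powr_finite:
  fixes c :: real
  assumes "c < 1"
  shows "\<exists>A\<ge>0. \<forall>y\<in>{-1..1::real}. (\<integral>\<^sup>+x\<in>{-1..1}. ennreal (\<bar>x - y\<bar> powr - c) \<partial>lborel) \<le> ennreal A"
proof -
  define I where "I = 2 powr (1 - c) / (1 - c)"
  have I0: "I \<ge> 0" using assms by (simp add: I_def)
  have hi: "((\<lambda>x. x powr - c) has_integral I) {0..2}"
    using has_integral_powr_from_0[of "- c" 2] assms by (simp add: I_def)
  have "((\<lambda>x. if x \<in> {0..2} then x powr - c else 0) has_integral I) UNIV"
    using hi by (subst has_integral_restrict_UNIV)
  then have h1: "(\<integral>\<^sup>+x. ennreal (if x \<in> {0..2} then x powr - c else 0) \<partial>lborel) = ennreal I"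
    by (intro nn_integral_has_integral_lborel) auto
  have pos: "(\<integral>\<^sup>+x\<in>{0..2}. ennreal (\<bar>x\<bar> powr - c) \<partial>lborel) = ennreal I"
    unfolding h1[symmetric] by (intro nn_integral_cong) (auto simp: indicator_def)
  have "(\<integral>\<^sup>+x\<in>{-2..0}. ennreal (\<bar>x\<bar> powr - c) \<partial>lborel)
      = \<bar>- 1 :: real\<bar> * (\<integral>\<^sup>+x. ennreal (\<bar>0 + (- 1) * x\<bar> powr - c) * indicator {-2..0} (0 + (- 1) * x) \<partial>lborel)"
    by (rule nn_integral_real_affine) auto
  also have "\<dots> = (\<integral>\<^sup>+x\<in>{0..2}. ennreal (\<bar>x\<bar> powr - c) \<partial>lborel)"
    by (simp, intro nn_integral_cong) (auto simp: indicator_def)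
  finally have neg: "(\<integral>\<^sup>+x\<in>{-2..0}. ennreal (\<bar>x\<bar> powr - c) \<partial>lborel) = ennreal I"
    using pos by simp
  show ?thesis
  proof (intro exI[of _ "I + I"] conjI ballI)
    show "I + I \<ge> 0" using I0 by simp
    fix y :: real assume y: "y \<in> {-1..1}"
    have "(\<integral>\<^sup>+x\<in>{-1..1}. ennreal (\<bar>x - y\<bar> powr - c) \<partial>lborel)
      = \<bar>1 :: real\<bar> * (\<integral>\<^sup>+x. ennreal (\<bar>(y + 1 * x) - y\<bar> powr - c) * indicator {-1..1} (y + 1 * x) \<partial>lborel)"
      by (rule nn_integral_real_affine) auto
    also have "\<dots> \<le> (\<integral>\<^sup>+x. ennreal (\<bar>x\<bar> powr - c) * indicator {-2..0} x + ennreal (\<bar>x\<bar> powr - c) * indicator {0..2} x \<partial>lborel)"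
      using y by (simp, intro nn_integral_mono) (auto simp: indicator_def)
    also have "\<dots> = ennreal I + ennreal I"
      by (subst nn_integral_add) (auto simp: pos neg)
    also have "\<dots> = ennreal (I + I)"
      by (rule ennreal_plus[symmetric, OF I0 I0])
    finally show "(\<integral>\<^sup>+x\<in>{-1..1}. ennreal (\<bar>x - y\<bar> powr - c) \<partial>lborel) \<le> ennreal (I + I)" .
  qed
qed

text \<open>Replacing the larger base by the smaller one increases the product. This decouples the
  singularity at y from those at the end points.\<close>

lemma powr_mult_powr_le_add:
  fixes u v :: real
  assumes "u \<ge> 0" "v \<ge> 0" "e \<ge> 0" "b \<ge> 0"
  shows "u powr - e * v powr - b \<le> u powr - (e + b) + v powr - (e + b)"
proof (cases "u = 0 \<or> v = 0")
  case False
  then have u: "u > 0" "v > 0" using assms by auto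
  show ?thesis
  proof (cases "u \<le> v")
    case True
    have "u powr - e * v powr - b \<le> u powr - e * u powr - b"
      using True u assms by (intro mult_left_mono powr_mono2') auto
    also have "\<dots> = u powr - (e + b)" by (simp add: powr_add[symmetric])
    finally show ?thesis using u by (simp add: add_increasing2)
  next
    case False
    have "u powr - e * v powr - b \<le> v powr - e * v powr - b"
      using False u assms by (intro mult_right_mono powr_mono2') auto
    also have "\<dots> = v powr - (e + b)" by (simp add: powr_add[symmetric])
    finally show ?thesis using u by (simp add: add_increasing)
  qed
qed auto

text \<open>In 1 - x^2 = (1 - x) (1 + x) one factor is at least 1 on each half of the interval, so
  only the nearer end point is singular.\<close>

lemma one_minus_square_powr_le:
  fixes x :: real
  assumes "x \<in> {-1..1}" "b \<ge> 0"
  shows "(1 - x\<^sup>2) powr - b \<le> \<bar>x - 1\<bar> powr - b + \<bar>x - (- 1)\<bar> powr - b"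
proof (cases "x = 1 \<or> x = - 1")
  case False
  then have x: "x < 1" "-1 < x" using assms by auto
  have eq: "1 - x\<^sup>2 = (1 - x) * (1 + x)" by (simp add: power2_eq_square algebra_simps)
  show ?thesis
  proof (cases "x \<ge> 0")
    case True
    have "1 - x \<le> 1 - x\<^sup>2" using True x mult_left_mono[of 1 "1 + x" "1 - x"] by (simp add: eq)
    then have "(1 - x\<^sup>2) powr - b \<le> (1 - x) powr - b"
      using x assms by (intro powr_mono2') auto
    then show ?thesis using x by (simp add: add_increasing2)
  next
    case False
    have "1 + x \<le> 1 - x\<^sup>2" using False x mult_right_mono[of 1 "1 - x" "1 + x"] by (simp add: eq)
    then have "(1 - x\<^sup>2) powr - b \<le> (1 + x) powr - b"
      using x assms by (intro powr_mono2') auto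
    then show ?thesis using x by (simp add: add_increasing add.commute)
  qed
qed auto

lemma nn_integral_kernel_finite:
  fixes e b :: real
  assumes "e \<ge> 0" "b \<ge> 0" "e + b < 1"
  shows "\<exists>A\<ge>0. \<forall>y\<in>{-1..1::real}.
      (\<integral>\<^sup>+x\<in>{-1..1}. ennreal (\<bar>x - y\<bar> powr - e * (1 - x\<^sup>2) powr - b) \<partial>lborel) \<le> ennreal A"
proof -
  define c where "c = e + b"
  obtain A where A: "A \<ge> 0" "\<And>y::real. y \<in> {-1..1} \<Longrightarrow>
      (\<integral>\<^sup>+x\<in>{-1..1}. ennreal (\<bar>x - y\<bar> powr - c) \<partial>lborel) \<le> ennreal A"
    using nn_integral_abs_powr_finite[of c] assms unfolding c_def by blast
  show ?thesis
  \<comment> \<open>After decoupling there are four pure singularities of exponent c = e + b: two at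
    y, one at 1 and one at -1.\<close>
  proof (intro exI[of _ "4 * A"] conjI ballI)
    show "4 * A \<ge> 0" using A by simp
    fix y :: real assume y: "y \<in> {-1..1}"
    let ?N = "\<lambda>y. \<integral>\<^sup>+x\<in>{-1..1}. ennreal (\<bar>x - y\<bar> powr - c) \<partial>lborel"
    have "\<bar>x - y\<bar> powr - e * (1 - x\<^sup>2) powr - b \<le>
        (\<bar>x - y\<bar> powr - c + \<bar>x - y\<bar> powr - c) + (\<bar>x - 1\<bar> powr - c + \<bar>x - (- 1)\<bar> powr - c)"
      if x: "x \<in> {-1..1}" for x
    proof -
      have "\<bar>x - y\<bar> powr - e * (1 - x\<^sup>2) powr - b \<le>
          \<bar>x - y\<bar> powr - e * (\<bar>x - 1\<bar> powr - b + \<bar>x - (- 1)\<bar> powr - b)"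
        using one_minus_square_powr_le[OF x \<open>b \<ge> 0\<close>] by (intro mult_left_mono) auto
      also have "\<dots> = \<bar>x - y\<bar> powr - e * \<bar>x - 1\<bar> powr - b + \<bar>x - y\<bar> powr - e * \<bar>x - (- 1)\<bar> powr - b"
        by (simp add: algebra_simps)
      also have "\<dots> \<le> (\<bar>x - y\<bar> powr - c + \<bar>x - 1\<bar> powr - c) + (\<bar>x - y\<bar> powr - c + \<bar>x - (- 1)\<bar> powr - c)"
        using powr_mult_powr_le_add[of "\<bar>x - y\<bar>" "\<bar>x - 1\<bar>" e b]
          powr_mult_powr_le_add[of "\<bar>x - y\<bar>" "\<bar>x - (- 1)\<bar>" e b] assms
        unfolding c_def by (intro add_mono) auto
      finally show ?thesis by simp
    qed
    then have "(\<integral>\<^sup>+x\<in>{-1..1}. ennreal (\<bar>x - y\<bar> powr - e * (1 - x\<^sup>2) powr - b) \<partial>lborel)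
      \<le> (\<integral>\<^sup>+x. (ennreal (\<bar>x - y\<bar> powr - c) * indicator {-1..1} x + ennreal (\<bar>x - y\<bar> powr - c) * indicator {-1..1} x) +
          (ennreal (\<bar>x - 1\<bar> powr - c) * indicator {-1..1} x + ennreal (\<bar>x - (- 1)\<bar> powr - c) * indicator {-1..1} x) \<partial>lborel)"
      by (intro nn_integral_mono) (auto simp: indicator_def ennreal_plus[symmetric] simp del: ennreal_plus intro!: ennreal_leI)
    also have "\<dots> = (?N y + ?N y) + (?N 1 + ?N (- 1))"
      by (simp add: nn_integral_add)
    also have "\<dots> \<le> (ennreal A + ennreal A) + (ennreal A + ennreal A)"
      using y by (intro add_mono A(2)) auto
    also have "\<dots> = ennreal (4 * A)"
      using A by (simp add: ennreal_plus[symmetric] del: ennreal_plus)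
    finally show "(\<integral>\<^sup>+x\<in>{-1..1}. ennreal (\<bar>x - y\<bar> powr - e * (1 - x\<^sup>2) powr - b) \<partial>lborel) \<le> ennreal (4 * A)" .
  qed
qed

definition gegenbauer_const :: "real \<Rightarrow> real" where
  "gegenbauer_const lam = Gamma (lam + 1) / (sqrt pi * Gamma (lam + 1 / 2))"

lemma gegenbauer_weight_eq:
  "gegenbauer_weight lam x = gegenbauer_const lam * (1 - x\<^sup>2) powr (lam - 1 / 2)"
  by (simp add: gegenbauer_weight_def gegenbauer_const_def)

lemma gegenbauer_const_pos: "lam > - 1 / 2 \<Longrightarrow> gegenbauer_const lam > 0"
  unfolding gegenbauer_const_def by (intro divide_pos_pos mult_pos_pos Gamma_real_pos) auto

lemma gegenbauer_const_0: "gegenbauer_const 0 = 1 / pi"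
  by (simp add: gegenbauer_const_def Gamma_one_half_real)

lemma gegenbauer_weight_measurable [measurable]: "gegenbauer_weight lam \<in> borel_measurable borel"
  unfolding gegenbauer_weight_def[abs_def] by measurable

lemma sets_gegenbauer_measure [simp, measurable_cong]: "sets (gegenbauer_measure lam) = sets borel"
  by (simp add: gegenbauer_measure_def)

lemma space_gegenbauer_measure [simp]: "space (gegenbauer_measure lam) = UNIV"
  by (simp add: gegenbauer_measure_def)

lemma measurable_gegenbauer_measure [simp]:
  "borel_measurable (gegenbauer_measure lam) = borel_measurable borel"
  by (rule measurable_cong_sets) auto

section \<open>The measure for a fixed parameter, and its Pearson relation\<close>

locale gegenbauer_param =
  fixes lam :: real
  assumes lam: "lam > - 1 / 2"
begin

abbreviation "\<mu> \<equiv> gegenbauer_measure lam"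
abbreviation "c\<^sub>w \<equiv> gegenbauer_const lam"
text \<open>The weight is at most a multiple of \<open>(1 - x\<^sup>2) powr - b\<^sub>w\<close>, and \<open>e\<^sub>w\<close> is chosen so that
  \<open>\<bar>x - y\<bar> powr - e\<^sub>w\<close> remains integrable against it, uniformly in \<open>y\<close>.\<close>

definition "b\<^sub>w = 1 / 2 - min lam 0"
definition "e\<^sub>w = (1 - b\<^sub>w) / 2"

lemma c_pos: "c\<^sub>w > 0" using gegenbauer_const_pos[OF lam] .

lemma b_e: "b\<^sub>w > 0" "e\<^sub>w > 0" "e\<^sub>w + b\<^sub>w < 1" "e\<^sub>w \<le> 1"
  using lam by (auto simp: b\<^sub>w_def e\<^sub>w_def field_simps min_def)

lemma weight_nonneg: "gegenbauer_weight lam x \<ge> 0"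
  using c_pos by (simp add: gegenbauer_weight_eq)

lemma nn_integral_mu:
  assumes [measurable]: "f \<in> borel_measurable borel"
  shows "(\<integral>\<^sup>+x. f x \<partial>\<mu>) = (\<integral>\<^sup>+x\<in>{-1..1}. ennreal (gegenbauer_weight lam x) * f x \<partial>lborel)"
  unfolding gegenbauer_measure_def
  by (subst nn_integral_density) (auto intro!: nn_integral_cong simp: indicator_def)

lemma integral_mu:
  fixes f :: "real \<Rightarrow> real"
  assumes [measurable]: "f \<in> borel_measurable borel"
  shows "(\<integral>x. f x \<partial>\<mu>) = (\<integral>x. indicator {-1..1} x * gegenbauer_weight lam x * f x \<partial>lborel)"
  unfolding gegenbauer_measure_def
  using weight_nonneg by (subst integral_density) auto

lemma integrable_mu:
  fixes f :: "real \<Rightarrow> real"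
  assumes [measurable]: "f \<in> borel_measurable borel"
  shows "integrable \<mu> f \<longleftrightarrow> integrable lborel (\<lambda>x. indicator {-1..1} x * gegenbauer_weight lam x * f x)"
  unfolding gegenbauer_measure_def
  using weight_nonneg by (subst integrable_density) auto

lemma AE_mu_I:
  assumes "AE x in lborel. x \<in> {-1..1} \<longrightarrow> P x"
  shows "AE x in \<mu>. P x"
proof -
  have "AE x in lborel. 0 < ennreal (indicator {-1..1} x * gegenbauer_weight lam x) \<longrightarrow> P x"
    using assms by eventually_elim (auto simp: indicator_def)
  then show ?thesis unfolding gegenbauer_measure_def by (subst AE_density) auto
qed

lemma AE_neq: "AE x in \<mu>. x \<noteq> y"
  using AE_lborel_singleton[of y] by (intro AE_mu_I) (auto elim: eventually_mono)

lemma AE_Icc: "AE x in \<mu>. x \<in> {-1..1}"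
  by (rule AE_mu_I) auto

lemma AE_Ioo: "AE x in \<mu>. x \<in> {-1<..<1}"
  using AE_Icc AE_neq[of 1] AE_neq[of "-1"] by eventually_elim auto

abbreviation "\<Gamma> x y \<equiv> \<bar>x - y\<bar> powr - e\<^sub>w"

text \<open>Since \<open>max lam 0 - b\<^sub>w = lam - 1 / 2\<close>, the hypothesis on
  \<open>f\<close> bounds the density of f d\<mu> by
  \<open>c\<^sub>w * B * (1 - x\<^sup>2) powr - b\<^sub>w\<close>. The constant \<open>A\<close> is
  chosen before \<open>B\<close>, so a bound \<open>B\<close> linear in m yields an integral linear
  in m.\<close>

lemma mu_kernel_bound:
  "\<exists>A\<ge>0. \<forall>y\<in>{-1..1::real}. \<forall>B\<ge>0. \<forall>f\<in>borel_measurable borel.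
      (\<forall>x\<in>{-1<..<1}. 0 \<le> f x \<and> f x * (1 - x\<^sup>2) powr (max lam 0) \<le> B) \<longrightarrow>
      (\<integral>\<^sup>+x. ennreal (\<Gamma> x y * f x) \<partial>\<mu>) \<le> ennreal (A * B)"
proof -
  obtain A where A: "A \<ge> 0" "\<And>y::real. y \<in> {-1..1} \<Longrightarrow>
      (\<integral>\<^sup>+x\<in>{-1..1}. ennreal (\<Gamma> x y * (1 - x\<^sup>2) powr - b\<^sub>w) \<partial>lborel) \<le> ennreal A"
    using nn_integral_kernel_finite[of e\<^sub>w b\<^sub>w] b_e by auto
  show ?thesis
  proof (intro exI[of _ "c\<^sub>w * A"] conjI ballI allI impI)
    show "c\<^sub>w * A \<ge> 0" using A c_pos by simp
    fix y B :: real and f :: "real \<Rightarrow> real"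
    assume y: "y \<in> {-1..1}" and B: "B \<ge> 0" and [measurable]: "f \<in> borel_measurable borel"
      and f: "\<forall>x\<in>{-1<..<1}. 0 \<le> f x \<and> f x * (1 - x\<^sup>2) powr (max lam 0) \<le> B"
    have le: "gegenbauer_weight lam x * (\<Gamma> x y * f x) \<le>
        c\<^sub>w * B * (\<Gamma> x y * (1 - x\<^sup>2) powr - b\<^sub>w)" if x: "x \<in> {-1..1}" for x
    proof (cases "x \<in> {-1<..<1}")
      case True
      have ex: "max lam 0 + - b\<^sub>w = lam - 1 / 2" by (auto simp: b\<^sub>w_def)
      have "(1 - x\<^sup>2) powr (lam - 1 / 2) * f x = (f x * (1 - x\<^sup>2) powr (max lam 0)) * (1 - x\<^sup>2) powr - b\<^sub>w"
        by (simp only: ex[symmetric] powr_add ac_simps)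
      also have "\<dots> \<le> B * (1 - x\<^sup>2) powr - b\<^sub>w"
        using f True by (intro mult_right_mono) auto
      finally have "c\<^sub>w * \<Gamma> x y * ((1 - x\<^sup>2) powr (lam - 1 / 2) * f x) \<le>
          c\<^sub>w * \<Gamma> x y * (B * (1 - x\<^sup>2) powr - b\<^sub>w)"
        using c_pos by (intro mult_left_mono) auto
      then show ?thesis by (simp add: gegenbauer_weight_eq ac_simps)
    next
      case False
      then have "x = 1 \<or> x = -1" using x by auto
      then show ?thesis by (auto simp: gegenbauer_weight_eq)
    qed
    have "(\<integral>\<^sup>+x. ennreal (\<Gamma> x y * f x) \<partial>\<mu>)
       = (\<integral>\<^sup>+x\<in>{-1..1}. ennreal (gegenbauer_weight lam x) * ennreal (\<Gamma> x y * f x) \<partial>lborel)"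
      by (rule nn_integral_mu) measurable
    also have "\<dots> \<le> (\<integral>\<^sup>+x. ennreal (c\<^sub>w * B) * (ennreal (\<Gamma> x y * (1 - x\<^sup>2) powr - b\<^sub>w) * indicator {-1..1} x) \<partial>lborel)"
      using le weight_nonneg c_pos B
      by (intro nn_integral_mono)
         (auto simp: indicator_def ennreal_mult'[symmetric] intro!: ennreal_leI)
    also have "\<dots> = ennreal (c\<^sub>w * B) * (\<integral>\<^sup>+x\<in>{-1..1}. ennreal (\<Gamma> x y * (1 - x\<^sup>2) powr - b\<^sub>w) \<partial>lborel)"
      by (rule nn_integral_cmult) measurable
    also have "\<dots> \<le> ennreal (c\<^sub>w * B) * ennreal A"
      using A(2)[OF y] by (rule mult_left_mono) auto
    also have "\<dots> = ennreal (c\<^sub>w * A * B)"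
      using c_pos B A by (simp add: ennreal_mult'[symmetric] ac_simps)
    finally show "(\<integral>\<^sup>+x. ennreal (\<Gamma> x y * f x) \<partial>\<mu>) \<le> ennreal (c\<^sub>w * A * B)" .
  qed
qed

lemma abs_powr_ge:
  fixes x y :: real
  assumes "x \<in> {-1..1}" "y \<in> {-1..1}" "x \<noteq> y"
  shows "1 \<le> 2 * \<Gamma> x y"
proof -
  have "1 / 2 = 2 powr - (1::real)" by (simp add: powr_minus)
  also have "\<dots> \<le> 2 powr - e\<^sub>w" using b_e by (intro powr_mono) auto
  also have "\<dots> \<le> \<Gamma> x y" using assms b_e by (intro powr_mono2') auto
  finally show ?thesis by simp
qed

lemma finite_measure_mu: "finite_measure \<mu>"
proof
  obtain A where A: "\<forall>y\<in>{-1..1::real}. \<forall>B\<ge>0. \<forall>f\<in>borel_measurable borel.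
      (\<forall>x\<in>{-1<..<1}. 0 \<le> f x \<and> f x * (1 - x\<^sup>2) powr (max lam 0) \<le> B) \<longrightarrow>
      (\<integral>\<^sup>+x. ennreal (\<Gamma> x y * f x) \<partial>\<mu>) \<le> ennreal (A * B)"
    using mu_kernel_bound by blast
  have *: "0 \<le> (2::real) \<and> 2 * (1 - x\<^sup>2) powr (max lam 0) \<le> 2" if "x \<in> {-1<..<1}" for x :: real
  proof -
    have "x\<^sup>2 \<le> 1" using that by (simp add: abs_square_le_1 abs_le_iff)
    then show ?thesis using powr_mono2[of "max lam 0" "1 - x\<^sup>2" 1] by simp
  qed
  \<comment> \<open>By \<open>abs_powr_ge\<close> the constant 1 is dominated by the kernel at y = 1
    times f = 2.\<close>
  have "(\<integral>\<^sup>+x. 1 \<partial>\<mu>) \<le> (\<integral>\<^sup>+x. ennreal (\<bar>x - 1\<bar> powr - e\<^sub>w * 2) \<partial>\<mu>)"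
  proof (rule nn_integral_mono_AE)
    show "AE x in \<mu>. 1 \<le> ennreal (\<bar>x - 1\<bar> powr - e\<^sub>w * 2)"
      using AE_Ioo
    proof eventually_elim
      case (elim x)
      then show ?case using abs_powr_ge[of x 1] ennreal_leI[of 1 "\<bar>x - 1\<bar> powr - e\<^sub>w * 2"] by simp
    qed
  qed
  also have "\<dots> \<le> ennreal (A * 2)"
    using * by (intro A[rule_format]) auto
  also have "\<dots> < \<infinity>" by simp
  finally show "emeasure \<mu> (space \<mu>) \<noteq> \<infinity>" by simp
qed

sublocale finite_measure \<mu> by (rule finite_measure_mu)
sublocale mu2: pair_sigma_finite \<mu> \<mu> ..

abbreviation "\<nu> \<equiv> \<mu> \<Otimes>\<^sub>M \<mu>"
abbreviation "\<Lambda> z \<equiv> ln \<bar>fst z - snd z :: real\<bar>"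

lemma integrable_bounded:
  fixes f :: "real \<Rightarrow> real"
  assumes "f \<in> borel_measurable borel" "\<And>x. x \<in> {-1..1} \<Longrightarrow> \<bar>f x\<bar> \<le> B"
  shows "integrable \<mu> f"
proof (rule integrable_const_bound)
  show "AE x in \<mu>. norm (f x) \<le> B"
    using AE_Icc by eventually_elim (use assms(2) in auto)
qed (use assms in simp)

lemma integrable_continuous:
  fixes f :: "real \<Rightarrow> real"
  assumes "f \<in> borel_measurable borel" "continuous_on {-1..1} f"
  shows "integrable \<mu> f"
proof -
  have "compact (f ` {-1..1})" using assms(2) by (intro compact_continuous_image) auto
  then obtain B where "\<And>x. x \<in> {-1..1} \<Longrightarrow> \<bar>f x\<bar> \<le> B"
    using compact_imp_bounded[of "f ` {-1..1}"] by (fastforce simp: bounded_iff)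
  then show ?thesis using assms(1) by (intro integrable_bounded)
qed

lemma poly_measurable [measurable]: "poly p \<in> borel_measurable borel" for p :: "real poly"
  by (intro borel_measurable_continuous_onI continuous_intros)

lemma integrable_poly [simp, intro]: "integrable \<mu> (poly p)"
  by (intro integrable_continuous continuous_intros) measurable

lemma integral_reflect:
  fixes f :: "real \<Rightarrow> real"
  assumes [measurable]: "f \<in> borel_measurable borel"
  shows "(\<integral>x. f (- x) \<partial>\<mu>) = (\<integral>x. f x \<partial>\<mu>)"
proof -
  have "(\<integral>x. f x \<partial>\<mu>) = (\<integral>x. indicator {-1..1} x * gegenbauer_weight lam x * f x \<partial>lborel)"
    by (rule integral_mu) measurable
  also have "\<dots> = \<bar>- 1 :: real\<bar> *\<^sub>R (\<integral>x. indicator {-1..1} (0 + (-1) * x) * gegenbauer_weight lam (0 + (-1) * x) * f (0 + (-1) * x) \<partial>lborel)"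
    by (rule lborel_integral_real_affine) auto
  also have "\<dots> = (\<integral>x. indicator {-1..1} x * gegenbauer_weight lam x * f (- x) \<partial>lborel)"
    by (simp, intro Bochner_Integration.integral_cong)
       (auto simp: indicator_def gegenbauer_weight_eq)
  also have "\<dots> = (\<integral>x. f (- x) \<partial>\<mu>)"
    by (rule integral_mu[symmetric]) measurable
  finally show ?thesis ..
qed

text \<open>The integrand is the derivative of \<open>(1 - x\<^sup>2) powr (lam + 1/2) * f x\<close>, divided by the
  weight; this identity replaces every explicit integral in what follows.\<close>

lemma pearson:
  "(\<integral>x. (1 - x\<^sup>2) * poly (pderiv f) x - (2 * lam + 1) * x * poly f x \<partial>\<mu>) = 0"
proof -
  let ?g = "\<lambda>x. (1 - x\<^sup>2) * poly (pderiv f) x - (2 * lam + 1) * x * poly f x"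
  have [measurable]: "?g \<in> borel_measurable borel" by measurable
  have int: "integrable \<mu> ?g" by (intro integrable_continuous continuous_intros) measurable
  define F where "F = (\<lambda>x. (1 - x\<^sup>2) powr (lam + 1 / 2) * poly f x)"
  have "((\<lambda>x. (1 - x\<^sup>2) powr (lam - 1 / 2) * ?g x) has_integral F 1 - F (-1)) {-1..1}"
  \<comment> \<open>The weight may blow up at the end points. The primitive is only required to be
    continuous there, which holds because \<open>lam + 1 / 2 > 0\<close>, and it vanishes at
    both.\<close>
  proof (rule fundamental_theorem_of_calculus_interior)
    show "continuous_on {-1..1} F"
      unfolding F_def using lam
      by (intro continuous_intros continuous_on_powr') (auto simp: abs_square_le_1 abs_le_iff)
    fix x :: real assume x: "x \<in> {-1<..<1}"
    then have p: "1 - x\<^sup>2 > 0" by (simp add: abs_square_less_1 abs_less_iff)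
    have pw: "(1 - x\<^sup>2) powr (lam + 1 / 2) = (1 - x\<^sup>2) powr (lam - 1 / 2) * (1 - x\<^sup>2)"
      using p powr_add[of "1 - x\<^sup>2" "lam - 1 / 2" 1] by (simp add: add.commute)
    have "(F has_real_derivative
        ((lam + 1 / 2) * (1 - x\<^sup>2) powr (lam + 1 / 2 - 1) * (- (2 * x)) * poly f x
         + (1 - x\<^sup>2) powr (lam + 1 / 2) * poly (pderiv f) x)) (at x)"
      unfolding F_def using p
      by (auto intro!: derivative_eq_intros simp: poly_DERIV)
    then show "(F has_vector_derivative (1 - x\<^sup>2) powr (lam - 1 / 2) * ?g x) (at x)"
      unfolding has_real_derivative_iff_has_vector_derivative[symmetric]
      by (rule DERIV_cong) (simp add: pw, simp add: field_simps)
  qed simp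
  then have h: "((\<lambda>x. (1 - x\<^sup>2) powr (lam - 1 / 2) * ?g x) has_integral 0) {-1..1}"
    using lam by (simp add: F_def)
  have "((\<lambda>x. c\<^sub>w * ((1 - x\<^sup>2) powr (lam - 1 / 2) * ?g x)) has_integral c\<^sub>w * 0) {-1..1}"
    using h by (rule has_integral_mult_right)
  then have "((\<lambda>x. c\<^sub>w * ((1 - x\<^sup>2) powr (lam - 1 / 2) * ?g x)) has_integral 0) {-1..1}"
    by simp
  then have "((\<lambda>x. if x \<in> {-1..1} then c\<^sub>w * ((1 - x\<^sup>2) powr (lam - 1 / 2) * ?g x) else 0) has_integral 0) UNIV"
    by (subst has_integral_restrict_UNIV)
  then have h1: "((\<lambda>x. indicator {-1..1} x * gegenbauer_weight lam x * ?g x) has_integral 0) UNIV"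
    by (rule has_integral_eq[rotated]) (auto simp: indicator_def gegenbauer_weight_eq)
  have "((\<lambda>x. indicator {-1..1} x * gegenbauer_weight lam x * ?g x) has_integral
     (\<integral>x. indicator {-1..1} x * gegenbauer_weight lam x * ?g x \<partial>lborel)) UNIV"
    using int by (intro has_integral_integral_lborel) (simp add: integrable_mu)
  then have "(\<integral>x. indicator {-1..1} x * gegenbauer_weight lam x * ?g x \<partial>lborel) = 0"
    using h1 has_integral_unique by blast
  then show ?thesis by (subst integral_mu) auto
qed

end

text \<open>The Pearson relation is homogeneous and cannot detect the total mass; for \<lambda> = 0
  the normalisation comes from arcsin as primitive.\<close>

lemma integral_arcsine: "(\<integral>x. 1 \<partial>gegenbauer_measure 0) = (1::real)"
proof -
  interpret gegenbauer_param 0 by standard simp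
  let ?g = "\<lambda>x::real. indicator {-1..1} x * gegenbauer_weight 0 x * 1"
  have "((\<lambda>x. inverse (sqrt (1 - x\<^sup>2))) has_integral arcsin 1 - arcsin (-1)) {-1..1}"
  proof (rule fundamental_theorem_of_calculus_interior)
    show "continuous_on {-1..1::real} arcsin" by (rule continuous_on_arcsin') 
    fix x :: real assume "x \<in> {-1<..<1}"
    then show "(arcsin has_vector_derivative inverse (sqrt (1 - x\<^sup>2))) (at x)"
      unfolding has_real_derivative_iff_has_vector_derivative[symmetric]
      by (intro DERIV_arcsin) auto
  qed simp
  then have "((\<lambda>x. 1 / pi * inverse (sqrt (1 - x\<^sup>2))) has_integral 1 / pi * pi) {-1..1}"
    by (intro has_integral_mult_right) (simp add: arcsin_minus_1)
  then have "((\<lambda>x. 1 / pi * inverse (sqrt (1 - x\<^sup>2))) has_integral 1) {-1..1::real}"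
    by simp
  then have "((\<lambda>x. if x \<in> {-1..1} then 1 / pi * inverse (sqrt (1 - x\<^sup>2)) else 0) has_integral 1) UNIV"
    by (subst has_integral_restrict_UNIV)
  then have h1: "(?g has_integral 1) UNIV"
  proof (rule has_integral_eq[rotated])
    fix x :: real
    show "(if x \<in> {-1..1} then 1 / pi * inverse (sqrt (1 - x\<^sup>2)) else 0) = ?g x"
      by (auto simp: indicator_def gegenbauer_weight_eq gegenbauer_const_0 powr_minus powr_half_sqrt
        abs_square_le_1 abs_le_iff)
  qed
  have "integrable \<mu> (\<lambda>x. 1 :: real)" by simp
  then have "(?g has_integral (\<integral>x. ?g x \<partial>lborel)) UNIV"
    by (intro has_integral_integral_lborel) (subst (asm) integrable_mu, auto)
  then have "(\<integral>x. ?g x \<partial>lborel) = 1" using h1 has_integral_unique by blast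
  then show ?thesis by (subst integral_mu) auto
qed

subsection \<open>Chebyshev polynomials and the logarithmic kernel\<close>

hide_const (open) Module.smult

lemma poly_span:
  fixes p :: "nat \<Rightarrow> 'a::field poly"
  assumes p: "\<And>k. degree (p k) = k" "p 0 \<noteq> 0" and q: "degree q \<le> n"
  shows "\<exists>a. q = (\<Sum>k\<le>n. smult (a k) (p k))"
  using q
proof (induction n arbitrary: q)
  case 0
  then obtain c where q: "q = [:c:]" by (metis le_0_eq degree_eq_zeroE)
  obtain d where d: "p 0 = [:d:]" using p(1)[of 0] by (metis degree_eq_zeroE)
  then have "d \<noteq> 0" using p(2) by auto
  then have "q = (\<Sum>k\<le>0. smult (c / d) (p k))" using q d by simp
  then show ?case by (intro exI[of _ "\<lambda>_. c / d"])
next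
  case (Suc n)
  have pn: "p (Suc n) \<noteq> 0" using p(1)[of "Suc n"] by auto
  define c where "c = coeff q (Suc n) / lead_coeff (p (Suc n))"
  have "degree (q - smult c (p (Suc n))) \<le> n"
  proof (rule degree_le, intro allI impI)
    fix i assume "n < i"
    then consider "i = Suc n" | "i > Suc n" by linarith
    then show "coeff (q - smult c (p (Suc n))) i = 0"
    proof cases
      case 1
      have "coeff (p (Suc n)) (Suc n) \<noteq> 0" using p(1)[of "Suc n"] pn by (metis leading_coeff_0_iff)
      then show ?thesis using p(1)[of "Suc n"] 1 by (simp add: c_def)
    next
      case 2
      then show ?thesis using p(1)[of "Suc n"] Suc.prems by (simp add: coeff_eq_0)
    qed
  qed
  then obtain a where a: "q - smult c (p (Suc n)) = (\<Sum>k\<le>n. smult (a k) (p k))"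
    using Suc.IH by blast
  have "q = (\<Sum>k\<le>n. smult (a k) (p k)) + smult c (p (Suc n))" using a by (metis diff_add_cancel)
  also have "\<dots> = (\<Sum>k\<le>Suc n. smult ((a(Suc n := c)) k) (p k))" by simp
  finally show ?case by blast
qed

fun cheb_T :: "nat \<Rightarrow> real poly" where
  "cheb_T 0 = 1"
| "cheb_T (Suc 0) = [:0, 1:]"
| "cheb_T (Suc (Suc n)) = [:0, 2:] * cheb_T (Suc n) - cheb_T n"

fun cheb_U :: "nat \<Rightarrow> real poly" where
  "cheb_U 0 = 1"
| "cheb_U (Suc 0) = [:0, 2:]"
| "cheb_U (Suc (Suc n)) = [:0, 2:] * cheb_U (Suc n) - cheb_U n"

abbreviation T :: "nat \<Rightarrow> real \<Rightarrow> real" where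
  "T n x \<equiv> poly (cheb_T n) x"

text \<open>The function \<open>- ln 2 - abel r J x y\<close> stands in for ln |x-y|. The damping
  r^j gives a geometric tail, and the cut at J leaves a polynomial in x, so that pairing with
  \<open>u m\<close> becomes a finite sum of moments.\<close>

abbreviation abel :: "real \<Rightarrow> nat \<Rightarrow> real \<Rightarrow> real \<Rightarrow> real" where
  "abel r J x y \<equiv> (\<Sum>j=1..J. 2 / real j * r ^ j * T j x * T j y)"

lemma poly_cheb_T_cos: "T n (cos t) = cos (real n * t)"
proof (induction n rule: cheb_T.induct)
  case (3 n)
  have "cos (real (Suc (Suc n)) * t) + cos (real n * t) = 2 * cos t * cos (real (Suc n) * t)"
    using cos_add[of "real (Suc n) * t" t] cos_diff[of "real (Suc n) * t" t]
    by (simp add: algebra_simps)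
  with 3 show ?case by simp
qed auto

lemma poly_cheb_U_cos: "poly (cheb_U n) (cos t) * sin t = sin (real (Suc n) * t)"
proof (induction n rule: cheb_U.induct)
  case 2
  then show ?case using sin_double[of t] by (simp add: mult.commute)
next
  case (3 n)
  have "sin (real (Suc (Suc (Suc n))) * t) + sin (real (Suc n) * t) = 2 * cos t * sin (real (Suc (Suc n)) * t)"
    using sin_add[of "real (Suc (Suc n)) * t" t] sin_diff[of "real (Suc (Suc n)) * t" t]
    by (simp add: algebra_simps)
  with 3 show ?case by (simp add: left_diff_distrib) (simp add: mult.assoc)
qed auto

lemma degree_cheb_T: "degree (cheb_T n) = n"
proof (induction n rule: cheb_T.induct)
  case (3 n)
  have ne: "cheb_T (Suc n) \<noteq> 0" using 3(1) by auto
  have d: "degree ([:0, 2:] * cheb_T (Suc n)) = Suc (Suc n)"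
    using 3 ne by (subst degree_mult_eq) auto
  have "degree ([:0, 2:] * cheb_T (Suc n) + - cheb_T n) = degree ([:0, 2:] * cheb_T (Suc n))"
    by (rule degree_add_eq_left) (use 3 d in simp)
  then show ?case using d by simp
qed auto

lemma cheb_T_arccos: "x \<in> {-1..1} \<Longrightarrow> T n x = cos (real n * arccos x)"
  using poly_cheb_T_cos[of n "arccos x"] by simp

lemma abs_cheb_T_le: "x \<in> {-1..1} \<Longrightarrow> \<bar>T n x\<bar> \<le> 1"
  by (simp add: cheb_T_arccos)

lemma cheb_T_mult:
  assumes "x \<in> {-1..1}" "m \<le> n"
  shows "T m x * T n x = (T (n + m) x + T (n - m) x) / 2"
  using assms cos_add[of "real n * arccos x" "real m * arccos x"] cos_diff[of "real n * arccos x" "real m * arccos x"]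
  by (simp add: cheb_T_arccos of_nat_diff algebra_simps)

text \<open>Obtained by differentiating U_n(cos t) sin t = sin((n+1) t). The left side is the
  Pearson operator of the arcsine law, so every T_j with j > 0 is in its range. This gives both the
  vanishing arcsine means of T_j and the test function for the virial identity.\<close>

lemma cheb_U_pearson:
  assumes x: "x \<in> {-1..1}"
  shows "(1 - x\<^sup>2) * poly (pderiv (cheb_U n)) x - x * poly (cheb_U n) x = - real (Suc n) * T (Suc n) x"
proof -
  define t where "t = arccos x"
  have xt: "x = cos t" using x by (simp add: t_def)
  have d1: "((\<lambda>t. poly (cheb_U n) (cos t) * sin t) has_real_derivative
      (poly (pderiv (cheb_U n)) (cos t) * (- sin t)) * sin t + poly (cheb_U n) (cos t) * cos t) (at t)"
    by (auto intro!: derivative_eq_intros DERIV_chain2[OF poly_DERIV] simp: mult.commute)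
  have d2: "((\<lambda>t. sin (real (Suc n) * t)) has_real_derivative cos (real (Suc n) * t) * real (Suc n)) (at t)"
    by (auto intro!: derivative_eq_intros)
  have "(poly (pderiv (cheb_U n)) (cos t) * (- sin t)) * sin t + poly (cheb_U n) (cos t) * cos t
      = cos (real (Suc n) * t) * real (Suc n)"
    using d1 d2 unfolding poly_cheb_U_cos by (rule DERIV_unique)
  then have "- ((sin t)\<^sup>2 * poly (pderiv (cheb_U n)) x) + poly (cheb_U n) x * x = T (Suc n) x * real (Suc n)"
    unfolding xt poly_cheb_T_cos by (simp add: power2_eq_square algebra_simps)
  moreover have "(sin t)\<^sup>2 = 1 - x\<^sup>2" unfolding xt by (rule sin_squared_eq)
  ultimately show ?thesis by (simp add: algebra_simps)
qed

section \<open>Approximation of the logarithmic kernel by Abel means\<close>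

lemma ln_one_plus_le_powr:
  fixes t e :: real
  assumes "t \<ge> 0" "0 < e" "e \<le> 1"
  shows "ln (1 + t) \<le> t powr e / e"
proof (cases "t \<le> 1")
  case True
  have "ln (1 + t) \<le> t" using assms by (intro ln_add_one_self_le_self)
  also have "t \<le> t powr e"
  proof (cases "t = 0")
    case False
    then have "t powr 1 \<le> t powr e" using True assms by (intro powr_mono') auto
    then show ?thesis using False assms by simp
  qed simp
  also have "\<dots> \<le> t powr e / e"
    using assms mult_right_mono[of e 1 "t powr e"] by (simp add: field_simps)
  finally show ?thesis .
next
  case False
  then have t: "t > 1" by simp
  have "ln (1 + t) = ln (t * (1 + 1 / t))"
    using t by (simp add: distrib_left)
  also have "\<dots> = ln t + ln (1 + 1 / t)"
    using t by (intro ln_mult_pos) (auto simp: add_pos_pos)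
  also have "ln (1 + 1 / t) \<le> 1 / t" using t by (intro ln_add_one_self_le_self) auto
  \<comment> \<open>This 1/e is absorbed by the -1 in ln s \<le> s - 1, used below with s = t powr e
    and divided by e.\<close>
  also have "1 / t \<le> 1 / e" using t assms by (intro divide_left_mono) auto
  also have "ln t = ln (t powr e) / e" using t assms by (simp add: ln_powr)
  also have "ln (t powr e) \<le> t powr e - 1" using t by (intro ln_le_minus_one) auto
  finally show ?thesis using assms by (simp add: divide_right_mono diff_divide_distrib)
qed

lemma ln_abs_le_powr:
  fixes t e :: real
  assumes "0 < t" "t \<le> 2" "0 < e" "e \<le> 1"
  shows "\<bar>ln t\<bar> \<le> 2 / e * t powr - e"
proof (cases "t \<le> 1")
  case True
  have "\<bar>ln t\<bar> = ln (t powr - e) / e" using True assms by (simp add: ln_powr)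
  also have "\<dots> \<le> t powr - e / e"
    using assms ln_le_minus_one[of "t powr - e"] by (intro divide_right_mono) auto
  also have "\<dots> \<le> 2 / e * t powr - e" using assms by (simp add: field_simps)
  finally show ?thesis .
next
  case False
  have "\<bar>ln t\<bar> \<le> 1" using False assms ln_le_minus_one[of t] by simp
  also have "1 / 2 = 2 powr - (1::real)" by (simp add: powr_minus)
  then have "1 \<le> 2 * 2 powr - e" using powr_mono[of "-1" "- e" 2] assms by simp
  also have "2 powr - e \<le> t powr - e" using assms by (intro powr_mono2') auto
  also have "2 * t powr - e \<le> 2 / e * t powr - e"
    using assms by (intro mult_right_mono) (auto simp: field_simps)
  finally show ?thesis by simp
qed

text \<open>The real part of the power series of ln(1 - r e^(ia)), with a geometric bound for the
  tail beyond J.\<close>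

lemma poisson_log_series:
  fixes r a :: real
  assumes r: "0 < r" "r < 1"
  shows "\<bar>ln (1 - 2 * r * cos a + r\<^sup>2) / 2 + (\<Sum>j=1..J. r ^ j / real j * cos (real j * a))\<bar> \<le> r ^ Suc J / (1 - r)"
proof -
  define z where "z = - (of_real r * cis a)"
  have nz: "cmod z < 1" using r by (simp add: z_def norm_mult)
  then have "(\<lambda>n. Re (- ((- z) ^ n) / of_nat n)) sums Re (ln (1 + z))"
    using Ln_series'[of z] by (intro sums_Re)
  moreover have "Re (- ((- z) ^ n) / of_nat n) = - (r ^ n / real n * cos (real n * a))" for n
  proof -
    have "(- z) ^ n = of_real (r ^ n) * cis (real n * a)"
      by (simp add: z_def power_mult_distrib Complex.DeMoivre)
    then show ?thesis by simp
  qed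
  moreover have "Re (ln (1 + z)) = ln (1 - 2 * r * cos a + r\<^sup>2) / 2"
  proof -
    have nz': "1 + z \<noteq> 0" using nz by (metis add.inverse_unique norm_minus_cancel norm_one order_less_irrefl)
    have "(cmod (1 + z))\<^sup>2 = (1 - r * cos a)\<^sup>2 + (r * sin a)\<^sup>2"
      unfolding cmod_power2 by (simp add: z_def)
    also have "\<dots> = 1 - 2 * r * cos a + r\<^sup>2 * ((cos a)\<^sup>2 + (sin a)\<^sup>2)"
      unfolding power2_eq_square by (simp only: algebra_simps)
    finally have sq: "(cmod (1 + z))\<^sup>2 = 1 - 2 * r * cos a + r\<^sup>2" by simp
    have "ln (1 - 2 * r * cos a + r\<^sup>2) = 2 * ln (cmod (1 + z))"
      unfolding sq[symmetric] using nz' by (simp add: ln_realpow)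
    then show ?thesis using nz' by simp
  qed
  ultimately have s: "(\<lambda>n. - (r ^ n / real n * cos (real n * a))) sums (ln (1 - 2 * r * cos a + r\<^sup>2) / 2)"
    by (simp only:)
  let ?f = "\<lambda>n. - (r ^ n / real n * cos (real n * a))"
  have split: "(\<lambda>n. ?f (n + Suc J)) sums (ln (1 - 2 * r * cos a + r\<^sup>2) / 2 - (\<Sum>n<Suc J. ?f n))"
    using s by (rule sums_split_initial_segment)
  \<comment> \<open>The term n = 0 is zero because division by zero yields zero.\<close>
  have "(\<Sum>n<Suc J. ?f n) = (\<Sum>n\<in>{1..J}. ?f n)"
    by (rule sum.mono_neutral_right) auto
  then have split': "(\<lambda>n. ?f (n + Suc J)) sums (ln (1 - 2 * r * cos a + r\<^sup>2) / 2 + (\<Sum>j=1..J. r ^ j / real j * cos (real j * a)))"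
    using split by (simp add: sum_negf)
  have g: "(\<lambda>n. r ^ n * r ^ Suc J) sums (1 / (1 - r) * r ^ Suc J)"
    using r by (intro sums_mult2 geometric_sums) auto
  have le: "norm (?f (n + Suc J)) \<le> r ^ n * r ^ Suc J" for n
  proof -
    have "norm (?f (n + Suc J)) = r ^ (n + Suc J) / real (n + Suc J) * \<bar>cos (real (n + Suc J) * a)\<bar>"
      using r by (simp add: abs_mult)
    also have "\<dots> \<le> r ^ (n + Suc J) / 1 * 1"
      using r by (intro mult_mono divide_left_mono) auto
    also have "\<dots> = r ^ n * r ^ Suc J" by (simp add: power_add)
    finally show ?thesis .
  qed
  have "norm (\<Sum>n. ?f (n + Suc J)) \<le> (\<Sum>n. r ^ n * r ^ Suc J)"
    using sums_summable[OF g] le by (rule norm_suminf_le[rotated])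
  then show ?thesis using sums_unique[OF split'] sums_unique[OF g] by simp
qed

text \<open>The cost of r < 1: with d = 2 - 2c one has 1 - 2rc + r^2 = q d for the explicit factor q
  below, and r \<le> q \<le> 1 + (1-r)^2/d.\<close>

lemma poisson_log_diff:
  fixes r c e :: real
  assumes r: "0 < r" "r < 1" and c: "c < 1" and e: "0 < e" "e \<le> 1"
  shows "\<bar>ln (2 - 2 * c) / 2 - ln (1 - 2 * r * c + r\<^sup>2) / 2\<bar> \<le> \<bar>ln r\<bar> / 2 + (1 - r) powr e / e * (2 - 2 * c) powr - (e / 2)"
proof -
  define d where "d = 2 - 2 * c"
  have d: "d > 0" using c by (simp add: d_def)
  define q where "q = r + (1 - r)\<^sup>2 / d"
  have q: "q > 0" using r d by (simp add: q_def add_pos_nonneg)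
  have "1 - 2 * r * c + r\<^sup>2 = q * d"
    using d by (simp add: q_def field_simps) (simp add: d_def power2_eq_square algebra_simps)
  then have diff: "ln (1 - 2 * r * c + r\<^sup>2) - ln d = ln q" using q d by (simp add: ln_mult_pos)
  have lo: "ln q \<ge> ln r" using r d q by (simp add: q_def)
  have "ln q \<le> ln (1 + (1 - r)\<^sup>2 / d)" using r d q by (simp add: q_def)
  also have "\<dots> \<le> ((1 - r)\<^sup>2 / d) powr (e / 2) / (e / 2)"
    using d e by (intro ln_one_plus_le_powr) auto
  also have "((1 - r)\<^sup>2 / d) powr (e / 2) = (1 - r) powr e * d powr - (e / 2)"
  proof -
    have "((1 - r)\<^sup>2) powr (e / 2) = ((1 - r) powr 2) powr (e / 2)" using r by simp
    also have "\<dots> = (1 - r) powr e" by (simp only: powr_powr) simp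
    finally show ?thesis using r d by (simp add: powr_divide powr_minus field_simps)
  qed
  finally have "ln q \<le> 2 * ((1 - r) powr e / e * d powr - (e / 2))" using e by (simp add: field_simps)
  moreover have "0 \<le> (1 - r) powr e / e * d powr - (e / 2)" using e by simp
  moreover have "\<bar>ln r\<bar> = - ln r" using r by simp
  ultimately show ?thesis using diff lo unfolding d_def[symmetric] by (simp add: abs_le_iff) 
qed

text \<open>For x = cos t and y = cos u, |x-y| = 2 |sin((t-u)/2) sin((t+u)/2)|, so ln |x-y| + ln 2
  is a sum of two one-variable Poisson logarithms. The product-to-sum formula splits the Abel mean
  in the same way.\<close>

lemma log_kernel_bound:
  fixes x y e r :: real
  assumes x: "x \<in> {-1..1}" and y: "y \<in> {-1..1}" and xy: "x \<noteq> y" and r: "0 < r" "r < 1"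
    and e: "0 < e" "e \<le> 1"
  shows "\<bar>ln \<bar>x - y\<bar> + ln 2 + abel r J x y\<bar>
    \<le> (2 * \<bar>ln r\<bar> + 2 * (1 - r) powr e / e + 4 * (r ^ Suc J / (1 - r))) * \<bar>x - y\<bar> powr - e"
proof -
  define t u where "t = arccos x" and "u = arccos y"
  have xt: "x = cos t" "y = cos u" using x y by (auto simp: t_def u_def)
  define a b where "a = t - u" and "b = t + u"
  define W where "W = \<bar>x - y\<bar> powr - e"
  have prod: "(2 - 2 * cos a) * (2 - 2 * cos b) = 4 * (x - y)\<^sup>2"
  proof -
    have s: "(sin t)\<^sup>2 = 1 - (cos t)\<^sup>2" "(sin u)\<^sup>2 = 1 - (cos u)\<^sup>2" by (auto simp: sin_squared_eq)
    have "(2 - 2 * cos a) * (2 - 2 * cos b)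
      = 4 * (1 - 2 * cos t * cos u + (cos t)\<^sup>2 * (cos u)\<^sup>2 - (sin t)\<^sup>2 * (sin u)\<^sup>2)"
      unfolding a_def b_def cos_add cos_diff by (simp add: power2_eq_square algebra_simps)
    also have "\<dots> = 4 * (x - y)\<^sup>2"
      unfolding s xt by (simp add: power2_eq_square algebra_simps)
    finally show ?thesis .
  qed
  have sqpos: "(x - y)\<^sup>2 > 0" using xy by simp
  have "cos a \<noteq> 1" "cos b \<noteq> 1" using prod sqpos by auto
  then have lt: "cos a < 1" "cos b < 1" using cos_le_one[of a] cos_le_one[of b] by linarith+
  \<comment> \<open>Error terms without a singularity are absorbed into multiples of W.\<close>
  have W1: "1 \<le> 2 * W"
  proof -
    have "1 / 2 = 2 powr - (1::real)" by (simp add: powr_minus)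
    also have "\<dots> \<le> 2 powr - e" using e by (intro powr_mono) auto
    also have "\<dots> \<le> W" unfolding W_def using x y xy e by (intro powr_mono2') auto
    finally show ?thesis by simp
  qed
  have dW: "(2 - 2 * c) powr - (e / 2) \<le> W"
    if "(2 - 2 * c) * (2 - 2 * c') = 4 * (x - y)\<^sup>2" "c < 1" "c' < 1" "- 1 \<le> c'" for c c'
  proof -
    \<comment> \<open>The other factor is at most 4, so each factor separately is at least
      (x-y)^2.\<close>
    have "(2 - 2 * c) * (2 - 2 * c') \<le> (2 - 2 * c) * 4" using that by (intro mult_left_mono) auto
    then have "(x - y)\<^sup>2 \<le> 2 - 2 * c" using that(1) by simp
    then have "(2 - 2 * c) powr - (e / 2) \<le> ((x - y)\<^sup>2) powr - (e / 2)"
      using sqpos e by (intro powr_mono2') auto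
    also have "((x - y)\<^sup>2) powr - (e / 2) = (\<bar>x - y\<bar> powr 2) powr - (e / 2)" by simp
    also have "\<dots> = W" unfolding W_def by (simp only: powr_powr) simp
    finally show ?thesis .
  qed
  let ?S = "\<lambda>a. \<Sum>j=1..J. r ^ j / real j * cos (real j * a)"
  have one: "\<bar>ln (2 - 2 * cos v) / 2 + ?S v\<bar> \<le> (\<bar>ln r\<bar> + (1 - r) powr e / e + 2 * (r ^ Suc J / (1 - r))) * W"
    if v: "cos v < 1" "(2 - 2 * cos v) powr - (e / 2) \<le> W" for v
  proof -
    have "\<bar>ln (2 - 2 * cos v) / 2 + ?S v\<bar> \<le> \<bar>ln r\<bar> / 2 + (1 - r) powr e / e * (2 - 2 * cos v) powr - (e / 2) + r ^ Suc J / (1 - r)"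
      using poisson_log_diff[OF r v(1) e] poisson_log_series[OF r, of v J] by linarith
    also have "(1 - r) powr e / e * (2 - 2 * cos v) powr - (e / 2) \<le> (1 - r) powr e / e * W"
      using v e by (intro mult_left_mono) auto
    also have "\<bar>ln r\<bar> / 2 \<le> \<bar>ln r\<bar> * W"
      using mult_left_mono[OF W1, of "\<bar>ln r\<bar> / 2"] by simp
    also have "r ^ Suc J / (1 - r) \<le> 2 * (r ^ Suc J / (1 - r)) * W"
      using mult_left_mono[OF W1, of "r ^ Suc J / (1 - r)"] r by (simp add: mult.assoc mult.left_commute)
    finally show ?thesis by (simp add: algebra_simps)
  qed
  have "ln \<bar>x - y\<bar> + ln 2 = ln (2 - 2 * cos a) / 2 + ln (2 - 2 * cos b) / 2"
  proof -
    have "ln (2 - 2 * cos a) + ln (2 - 2 * cos b) = ln ((2 * \<bar>x - y\<bar>)\<^sup>2)"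
      using lt prod by (simp add: ln_mult_pos[symmetric] power_mult_distrib)
    also have "\<dots> = 2 * (ln 2 + ln \<bar>x - y\<bar>)"
      using xy by (subst ln_realpow) (auto simp: ln_mult_pos)
    finally show ?thesis by simp
  qed
  moreover have "abel r J x y = ?S a + ?S b"
  proof -
    have "2 / real j * r ^ j * T j x * T j y
       = r ^ j / real j * cos (real j * a) + r ^ j / real j * cos (real j * b)" for j
    proof -
      have "cos (real j * a) + cos (real j * b) = 2 * (cos (real j * t) * cos (real j * u))"
        by (simp add: a_def b_def distrib_left right_diff_distrib cos_add cos_diff)
      then have "r ^ j / real j * cos (real j * a) + r ^ j / real j * cos (real j * b)
         = r ^ j / real j * (2 * (cos (real j * t) * cos (real j * u)))"
        by (simp only: distrib_left[symmetric])
      then show ?thesis by (simp add: xt poly_cheb_T_cos)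
    qed
    then show ?thesis by (simp add: sum.distrib)
  qed
  ultimately have "\<bar>ln \<bar>x - y\<bar> + ln 2 + abel r J x y\<bar>
    \<le> \<bar>ln (2 - 2 * cos a) / 2 + ?S a\<bar> + \<bar>ln (2 - 2 * cos b) / 2 + ?S b\<bar>" by linarith
  also have "\<dots> \<le> 2 * ((\<bar>ln r\<bar> + (1 - r) powr e / e + 2 * (r ^ Suc J / (1 - r))) * W)"
    using one[OF lt(1) dW[OF prod lt cos_ge_minus_one]]
      one[OF lt(2) dW[OF prod[unfolded mult.commute[of "2 - 2 * cos a"]] lt(2,1) cos_ge_minus_one]]
    by linarith
  finally show ?thesis unfolding W_def by (simp add: algebra_simps)
qed

text \<open>r is taken close to 1 first, then J large in terms of r. The side conditions
  \<open>1 - \<epsilon> < r\<close> and \<open>j0 \<le> J\<close> serve the exact evaluation in the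
  Chebyshev case, where r must tend to 1 and a given T_j must lie below the cut.\<close>

lemma log_kernel_approx:
  fixes e \<epsilon> :: real
  assumes e: "0 < e" "e \<le> 1" and eps: "\<epsilon> > 0"
  shows "\<exists>r J. 1 - \<epsilon> < r \<and> 0 < r \<and> r < 1 \<and> j0 \<le> J \<and> (\<forall>x\<in>{-1..1}. \<forall>y\<in>{-1..1}. x \<noteq> y \<longrightarrow>
    \<bar>ln \<bar>x - y\<bar> + ln 2 + abel r J x y\<bar>
    \<le> \<epsilon> * \<bar>x - y\<bar> powr - e)"
proof -
  have "((\<lambda>r. 2 * \<bar>ln r\<bar> + 2 * (1 - r) powr e / e) \<longlongrightarrow> 2 * \<bar>ln 1\<bar> + 2 * (1 - 1) powr e / e) (at_left (1::real))"
    using e by (intro tendsto_intros) (auto simp: eventually_at_filter)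
  then have "eventually (\<lambda>r. 2 * \<bar>ln r\<bar> + 2 * (1 - r) powr e / e < \<epsilon> / 2) (at_left (1::real))"
    using eps e by (intro order_tendstoD(2)) auto
  moreover have "eventually (\<lambda>r. max (1 - \<epsilon>) 0 < r) (at_left (1::real))"
    using eps by (intro eventually_at_leftI[of "max (1 - \<epsilon>) 0"]) auto
  moreover have "eventually (\<lambda>r. r < 1) (at_left (1::real))"
    by (simp add: eventually_at_filter)
  ultimately have "eventually (\<lambda>r. 2 * \<bar>ln r\<bar> + 2 * (1 - r) powr e / e < \<epsilon> / 2 \<and> max (1 - \<epsilon>) 0 < r \<and> r < 1) (at_left (1::real))"
    by eventually_elim auto
  then obtain r where r: "2 * \<bar>ln r\<bar> + 2 * (1 - r) powr e / e < \<epsilon> / 2" "1 - \<epsilon> < r" "0 < r" "r < 1"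
    using eventually_happens'[of "at_left (1::real)"] by fastforce
  have "(\<lambda>J. 4 * (r ^ Suc J / (1 - r))) \<longlonglongrightarrow> 4 * (0 / (1 - r))"
    using r by (intro tendsto_intros LIMSEQ_Suc LIMSEQ_realpow_zero) auto
  then have "eventually (\<lambda>J. 4 * (r ^ Suc J / (1 - r)) < \<epsilon> / 2) sequentially"
    using eps by (intro order_tendstoD(2)) auto
  then have "eventually (\<lambda>J. 4 * (r ^ Suc J / (1 - r)) < \<epsilon> / 2 \<and> j0 \<le> J) sequentially"
    using eventually_ge_at_top[of j0] by eventually_elim auto
  then obtain J where J: "4 * (r ^ Suc J / (1 - r)) < \<epsilon> / 2" "j0 \<le> J"
    by (auto simp: eventually_sequentially)
  have "\<bar>ln \<bar>x - y\<bar> + ln 2 + abel r J x y\<bar>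
    \<le> \<epsilon> * \<bar>x - y\<bar> powr - e" if "x \<in> {-1..1}" "y \<in> {-1..1}" "x \<noteq> y" for x y
    using r(1) J(1) by (intro order_trans[OF log_kernel_bound[OF that r(3,4) e]] mult_right_mono) auto
  then show ?thesis using r J by blast
qed

subsection \<open>Orthonormal polynomials, differential equation and virial identity\<close>

locale gegenbauer = gegenbauer_param lam for lam :: real +
  fixes C :: "nat \<Rightarrow> real poly"
  assumes normalized: "normalized_gegenbauer lam C"
begin

definition L :: "real poly \<Rightarrow> real" where "L p = (\<integral>x. poly p x \<partial>\<mu>)"
definition \<kappa> :: "nat \<Rightarrow> real" where "\<kappa> k = real k * (real k + 2 * lam)"
abbreviation "sg \<equiv> [:1, 0, -1:] :: real poly"
abbreviation "X\<^sub>p \<equiv> [:0, 1:] :: real poly"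

lemma degree_C [simp]: "degree (C k) = k"
  using normalized by (simp add: normalized_gegenbauer_def)

lemma L_add: "L (p + q) = L p + L q"
proof -
  have "L (p + q) = (\<integral>x. poly p x + poly q x \<partial>\<mu>)"
    unfolding L_def by (intro Bochner_Integration.integral_cong) auto
  then show ?thesis unfolding L_def by simp
qed

lemma L_smult: "L (smult c p) = c * L p"
proof -
  have "L (smult c p) = (\<integral>x. c * poly p x \<partial>\<mu>)"
    unfolding L_def by (intro Bochner_Integration.integral_cong) auto
  then show ?thesis unfolding L_def by simp
qed

lemma L_minus: "L (- p) = - L p"
  using L_smult[of "-1" p] by simp

lemma L_diff: "L (p - q) = L p - L q"
  using L_add[of p "- q"] by (simp add: L_minus)

lemma L_0 [simp]: "L 0 = 0"
  using L_smult[of 0 0] by simp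

lemma L_sum: "L (\<Sum>i\<in>A. f i) = (\<Sum>i\<in>A. L (f i))"
  by (induction A rule: infinite_finite_induct) (simp_all add: L_add)

lemma ortho: "L (C i * C j) = (if i = j then 1 else 0)"
  using normalized by (simp add: normalized_gegenbauer_def L_def)

lemma C_0_nonzero: "C 0 \<noteq> 0"
  using ortho[of 0 0] by auto

lemma C_span: "degree q \<le> n \<Longrightarrow> \<exists>a. q = (\<Sum>k\<le>n. smult (a k) (C k))"
  using poly_span[of C q n] C_0_nonzero by simp

lemma L_mono:
  assumes "\<And>x. x \<in> {-1..1} \<Longrightarrow> poly p x \<le> poly q x"
  shows "L p \<le> L q"
  unfolding L_def
proof (intro integral_mono_AE integrable_poly)
  show "AE x in \<mu>. poly p x \<le> poly q x"
    using AE_Icc by eventually_elim (rule assms)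
qed

lemma L_cong:
  assumes "\<And>x. x \<in> {-1..1} \<Longrightarrow> poly p x = poly q x"
  shows "L p = L q"
  using L_mono[of p q] L_mono[of q p] assms by (simp add: antisym)

lemma L_orthogonal:
  assumes "degree q < k"
  shows "L (q * C k) = 0"
proof -
  define n where "n = degree q"
  obtain a where a: "q = (\<Sum>i\<le>n. smult (a i) (C i))"
    using C_span[of q n] by (auto simp: n_def)
  have "L (q * C k) = (\<Sum>i\<le>n. a i * (if i = k then 1 else 0))"
    by (subst a) (simp add: sum_distrib_right L_sum L_smult ortho)
  also have "\<dots> = 0" using assms by (intro sum.neutral) (auto simp: n_def)
  finally show ?thesis .
qed

text \<open>The squared distance from f to its projection on degree at most m is nonnegative. The
  bound does not depend on m.\<close>

lemma bessel: "(\<Sum>k\<le>m. (L (f * C k))\<^sup>2) \<le> L (f * f)"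
proof -
  define g where "g = (\<Sum>k\<le>m. smult (L (f * C k)) (C k))"
  have fg: "L (f * g) = (\<Sum>k\<le>m. (L (f * C k))\<^sup>2)"
    by (simp add: g_def sum_distrib_left L_sum L_smult power2_eq_square)
  have "L (C k * g) = L (f * C k)" if "k \<le> m" for k
    using that by (simp add: g_def sum_distrib_left L_sum L_smult ortho if_distrib cong: if_cong)
  then have gg: "L (g * g) = (\<Sum>k\<le>m. (L (f * C k))\<^sup>2)"
    by (subst (1) g_def) (simp add: sum_distrib_right L_sum L_smult power2_eq_square)
  have "0 \<le> L ((f - g) * (f - g))"
    using L_mono[of 0 "(f - g) * (f - g)"] by simp
  also have "(f - g) * (f - g) = f * f - f * g - f * g + g * g" by (simp add: algebra_simps)
  finally show ?thesis unfolding L_add L_diff fg gg by simp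
qed

section \<open>The Gegenbauer operator, its eigenvalues and the virial identity\<close>

lemma L_pearson: "L (sg * pderiv f - smult (2 * lam + 1) (X\<^sub>p * f)) = 0"
proof -
  have "L (sg * pderiv f - smult (2 * lam + 1) (X\<^sub>p * f))
    = (\<integral>x. (1 - x\<^sup>2) * poly (pderiv f) x - (2 * lam + 1) * x * poly f x \<partial>\<mu>)"
    unfolding L_def by (intro Bochner_Integration.integral_cong) (auto simp: power2_eq_square algebra_simps)
  then show ?thesis using pearson by simp
qed

text \<open>In divergence form, with w the weight, this is (1/w) ((1 - x^2) w p')', which explains
  the symmetry \<open>L_D_sym\<close>.\<close>

definition D :: "real poly \<Rightarrow> real poly" where
  "D p = sg * pderiv (pderiv p) - smult (2 * lam + 1) (X\<^sub>p * pderiv p)"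

lemma poly_ext: "(\<And>x. poly p x = poly q x) \<Longrightarrow> p = q" for p q :: "real poly"
  by (intro poly_eq_poly_eq_iff[THEN iffD1] ext)

lemma pderiv_sg: "pderiv (sg * q) = sg * pderiv q - smult 2 (X\<^sub>p * q)"
proof -
  have "pderiv sg = smult (- 2) X\<^sub>p" by (simp add: pderiv_pCons)
  then show ?thesis
    by (simp only: pderiv_mult[of sg]) (rule poly_ext, simp add: algebra_simps)
qed

lemma pderiv_D:
  "pderiv (D p) = sg * pderiv (pderiv (pderiv p)) - smult (2 * lam + 3) (X\<^sub>p * pderiv (pderiv p))
     - smult (2 * lam + 1) (pderiv p)"
  unfolding D_def pderiv_diff pderiv_smult pderiv_sg pderiv_mult[of X\<^sub>p]
  by (rule poly_ext) (simp add: pderiv_pCons algebra_simps)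

lemma L_D: "L (r * D q) = - L (sg * pderiv r * pderiv q)"
proof -
  have "r * D q = (sg * pderiv (r * pderiv q) - smult (2 * lam + 1) (X\<^sub>p * (r * pderiv q)))
      - sg * pderiv r * pderiv q"
    by (rule poly_ext) (simp add: D_def pderiv_mult algebra_simps)
  then show ?thesis unfolding L_diff using L_pearson[of "r * pderiv q"] by (simp add: L_diff)
qed

lemma L_D_sym: "L (r * D q) = L (q * D r)"
  unfolding L_D by (simp only: mult.assoc mult.commute[of "pderiv r"])

text \<open>On monomials \<open>D\<close> is triangular with diagonal entries
  \<open>- \<kappa> n\<close>: it does not raise the degree, and \<open>D (C k)\<close> has leading
  coefficient \<open>- \<kappa> k\<close> times that of \<open>C k\<close>.\<close>

lemma coeff_D:
  "coeff (D q) n = (real n + 1) * (real n + 2) * coeff q (n + 2) - real n * (real n + 2 * lam) * coeff q n"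
proof -
  have e: "D q = pderiv (pderiv q) - monom 1 2 * pderiv (pderiv q) - smult (2 * lam + 1) (monom 1 1 * pderiv q)"
    by (rule poly_ext) (simp add: D_def poly_monom power2_eq_square algebra_simps)
  consider "n = 0" | "n = 1" | m where "n = Suc (Suc m)" by (metis One_nat_def not0_implies_Suc)
  then show ?thesis
    by cases (simp_all add: e coeff_monom_mult coeff_pderiv, simp_all add: algebra_simps)
qed

text \<open>The remainder \<open>r\<close> has degree below k because the leading terms cancel, and
  it is orthogonal to all \<open>C j\<close> with j < k because \<open>D\<close> is symmetric and
  does not raise degrees; hence it is zero.\<close>

lemma ode: "D (C k) = smult (- \<kappa> k) (C k)"
proof (cases "k = 0")
  case True
  then have "pderiv (C k) = 0" by (simp add: pderiv_eq_0_iff)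
  then show ?thesis using True by (simp add: D_def \<kappa>_def)
next
  case False
  define r where "r = D (C k) + smult (\<kappa> k) (C k)"
  have "coeff r n = 0" if "n > k - 1" for n
    using that False by (cases "n = k") (auto simp: r_def coeff_D coeff_eq_0 \<kappa>_def)
  then have deg: "degree r \<le> k - 1" by (intro degree_le) auto
  then obtain a where a: "r = (\<Sum>i\<le>k - 1. smult (a i) (C i))" using C_span by blast
  have "L (C j * r) = 0" if "j < k" for j
  proof -
    have "degree (D (C j)) \<le> j" by (intro degree_le) (auto simp: coeff_D coeff_eq_0)
    then have "L (C k * D (C j)) = 0"
      using L_orthogonal[of "D (C j)" k] that by (simp add: mult.commute)
    then show ?thesis using that ortho[of j k]
      by (simp add: r_def distrib_left L_add L_smult L_D_sym[of "C j"])
  qed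
  moreover have "L (C j * r) = a j" if "j < k" for j
    using that by (subst a) (simp add: sum_distrib_left L_sum L_smult ortho if_distrib cong: if_cong)
  ultimately have "a j = 0" if "j < k" for j using that by metis
  then have "r = 0" unfolding a using False by (intro sum.neutral) auto
  then show ?thesis by (simp add: r_def eq_neg_iff_add_eq_0)
qed

lemma ode_at: "(1 - x\<^sup>2) * poly (pderiv (pderiv (C k))) x - (2 * lam + 1) * x * poly (pderiv (C k)) x
    = - \<kappa> k * poly (C k) x"
proof -
  have "poly (D (C k)) x = poly (smult (- \<kappa> k) (C k)) x" by (simp only: ode)
  then show ?thesis by (simp add: D_def power2_eq_square algebra_simps)
qed

lemma L_square_bound:
  assumes "\<And>x. x \<in> {-1..1} \<Longrightarrow> \<bar>poly q x\<bar> \<le> B"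
  shows "\<bar>L (q * (C k * C k))\<bar> \<le> B"
proof -
  have "L (q * (C k * C k)) \<le> L (smult B (C k * C k))"
    using assms by (intro L_mono) (auto intro!: mult_right_mono simp: abs_le_iff)
  moreover have "L (smult (- B) (C k * C k)) \<le> L (q * (C k * C k))"
    using assms unfolding poly_smult poly_mult
    by (intro L_mono) (simp, smt (verit) abs_le_iff mult_right_mono zero_le_square mult_minus_left)
  ultimately show ?thesis by (simp add: L_smult L_minus ortho abs_le_iff)
qed

text \<open>A virial identity: testing the Pearson relation against \<open>(1 - x\<^sup>2) g (C k)'\<^sup>2\<close> shows that every
  limit of the measures \<open>(C k)\<^sup>2 d\<mu>\<close> satisfies the Pearson relation of the arcsine law.\<close>

lemma virial:
  "4 * \<kappa> k * L ((sg * pderiv g - X\<^sub>p * g) * (C k * C k))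
    = - L (D (sg * pderiv g + smult (2 * lam - 1) (X\<^sub>p * g)) * (C k * C k))"
proof -
  let ?p = "C k" and ?p' = "pderiv (C k)"
  let ?s = "smult (2 * lam + 1)"
  \<comment> \<open>h is the coefficient of (1 - x^2) p'^2 that appears when the Pearson relation is
    tested on (1 - x^2) g p'^2 and p'' is eliminated by the differential equation.\<close>
  define h where "h = sg * pderiv g + smult (2 * lam - 1) (X\<^sub>p * g)"
  have ode': "sg * pderiv ?p' = ?s (X\<^sub>p * ?p') - smult (\<kappa> k) ?p"
    using ode[of k] by (simp add: D_def algebra_simps)
  \<comment> \<open>A and B are integrations by parts: A removes p p', B removes p'^2, so everything
    is expressed through p^2.\<close>
  have A: "2 * L (sg * h' * (?p * ?p')) = - L ((sg * pderiv h' - ?s (X\<^sub>p * h')) * (?p * ?p))" for h'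
  proof -
    have "sg * pderiv (h' * (?p * ?p)) - ?s (X\<^sub>p * (h' * (?p * ?p)))
        = smult 2 (sg * h' * (?p * ?p')) + (sg * pderiv h' - ?s (X\<^sub>p * h')) * (?p * ?p)"
      by (rule poly_ext) (simp add: pderiv_mult algebra_simps)
    then show ?thesis using L_pearson[of "h' * (?p * ?p)"] by (simp add: L_add L_smult)
  qed
  have B: "2 * L (h * sg * (?p' * ?p')) = 2 * \<kappa> k * L (h * (?p * ?p)) + L (D h * (?p * ?p))"
  proof -
    have "sg * pderiv (h * (?p * ?p')) - ?s (X\<^sub>p * (h * (?p * ?p')))
        = sg * pderiv h * (?p * ?p') + h * sg * (?p' * ?p') + h * ?p * (sg * pderiv ?p' - ?s (X\<^sub>p * ?p'))"
      by (rule poly_ext) (simp add: pderiv_mult algebra_simps)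
    also have "\<dots> = sg * pderiv h * (?p * ?p') + h * sg * (?p' * ?p') - smult (\<kappa> k) (h * (?p * ?p))"
      unfolding ode' by (rule poly_ext) (simp add: algebra_simps)
    finally have "L (sg * pderiv h * (?p * ?p')) + L (h * sg * (?p' * ?p')) - \<kappa> k * L (h * (?p * ?p)) = 0"
      using L_pearson[of "h * (?p * ?p')"] by (simp only: L_add L_diff L_smult)
    moreover have "2 * L (sg * pderiv h * (?p * ?p')) = - L (D h * (?p * ?p))"
      using A[of "pderiv h"] by (simp add: D_def)
    ultimately show ?thesis by linarith
  qed
  have "sg * pderiv (sg * g * (?p' * ?p')) - ?s (X\<^sub>p * (sg * g * (?p' * ?p')))
      = (sg * pderiv g - smult (2 * lam + 3) (X\<^sub>p * g)) * sg * (?p' * ?p')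
        + smult 2 (sg * g * ?p' * (sg * pderiv ?p'))"
    unfolding mult.assoc[of sg g] pderiv_sg by (rule poly_ext) (simp add: pderiv_mult algebra_simps)
  also have "\<dots> = h * sg * (?p' * ?p') - smult (2 * \<kappa> k) (sg * g * (?p * ?p'))"
    unfolding ode' h_def by (rule poly_ext) (simp add: algebra_simps)
  finally have "L (h * sg * (?p' * ?p')) = \<kappa> k * (2 * L (sg * g * (?p * ?p')))"
    using L_pearson[of "sg * g * (?p' * ?p')"] by (simp only: L_diff L_smult)
  also have "\<dots> = - \<kappa> k * L ((sg * pderiv g - ?s (X\<^sub>p * g)) * (?p * ?p))"
    unfolding A by simp
  finally have "2 * \<kappa> k * (L (h * (?p * ?p)) + L ((sg * pderiv g - ?s (X\<^sub>p * g)) * (?p * ?p))) = - L (D h * (?p * ?p))"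
    using B by (simp add: algebra_simps)
  \<comment> \<open>The terms with \<open>lam\<close> cancel here; what remains is twice the Pearson
    operator of the arcsine law.\<close>
  moreover have "h * (?p * ?p) + (sg * pderiv g - ?s (X\<^sub>p * g)) * (?p * ?p)
      = smult 2 ((sg * pderiv g - X\<^sub>p * g) * (?p * ?p))"
    unfolding h_def by (rule poly_ext) (simp add: algebra_simps)
  then have "L (h * (?p * ?p)) + L ((sg * pderiv g - ?s (X\<^sub>p * g)) * (?p * ?p)) = 2 * L ((sg * pderiv g - X\<^sub>p * g) * (?p * ?p))"
    by (simp only: L_add[symmetric] L_smult[symmetric])
  ultimately show ?thesis unfolding h_def by simp
qed

lemma \<kappa>_pos: "k \<ge> 1 \<Longrightarrow> \<kappa> k > 0"
  unfolding \<kappa>_def using lam by (intro mult_pos_pos) auto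

lemma poly_bounded: "\<exists>B\<ge>0. \<forall>x\<in>{-1..1}. \<bar>poly q x\<bar> \<le> B" for q :: "real poly"
proof -
  have "compact (poly q ` {-1..1})" by (intro compact_continuous_image continuous_intros) auto
  then obtain B where "\<forall>x\<in>{-1..1}. \<bar>poly q x\<bar> \<le> B"
    using compact_imp_bounded[of "poly q ` {-1..1}"] by (fastforce simp: bounded_iff)
  moreover from this have "\<bar>poly q 1\<bar> \<le> B" by simp
  then have "B \<ge> 0" by (rule order_trans[OF abs_ge_zero])
  ultimately show ?thesis by blast
qed

text \<open>Taking g = U_(j-1) in the virial identity turns its left side into the moment of T_j,
  while the right side involves a polynomial depending on j only. Each moment is thus O(1 /
  \<open>\<kappa> k\<close>) = O(1/k^2), which is summable.\<close>

lemma cheb_moment_sum_bounded: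
  assumes "j \<ge> 1"
  shows "\<exists>B\<ge>0. \<forall>m. \<bar>\<Sum>k\<le>m. L (cheb_T j * (C k * C k))\<bar> \<le> B"
proof -
  obtain n where j: "j = Suc n" using assms by (metis Suc_le_D One_nat_def)
  define g where "g = cheb_U n"
  define h where "h = D (sg * pderiv g + smult (2 * lam - 1) (X\<^sub>p * g))"
  obtain B where B: "B \<ge> 0" "\<forall>x\<in>{-1..1}. \<bar>poly h x\<bar> \<le> B" using poly_bounded by blast
  have bd: "\<kappa> k * \<bar>L (cheb_T j * (C k * C k))\<bar> \<le> B" if "k \<ge> 1" for k
  proof -
    have "L ((sg * pderiv g - X\<^sub>p * g) * (C k * C k)) = L (smult (- real j) (cheb_T j * (C k * C k)))"
    proof (rule L_cong)
      fix x :: real assume x: "x \<in> {-1..1}"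
      have "poly (sg * pderiv g - X\<^sub>p * g) x = - real j * T j x"
        using cheb_U_pearson[OF x, of n] by (simp add: g_def j power2_eq_square algebra_simps)
      then show "poly ((sg * pderiv g - X\<^sub>p * g) * (C k * C k)) x = poly (smult (- real j) (cheb_T j * (C k * C k))) x"
        by (simp only: poly_mult poly_smult mult.assoc)
    qed
    then have "4 * \<kappa> k * (- real j * L (cheb_T j * (C k * C k))) = - L (h * (C k * C k))"
      using virial[of k g] by (simp only: L_smult h_def)
    then have "4 * real j * (\<kappa> k * L (cheb_T j * (C k * C k))) = L (h * (C k * C k))"
      by (simp add: algebra_simps)
    then have "\<bar>4 * real j * (\<kappa> k * L (cheb_T j * (C k * C k)))\<bar> \<le> B"
      using L_square_bound[of h B k] B by simp
    then have "4 * real j * (\<kappa> k * \<bar>L (cheb_T j * (C k * C k))\<bar>) \<le> B"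
      using \<kappa>_pos[OF that] by (simp add: abs_mult)
    moreover have "1 * (\<kappa> k * \<bar>L (cheb_T j * (C k * C k))\<bar>) \<le> 4 * real j * (\<kappa> k * \<bar>L (cheb_T j * (C k * C k))\<bar>)"
      using \<kappa>_pos[OF that] assms by (intro mult_right_mono) auto
    ultimately show ?thesis by linarith
  qed
  have bd2: "\<bar>L (cheb_T j * (C k * C k))\<bar> \<le> 1" for k
    by (rule L_square_bound) (rule abs_cheb_T_le)
  \<comment> \<open>A telescoping majorant. The 2 pays for k = 0 and k = 1; the 3 comes from m + 2
    \<le> 3 m when 1/(m (m+1)) is replaced by 3/((m+1) (m+2)).\<close>
  have le1: "(\<Sum>k\<le>m. \<bar>L (cheb_T j * (C k * C k))\<bar>) \<le> 2 + 3 * B * (1 - 1 / (real m + 1))" for m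
  proof (induction m)
    case 0
    show ?case using bd2[of 0] B by simp
  next
    case (Suc m)
    show ?case
    proof (cases "m = 0")
      case True
      then show ?thesis using bd2[of 0] bd2[of 1] B(1) by simp
    next
      case False
      let ?k = "Suc m"
      \<comment> \<open>Uses 2 \<lambda> > -1.\<close>
      have k: "\<kappa> ?k \<ge> (real m + 1) * (real m)"
        unfolding \<kappa>_def using lam by (intro mult_mono) auto
      have "\<bar>L (cheb_T j * (C ?k * C ?k))\<bar> * ((real m + 1) * real m) \<le> B"
        using mult_right_mono[OF k abs_ge_zero[of "L (cheb_T j * (C ?k * C ?k))"]] bd[of ?k]
        by (simp add: mult.commute)
      then have "\<bar>L (cheb_T j * (C ?k * C ?k))\<bar> \<le> B / ((real m + 1) * real m)"
        using False by (simp add: pos_le_divide_eq)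
      also have "\<dots> \<le> 3 * B / ((real m + 1) * (real m + 2))"
      proof -
        have "B * (real m + 2) \<le> B * (3 * real m)" using False B(1) by (intro mult_left_mono) auto
        then show ?thesis using False B(1) by (simp add: divide_simps)
      qed
      also have "\<dots> = 3 * B * (1 / (real m + 1) - 1 / (real m + 2))"
        by (simp add: field_simps)
      finally have "(\<Sum>k\<le>Suc m. \<bar>L (cheb_T j * (C k * C k))\<bar>)
          \<le> 2 + 3 * B * (1 - 1 / (real m + 1)) + 3 * B * (1 / (real m + 1) - 1 / (real m + 2))"
        using Suc.IH by simp
      also have "\<dots> = 2 + 3 * B * (1 - 1 / (real (Suc m) + 1))"
        by (simp add: algebra_simps)
      finally show ?thesis .
    qed
  qed
  have le2: "3 * B * (1 - 1 / (real m + 1)) \<le> 3 * B * 1" for m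
    using B(1) by (intro mult_left_mono) auto
  have "\<bar>\<Sum>k\<le>m. L (cheb_T j * (C k * C k))\<bar> \<le> 2 + 3 * B" for m
    using sum_abs[of "\<lambda>k. L (cheb_T j * (C k * C k))" "{..m}"] le1[of m] le2[of m] by linarith
  then show ?thesis using B(1) by (intro exI[of _ "2 + 3 * B"]) auto
qed

end

subsection \<open>The Christoffel function\<close>

context gegenbauer
begin

definition u :: "nat \<Rightarrow> real \<Rightarrow> real" where "u m x = (\<Sum>k\<le>m. (poly (C k) x)\<^sup>2)"

lemma u_nonneg [simp]: "u m x \<ge> 0"
  by (simp add: u_def sum_nonneg)

lemma u_measurable [measurable]: "u m \<in> borel_measurable borel"
  unfolding u_def[abs_def] by measurable

text \<open>Cauchy-Schwarz for the coefficients of q. Together with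
  \<open>christoffel_extremal\<close> this is the variational description of \<open>u m x\<close>,
  through which different weights can be compared.\<close>

lemma christoffel:
  assumes "degree q \<le> m"
  shows "(poly q x)\<^sup>2 \<le> L (q * q) * u m x"
proof -
  obtain a where a: "q = (\<Sum>k\<le>m. smult (a k) (C k))" using C_span[OF assms] by blast
  have qC: "L (C k * q) = a k" if "k \<le> m" for k
    using that by (subst a) (simp add: sum_distrib_left L_sum L_smult ortho if_distrib cong: if_cong)
  have "L (q * q) = L ((\<Sum>k\<le>m. smult (a k) (C k)) * q)" using a by simp
  also have "\<dots> = (\<Sum>k\<le>m. (a k)\<^sup>2)"
    by (simp add: sum_distrib_right L_sum L_smult qC power2_eq_square)
  finally have Lq: "L (q * q) = (\<Sum>k\<le>m. (a k)\<^sup>2)" .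
  have "poly q x = (\<Sum>k\<le>m. a k * poly (C k) x)" by (subst a) (simp add: poly_sum)
  then show ?thesis unfolding Lq u_def using Cauchy_Schwarz_ineq_sum[of a "\<lambda>k. poly (C k) x" "{..m}"] by simp
qed

lemma christoffel_extremal: "\<exists>q. degree q \<le> m \<and> poly q x = u m x \<and> L (q * q) = u m x"
proof -
  \<comment> \<open>The reproducing kernel with one argument fixed at x, where Cauchy-Schwarz is an
    equality.\<close>
  define q where "q = (\<Sum>k\<le>m. smult (poly (C k) x) (C k))"
  have "degree q \<le> m"
    unfolding q_def by (intro degree_sum_le order_trans[OF degree_smult_le]) auto
  moreover have "poly q x = u m x" by (simp add: q_def u_def poly_sum power2_eq_square)
  moreover have "L (C k * q) = poly (C k) x" if "k \<le> m" for k
    using that by (simp add: q_def sum_distrib_left L_sum L_smult ortho if_distrib cong: if_cong)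
  then have "L (q * q) = u m x"
    by (subst (1) q_def) (simp add: sum_distrib_right L_sum L_smult u_def power2_eq_square)
  ultimately show ?thesis by blast
qed

end

section \<open>The arcsine law as comparison measure; Dirichlet and Fejer polynomials\<close>

lemma cheb_T_integral:
  "(\<integral>x. T i x * T j x \<partial>gegenbauer_measure 0) = (if i = j then if i = 0 then 1 else 1 / 2 else 0)"
proof -
  interpret gegenbauer_param 0 by standard simp
  have T0: "(\<integral>x. T m x \<partial>\<mu>) = (if m = 0 then 1 else 0)" for m
  proof (cases m)
    case 0
    then show ?thesis using integral_arcsine by simp
  next
    case (Suc n)
    have "(\<integral>x. - real m * T m x \<partial>\<mu>)
        = (\<integral>x. (1 - x\<^sup>2) * poly (pderiv (cheb_U n)) x - (2 * 0 + 1) * x * poly (cheb_U n) x \<partial>\<mu>)"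
    proof (rule integral_cong_AE)
      show "AE x in \<mu>. - real m * T m x
          = (1 - x\<^sup>2) * poly (pderiv (cheb_U n)) x - (2 * 0 + 1) * x * poly (cheb_U n) x"
        using AE_Icc by eventually_elim (use cheb_U_pearson[of _ n] Suc in auto)
    qed measurable
    also have "\<dots> = 0" by (rule pearson)
    finally show ?thesis using Suc by simp
  qed
  have TT: "(\<integral>x. T i x * T j x \<partial>\<mu>) = (if i = j then if i = 0 then 1 else 1 / 2 else 0)"
    if "i \<le> j" for i j
  proof -
    have "(\<integral>x. T i x * T j x \<partial>\<mu>)
        = (\<integral>x. (T (j + i) x + T (j - i) x) / 2 \<partial>\<mu>)"
    proof (rule integral_cong_AE)
      show "AE x in \<mu>. T i x * T j x = (T (j + i) x + T (j - i) x) / 2"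
        using AE_Icc by eventually_elim (use cheb_T_mult[OF _ that] in auto)
    qed measurable
    also have "\<dots> = ((\<integral>x. T (j + i) x \<partial>\<mu>) + (\<integral>x. T (j - i) x \<partial>\<mu>)) / 2"
      by simp
    also have "\<dots> = (if i = j then if i = 0 then 1 else 1 / 2 else 0)"
      using that by (simp add: T0)
    finally show ?thesis .
  qed
  then show ?thesis
    using TT[of i j] TT[of j i] by (cases "i \<le> j") (auto simp: mult.commute)
qed

lemma cheb_normalized:
  "normalized_gegenbauer 0 (\<lambda>k. smult (if k = 0 then 1 else sqrt 2) (cheb_T k))"
proof -
  interpret gegenbauer_param 0 by standard simp
  let ?a = "\<lambda>k::nat. if k = 0 then 1 else sqrt 2"
  have "(\<integral>x. poly (smult (?a i) (cheb_T i)) x * poly (smult (?a j) (cheb_T j)) x \<partial>\<mu>)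
      = (if i = j then 1 else 0)" for i j
  proof -
    have "(\<integral>x. poly (smult (?a i) (cheb_T i)) x * poly (smult (?a j) (cheb_T j)) x \<partial>\<mu>)
        = (\<integral>x. (?a i * ?a j) * (T i x * T j x) \<partial>\<mu>)"
      by (intro Bochner_Integration.integral_cong) (auto simp: algebra_simps)
    also have "\<dots> = (?a i * ?a j) * (\<integral>x. T i x * T j x \<partial>\<mu>)"
      by (rule integral_mult_right_zero)
    finally show ?thesis by (simp add: cheb_T_integral)
  qed
  then show ?thesis by (simp add: normalized_gegenbauer_def degree_cheb_T)
qed

text \<open>A second instance, available for every \<open>lam\<close>: \<open>cheb.L\<close> and
  \<open>cheb.u\<close> belong to the arcsine law against which general weights are
  compared.\<close>

interpretation cheb: gegenbauer 0 "\<lambda>k. smult (if k = 0 then 1 else sqrt 2) (cheb_T k)"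
  by standard (simp_all add: cheb_normalized)

lemma cheb_u_le:
  assumes "x \<in> {-1..1}"
  shows "cheb.u m x \<le> 1 + 2 * real m"
proof -
  have sq: "(T k x)\<^sup>2 \<le> 1" for k
    using abs_cheb_T_le[OF assms, of k] by (simp add: abs_square_le_1)
  have "cheb.u m x \<le> (\<Sum>k\<le>m. if k = 0 then 1 else 2)"
    unfolding cheb.u_def using sq by (intro sum_mono) (auto simp: power_mult_distrib)
  also have "\<dots> = 1 + 2 * real m" by (induction m) auto
  finally show ?thesis .
qed

text \<open>The Dirichlet kernel 1 + 2 T_1 + ... + 2 T_k as a polynomial in cos t.\<close>

primrec cheb_D :: "nat \<Rightarrow> real poly" where
  "cheb_D 0 = 1"
| "cheb_D (Suc k) = cheb_D k + smult 2 (cheb_T (Suc k))"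

text \<open>The unnormalised Fejer kernel: its value at cos t is (1 - cos(j t)) / (1 - cos t), of
  size j^2 near t = 0 and at most 2 / (1 - cos t) elsewhere.\<close>

primrec cheb_F :: "nat \<Rightarrow> real poly" where
  "cheb_F 0 = 0"
| "cheb_F (Suc j) = cheb_F j + cheb_D j"

lemma degree_cheb_D: "degree (cheb_D k) \<le> k"
  by (induction k) (auto intro!: degree_add_le order_trans[OF degree_smult_le] simp: degree_cheb_T)

lemma degree_cheb_F: "degree (cheb_F j) \<le> j"
  by (induction j) (auto intro!: degree_add_le order_trans[OF degree_cheb_D])

lemma cheb_D_cos: "(1 - cos t) * poly (cheb_D k) (cos t) = cos (real k * t) - cos (real (Suc k) * t)"
proof (induction k)
  case (Suc k)
  have "(1 - cos t) * (2 * cos (real (Suc k) * t)) = - cos (real k * t) + 2 * cos (real (Suc k) * t) - cos (real (Suc (Suc k)) * t)"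
    using cos_add[of "real (Suc k) * t" t] cos_diff[of "real (Suc k) * t" t] by (simp add: algebra_simps)
  with Suc show ?case by (simp add: distrib_left poly_cheb_T_cos del: cheb_T.simps of_nat_Suc)
qed auto

lemma cheb_F_cos: "(1 - cos t) * poly (cheb_F j) (cos t) = 1 - cos (real j * t)"
  by (induction j) (simp_all add: distrib_left cheb_D_cos)

lemma abs_cheb_D_le: "x \<in> {-1..1} \<Longrightarrow> \<bar>poly (cheb_D k) x\<bar> \<le> 2 * real k + 1"
proof (induction k)
  case (Suc k)
  then show ?case using abs_cheb_T_le[of x "Suc k"] abs_triangle_ineq[of "poly (cheb_D k) x" "2 * T (Suc k) x"]
    by (simp add: abs_mult del: cheb_T.simps)
qed auto

lemma abs_cheb_F_le: "x \<in> {-1..1} \<Longrightarrow> \<bar>poly (cheb_F j) x\<bar> \<le> (real j)\<^sup>2"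
proof (induction j)
  case (Suc j)
  then show ?case using abs_cheb_D_le[of x j] abs_triangle_ineq[of "poly (cheb_F j) x" "poly (cheb_D j) x"]
    by (simp add: power2_eq_square algebra_simps)
qed auto

lemma abs_cheb_F_le':
  assumes "x \<in> {-1..1}"
  shows "(1 - x) * \<bar>poly (cheb_F j) x\<bar> \<le> 2"
proof -
  have "(1 - x) * \<bar>poly (cheb_F j) x\<bar> = \<bar>(1 - x) * poly (cheb_F j) x\<bar>" using assms by (simp add: abs_mult)
  also have "\<dots> = \<bar>1 - cos (real j * arccos x)\<bar>" using cheb_F_cos[of "arccos x" j] assms by simp
  also have "\<dots> \<le> 2" using abs_cos_le_one[of "real j * arccos x"] by linarith
  finally show ?thesis .
qed

lemma one_minus_cos_le: "1 - cos t \<le> t\<^sup>2 / 2" if "t \<ge> 0" for t :: real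
proof -
  have "1 - cos t = 2 * (sin (t / 2))\<^sup>2" using cos_double_sin[of "t / 2"] by simp
  also have "(sin (t / 2))\<^sup>2 \<le> (t / 2)\<^sup>2"
  proof -
    have "\<bar>sin (t / 2)\<bar> \<le> \<bar>t / 2\<bar>" using abs_sin_x_le_abs_x by blast
    then show ?thesis by (simp only: abs_le_square_iff)
  qed
  finally show ?thesis by (simp add: power2_eq_square field_simps)
qed

lemma one_minus_cos_ge: "t\<^sup>2 / 8 \<le> 1 - cos t" if t: "t \<ge> 0" "t \<le> pi / 2" for t :: real
proof -
  have "(\<lambda>x. sin x - x / 2) 0 \<le> (\<lambda>x. sin x - x / 2) (t / 2)"
  proof (rule DERIV_nonneg_imp_nondecreasing[of 0 "t / 2" "\<lambda>x. sin x - x / 2"])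
    fix x assume x: "0 \<le> x" "x \<le> t / 2"
    then have "cos (pi / 3) \<le> cos x" using t pi_gt_zero by (intro cos_monotone_0_pi_le) auto
    moreover have "((\<lambda>x. sin x - x / 2) has_real_derivative cos x - 1 / 2) (at x)"
      by (auto intro!: derivative_eq_intros)
    ultimately show "\<exists>y. ((\<lambda>x. sin x - x / 2) has_real_derivative y) (at x) \<and> 0 \<le> y"
      by (intro exI[of _ "cos x - 1 / 2"]) (simp add: cos_60)
  qed (use t in auto)
  then have "t / 4 \<le> sin (t / 2)" by simp
  then have "(t / 4)\<^sup>2 \<le> (sin (t / 2))\<^sup>2" using t by (intro power_mono) auto
  moreover have "1 - cos t = 2 * (sin (t / 2))\<^sup>2" using cos_double_sin[of "t / 2"] by simp
  ultimately show ?thesis by (simp add: power2_eq_square)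
qed

text \<open>Up to distance 1/j from its peak the Fejer kernel keeps a fixed part of its maximum j^2:
  the quotient of (j t)^2 / 8 and t^2 / 2. The kernel with j = 1 is constant, which covers t >
  1.\<close>

lemma cheb_F_ge:
  assumes t: "0 < t" "t \<le> pi / 2" and j: "j \<ge> 1" "j = 1 \<or> real j * t \<le> 1"
  shows "(real j)\<^sup>2 / 4 \<le> poly (cheb_F j) (cos t)"
proof (cases "j = 1")
  case False
  then have jt: "real j * t \<le> 1" using j by auto
  have c: "0 < 1 - cos t" using cos_monotone_0_pi[of 0 t] t pi_gt_zero by simp
  have "(real j)\<^sup>2 / 4 * (1 - cos t) \<le> (real j)\<^sup>2 / 4 * (t\<^sup>2 / 2)"
    using one_minus_cos_le[of t] t by (intro mult_left_mono) auto
  also have "\<dots> = (real j * t)\<^sup>2 / 8" by (simp add: power_mult_distrib)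
  also have "\<dots> \<le> 1 - cos (real j * t)"
    using jt t pi_gt3 by (intro one_minus_cos_ge) auto
  also have "\<dots> = poly (cheb_F j) (cos t) * (1 - cos t)" using cheb_F_cos[of t j] by (simp add: mult.commute)
  finally show ?thesis using c by (simp add: mult_le_cancel_right_pos)
qed simp

text \<open>The normalised Fejer polynomial is at most \<open>min 1 (2 / (j\<^sup>2 (1 - x)))\<close>, so its square
  compensates a factor \<open>(1 - x\<^sup>2) powr s\<close> for every \<open>s\<close> up to 2.\<close>

lemma fejer_weight_le:
  assumes x: "x \<in> {-1<..<1}" and j: "j \<ge> 1" and s: "0 \<le> s" "s \<le> 2"
  shows "(1 - x\<^sup>2) powr s * (poly (cheb_F j) x / (real j)\<^sup>2)\<^sup>2 \<le> (4 / (real j)\<^sup>2) powr s"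
proof -
  define f where "f = \<bar>poly (cheb_F j) x / (real j)\<^sup>2\<bar>"
  define d where "d = 2 / (real j)\<^sup>2"
  have d: "d > 0" using j by (simp add: d_def)
  have f1: "0 \<le> f" "f \<le> 1" using abs_cheb_F_le[of x j] x j by (auto simp: f_def field_simps)
  have "f * (1 - x) = (1 - x) * \<bar>poly (cheb_F j) x\<bar> / (real j)\<^sup>2" by (simp add: f_def)
  also have "\<dots> \<le> d" unfolding d_def using abs_cheb_F_le'[of x j] x by (intro divide_right_mono) auto
  finally have f2: "f \<le> d / (1 - x)" using x by (simp add: pos_le_divide_eq)
  \<comment> \<open>The two bounds 1 and d / (1 - x) for f cross at 1 - x = d;
    \<open>s \<le> 2\<close> is used beyond that point.\<close>
  have "(1 - x) powr s * f\<^sup>2 \<le> d powr s"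
  proof (cases "1 - x \<le> d")
    case True
    have "(1 - x) powr s * f\<^sup>2 \<le> (1 - x) powr s * 1" using f1 by (intro mult_left_mono) (auto simp: abs_square_le_1)
    also have "\<dots> \<le> d powr s" using True x s by (simp add: powr_mono2)
    finally show ?thesis .
  next
    case False
    have "(1 - x) powr s * f\<^sup>2 \<le> (1 - x) powr s * (d / (1 - x))\<^sup>2" using f1 f2 by (intro mult_left_mono power_mono) auto
    also have "\<dots> = d powr 2 * ((1 - x) powr s / (1 - x) powr 2)" using d x by (simp add: power_divide)
    also have "\<dots> = d powr 2 * (1 - x) powr - (2 - s)" by (simp add: powr_diff[symmetric])
    also have "\<dots> \<le> d powr 2 * d powr - (2 - s)" using False d s by (intro mult_left_mono powr_mono2') auto
    also have "\<dots> = d powr s" by (simp add: powr_add[symmetric])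
    finally show ?thesis .
  qed
  moreover have "(1 - x\<^sup>2) powr s \<le> 2 powr s * (1 - x) powr s"
  proof -
    have "1 - x\<^sup>2 = (1 + x) * (1 - x)" by (simp add: power2_eq_square algebra_simps)
    also have "\<dots> \<le> 2 * (1 - x)" using x by (intro mult_right_mono) auto
    finally have "(1 - x\<^sup>2) powr s \<le> (2 * (1 - x)) powr s"
      using s x by (intro powr_mono2) (auto simp: abs_square_le_1 abs_le_iff)
    also have "(2 * (1 - x)) powr s = 2 powr s * (1 - x) powr s" using x by (intro powr_mult)
    finally show ?thesis .
  qed
  ultimately have "(1 - x\<^sup>2) powr s * f\<^sup>2 \<le> 2 powr s * d powr s"
    by (smt (verit, best) mult.assoc mult_left_mono mult_right_mono powr_ge_zero zero_le_power2)
  also have "\<dots> = (4 / (real j)\<^sup>2) powr s" using d by (simp add: powr_mult[symmetric] d_def)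
  finally have "(1 - x\<^sup>2) powr s * f\<^sup>2 \<le> (4 / (real j)\<^sup>2) powr s" .
  then show ?thesis unfolding f_def power2_abs .
qed

section \<open>Bounds for the Christoffel function in the interior and near the end points\<close>

lemma cos_inverse_nat:
  assumes "m \<ge> 1"
  shows "0 \<le> cos (1 / real m)" "cos (1 / real m) < 1"
proof -
  have m: "0 < 1 / real m" "1 / real m \<le> 1" using assms by auto
  then have "1 / real m \<le> pi / 2" "1 / real m \<le> pi" "- (pi / 2) \<le> 1 / real m" using pi_gt3 by linarith+
  then show "0 \<le> cos (1 / real m)" "cos (1 / real m) < 1"
    using cos_ge_zero[of "1 / real m"] cos_monotone_0_pi[of 0 "1 / real m"] m by auto
qed

text \<open>Sonin's function S = k p^2 + (1 - x^2) p'^2 has derivative 4 a x p'^2, so it increases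
  on [0, 1], and S(1) = k p(1)^2. The parameters a and k are free so that the lemma applies to
  \<open>C k\<close> and also to its derivative.\<close>

lemma sonin:
  fixes p :: "real poly"
  assumes a: "a \<ge> 0" and k: "k > 0" and x: "x \<in> {0..1}"
    and ode: "\<And>x. (1 - x\<^sup>2) * poly (pderiv (pderiv p)) x - (2 * a + 1) * x * poly (pderiv p) x = - k * poly p x"
  shows "\<bar>poly p x\<bar> \<le> \<bar>poly p 1\<bar>"
proof -
  let ?S = "\<lambda>x. k * (poly p x)\<^sup>2 + (1 - x\<^sup>2) * (poly (pderiv p) x)\<^sup>2"
  have "?S x \<le> ?S 1"
  proof (rule DERIV_nonneg_imp_nondecreasing[of x 1 ?S])
    fix y :: real assume y: "x \<le> y" "y \<le> 1"
    have "(?S has_real_derivative (k * (2 * poly p y * poly (pderiv p) y) +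
        ((- (2 * y)) * (poly (pderiv p) y)\<^sup>2 + (1 - y\<^sup>2) * (2 * poly (pderiv p) y * poly (pderiv (pderiv p)) y)))) (at y)"
      by (auto intro!: derivative_eq_intros poly_DERIV)
    moreover have "k * (2 * poly p y * poly (pderiv p) y) +
        ((- (2 * y)) * (poly (pderiv p) y)\<^sup>2 + (1 - y\<^sup>2) * (2 * poly (pderiv p) y * poly (pderiv (pderiv p)) y))
       = 4 * a * y * (poly (pderiv p) y)\<^sup>2"
    proof -
      have e: "(1 - y\<^sup>2) * poly (pderiv (pderiv p)) y = (2 * a + 1) * y * poly (pderiv p) y - k * poly p y"
        using ode[of y] by linarith
      have "(1 - y\<^sup>2) * (2 * poly (pderiv p) y * poly (pderiv (pderiv p)) y)
        = 2 * poly (pderiv p) y * ((1 - y\<^sup>2) * poly (pderiv (pderiv p)) y)" by simp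
      also note e
      finally have "(1 - y\<^sup>2) * (2 * poly (pderiv p) y * poly (pderiv (pderiv p)) y)
        = 2 * poly (pderiv p) y * ((2 * a + 1) * y * poly (pderiv p) y - k * poly p y)" .
      then show ?thesis by (simp add: power2_eq_square algebra_simps)
    qed
    ultimately show "\<exists>z. (?S has_real_derivative z) (at y) \<and> 0 \<le> z"
      using a x y by (intro exI[of _ "4 * a * y * (poly (pderiv p) y)\<^sup>2"]) auto
  qed (use x in auto)
  moreover have "0 \<le> (1 - x\<^sup>2) * (poly (pderiv p) x)\<^sup>2" using x by (simp add: abs_square_le_1)
  ultimately have "k * (poly p x)\<^sup>2 \<le> k * (poly p 1)\<^sup>2" by simp
  then show ?thesis using k by (simp add: abs_le_square_iff)
qed

context gegenbauer
begin

text \<open>The domination bounds the arcsine norm of Q by the \<lambda>-norm of q, with the ratio 1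
  / (\<open>pi * c\<^sub>w\<close>) of the normalising constants. The Christoffel inequality for the
  arcsine law, where \<open>cheb.u M\<close> is at most 1 + 2 M, then bounds Q at the point.\<close>

lemma arcsine_comparison:
  assumes Q: "degree Q \<le> M" and x0: "x0 \<in> {-1..1}" and B: "B \<ge> 0"
    and le: "\<And>x. x \<in> {-1<..<1} \<Longrightarrow> (poly Q x)\<^sup>2 \<le> B * (1 - x\<^sup>2) powr lam * (poly q x)\<^sup>2"
  shows "(poly Q x0)\<^sup>2 \<le> (1 + 2 * real M) * (B / (pi * c\<^sub>w)) * L (q * q)"
proof -
  let ?w = "gegenbauer_weight"
  have "cheb.L (Q * Q) = (\<integral>x. indicator {-1..1} x * ?w 0 x * poly (Q * Q) x \<partial>lborel)"
    unfolding cheb.L_def by (rule cheb.integral_mu) measurable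
  also have "\<dots> \<le> (\<integral>x. B / (pi * c\<^sub>w) * (indicator {-1..1} x * ?w lam x * poly (q * q) x) \<partial>lborel)"
  proof (rule integral_mono)
    show "integrable lborel (\<lambda>x. indicator {-1..1} x * ?w 0 x * poly (Q * Q) x)"
      using cheb.integrable_poly[of "Q * Q"] by (subst (asm) cheb.integrable_mu) measurable
    show "integrable lborel (\<lambda>x. B / (pi * c\<^sub>w) * (indicator {-1..1} x * ?w lam x * poly (q * q) x))"
      using integrable_poly[of "q * q"] integrable_mu[OF poly_measurable[of "q * q"]]
      by (intro integrable_mult_right) blast
    fix x :: real
    show "indicator {-1..1} x * ?w 0 x * poly (Q * Q) x \<le> B / (pi * c\<^sub>w) * (indicator {-1..1} x * ?w lam x * poly (q * q) x)"
    proof (cases "x \<in> {-1<..<1}")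
      case True
      have "?w 0 x * (poly Q x)\<^sup>2 \<le> ?w 0 x * (B * (1 - x\<^sup>2) powr lam * (poly q x)\<^sup>2)"
        using le[OF True] cheb.weight_nonneg by (intro mult_left_mono)
      also have "\<dots> = B / (pi * c\<^sub>w) * (?w lam x * (poly q x)\<^sup>2)"
        using c_pos powr_add[of "1 - x\<^sup>2" "- (1 / 2)" lam]
        by (simp add: gegenbauer_weight_eq gegenbauer_const_0 field_simps)
      finally show ?thesis using True by (simp add: power2_eq_square)
    next
      case False
      then have "indicator {-1..1} x = (0::real) \<or> x = 1 \<or> x = -1" by (auto simp: indicator_def)
      then show ?thesis by (auto simp: gegenbauer_weight_eq)
    qed
  qed
  also have "\<dots> = B / (pi * c\<^sub>w) * (\<integral>x. indicator {-1..1} x * ?w lam x * poly (q * q) x \<partial>lborel)"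
    by (rule integral_mult_right_zero)
  also have "(\<integral>x. indicator {-1..1} x * ?w lam x * poly (q * q) x \<partial>lborel) = L (q * q)"
    unfolding L_def by (rule integral_mu[symmetric]) measurable
  finally have LQ: "cheb.L (Q * Q) \<le> B / (pi * c\<^sub>w) * L (q * q)" .
  have L0: "0 \<le> cheb.L (Q * Q)" using cheb.L_mono[of 0 "Q * Q"] by simp
  have "(poly Q x0)\<^sup>2 \<le> cheb.L (Q * Q) * cheb.u M x0" by (rule cheb.christoffel[OF Q])
  also have "\<dots> \<le> cheb.L (Q * Q) * (1 + 2 * real M)"
    using cheb_u_le[OF x0, of M] L0 by (intro mult_left_mono) auto
  also have "\<dots> \<le> (B / (pi * c\<^sub>w) * L (q * q)) * (1 + 2 * real M)"
    using LQ by (intro mult_right_mono) auto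
  finally show ?thesis by (simp add: mult_ac)
qed

text \<open>The extremal polynomial \<open>q\<close> at \<open>cos t\<close> is multiplied by \<open>(1 - x\<^sup>2) ^ h\<close>, which passes to a weight with
  an even exponent \<open>2 h \<ge> lam\<close>, and by a Fejer polynomial of degree about \<open>1 / t\<close>, which recovers the loss
  \<open>(1 - x\<^sup>2) powr (2 h - lam)\<close> at the scale \<open>t\<close>; the product is then tested against the arcsine law.\<close>

lemma interior_bound:
  assumes lam0: "lam \<ge> 0"
  shows "\<exists>B\<ge>0. \<forall>m\<ge>1. \<forall>t\<in>{1 / real m..pi / 2}. u m (cos t) * (1 - (cos t)\<^sup>2) powr lam \<le> B * real m"
proof -
  \<comment> \<open>The least integer with 2 h \<ge> \<lambda>, so that s = 2 h - \<lambda> stays in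
    the range of \<open>fejer_weight_le\<close>.\<close>
  define h where "h = nat \<lceil>lam / 2\<rceil>"
  define s where "s = 2 * real h - lam"
  have s: "0 \<le> s" "s \<le> 2" using lam0 unfolding s_def h_def by linarith+
  \<comment> \<open>16 undoes the squared lower bound 1/4 for the normalised Fejer polynomial, 5 + 4
    h comes from the degree 2 m + 2 h of Q, and 128 from 4/j^2 \<le> 16 t^2 \<le> 128 (1 -
    x0^2).\<close>
  define B where "B = 16 * (5 + 4 * real h) * (128 powr s / (pi * c\<^sub>w))"
  have B0: "B \<ge> 0" using c_pos by (simp add: B_def)
  have main: "u m (cos t) * (1 - (cos t)\<^sup>2) powr lam \<le> B * real m"
    if m: "m \<ge> 1" and t: "1 / real m \<le> t" "t \<le> pi / 2" for m :: nat and t :: real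
  proof -
    define x0 where "x0 = cos t"
    have t0: "t > 0" using m by (intro less_le_trans[OF _ t(1)]) simp
    have x0: "0 \<le> x0" "x0 < 1"
      unfolding x0_def using t t0 pi_gt_zero cos_monotone_0_pi[of 0 t] by (auto intro: cos_ge_zero)
    \<comment> \<open>About 1/t: small enough for the Fejer peak to reach t, large enough that 1/j^2
      is comparable with 1 - x0^2. The assumption t \<ge> 1/m gives j \<le> m and keeps the degree
      of Q linear in m.\<close>
    define j where "j = (if t \<le> 1 then nat \<lfloor>1 / t\<rfloor> else 1)"
    have j: "j \<ge> 1" "j = 1 \<or> real j * t \<le> 1" "1 / real j \<le> 2 * t" "j \<le> m"
    proof -
      have *: "1 \<le> \<lfloor>1 / t\<rfloor>" "real (nat \<lfloor>1 / t\<rfloor>) \<le> 1 / t" "1 / t < real (nat \<lfloor>1 / t\<rfloor>) + 1" if "t \<le> 1"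
      proof -
        show 1: "1 \<le> \<lfloor>1 / t\<rfloor>" using that t0 by (simp add: le_floor_iff)
        show "real (nat \<lfloor>1 / t\<rfloor>) \<le> 1 / t" "1 / t < real (nat \<lfloor>1 / t\<rfloor>) + 1" using 1 by linarith+
      qed
      show j1: "j \<ge> 1"
      proof (cases "t \<le> 1")
        case True
        then have "j = nat \<lfloor>1 / t\<rfloor>" by (simp add: j_def)
        then show ?thesis using *(1)[OF True] by linarith
      qed (simp add: j_def)
      show "j = 1 \<or> real j * t \<le> 1"
      proof (cases "t \<le> 1")
        case True
        then have "real j \<le> 1 / t" using *(2) by (simp add: j_def)
        then show ?thesis using t0 by (simp add: pos_le_divide_eq)
      qed (simp add: j_def)
      show "1 / real j \<le> 2 * t"
      proof (cases "t \<le> 1")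
        case True
        have "1 / t \<le> 2 * real j" using *(3)[OF True] j1 True unfolding j_def by simp
        then show ?thesis using j1 t0 by (simp add: field_simps)
      qed (simp add: j_def)
      show "j \<le> m"
      proof (cases "t \<le> 1")
        case True
        have "1 / t \<le> real m" using t(1) t0 m by (simp add: field_simps)
        then have "real j \<le> real m" using *(2)[OF True] True by (simp add: j_def)
        then show ?thesis by simp
      qed (use m in \<open>simp add: j_def\<close>)
    qed
    obtain q where q: "degree q \<le> m" "poly q x0 = u m x0" "L (q * q) = u m x0" using christoffel_extremal by blast
    define F where "F = smult (1 / (real j)\<^sup>2) (cheb_F j)"
    define Q where "Q = q * sg ^ h * F"
    define v where "v = 1 - x0\<^sup>2"
    have v: "v > 0" using x0 by (simp add: v_def abs_square_less_1)
    have degQ: "degree Q \<le> 2 * m + 2 * h"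
    proof -
      have "degree (sg ^ h) \<le> 2 * h" using degree_power_le[of sg h] by simp
      moreover have "degree F \<le> m"
        unfolding F_def using degree_smult_le[of "1 / (real j)\<^sup>2" "cheb_F j"] degree_cheb_F[of j] j(4) by linarith
      ultimately show ?thesis
        unfolding Q_def using degree_mult_le[of "q * sg ^ h" F] degree_mult_le[of q "sg ^ h"] q(1) by linarith
    qed
    have Qx: "(poly Q x)\<^sup>2 = (poly q x)\<^sup>2 * (1 - x\<^sup>2) powr (lam + s) * (poly (cheb_F j) x / (real j)\<^sup>2)\<^sup>2"
      if "x \<in> {-1<..<1}" for x
    proof -
      have p: "1 - x\<^sup>2 > 0" using that by (simp add: abs_square_less_1 abs_less_iff)
      have "((1 - x\<^sup>2) ^ h)\<^sup>2 = (1 - x\<^sup>2) powr real (h * 2)"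
        using p by (simp only: powr_realpow power_mult)
      also have "real (h * 2) = lam + s" by (simp add: s_def)
      finally have "((1 - x\<^sup>2) ^ h)\<^sup>2 = (1 - x\<^sup>2) powr (lam + s)" .
      moreover have "poly Q x = poly q x * (1 - x\<^sup>2) ^ h * (poly (cheb_F j) x / (real j)\<^sup>2)"
        by (simp add: Q_def F_def poly_power power2_eq_square)
      ultimately show ?thesis by (simp only: power_mult_distrib)
    qed
    have "(poly Q x0)\<^sup>2 \<le> (1 + 2 * real (2 * m + 2 * h)) * ((4 / (real j)\<^sup>2) powr s / (pi * c\<^sub>w)) * L (q * q)"
    proof (rule arcsine_comparison[OF degQ])
      fix x :: real assume x: "x \<in> {-1<..<1}"
      have "(poly Q x)\<^sup>2 = (1 - x\<^sup>2) powr lam * (poly q x)\<^sup>2 * ((1 - x\<^sup>2) powr s * (poly (cheb_F j) x / (real j)\<^sup>2)\<^sup>2)"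
        unfolding Qx[OF x] powr_add by (simp only: mult_ac)
      also have "\<dots> \<le> (1 - x\<^sup>2) powr lam * (poly q x)\<^sup>2 * (4 / (real j)\<^sup>2) powr s"
        using fejer_weight_le[OF x j(1) s] by (intro mult_left_mono) auto
      finally show "(poly Q x)\<^sup>2 \<le> (4 / (real j)\<^sup>2) powr s * (1 - x\<^sup>2) powr lam * (poly q x)\<^sup>2" by (simp only: mult_ac)
    qed (use x0 in auto)
    also have "\<dots> \<le> ((5 + 4 * real h) * real m) * ((128 * v) powr s / (pi * c\<^sub>w)) * u m x0"
    proof -
      have "4 / (real j)\<^sup>2 = 4 * (1 / real j)\<^sup>2" by (simp add: power_divide)
      also have "\<dots> \<le> 4 * (2 * t)\<^sup>2" using j by (intro mult_left_mono power_mono) auto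
      also have "\<dots> = 128 * (t\<^sup>2 / 8)" by (simp add: power2_eq_square)
      also have "\<dots> \<le> 128 * v"
      proof -
        have "t\<^sup>2 / 8 \<le> 1 - x0" unfolding x0_def using t t0 by (intro one_minus_cos_ge) auto
        also have "x0\<^sup>2 \<le> x0" using x0 by (simp add: power2_eq_square mult_left_le)
        then have "1 - x0 \<le> v" by (simp add: v_def)
        finally show ?thesis by simp
      qed
      finally have "(4 / (real j)\<^sup>2) powr s \<le> (128 * v) powr s" using s by (intro powr_mono2) auto
      moreover have "1 + 2 * real (2 * m + 2 * h) \<le> (5 + 4 * real h) * real m"
      proof -
        have "4 * real h * 1 \<le> 4 * real h * real m" using m by (intro mult_left_mono) auto
        then show ?thesis using m by (simp add: algebra_simps)
      qed
      ultimately show ?thesis unfolding q(3) using c_pos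
        by (intro mult_mono divide_right_mono) (auto intro!: mult_nonneg_nonneg)
    qed
    finally have up: "(poly Q x0)\<^sup>2 \<le> ((5 + 4 * real h) * real m) * ((128 * v) powr s / (pi * c\<^sub>w)) * u m x0" .
    have "1 / 4 \<le> poly (cheb_F j) x0 / (real j)\<^sup>2"
      using cheb_F_ge[OF t0 t(2) j(1,2)] j(1) unfolding x0_def by (simp add: field_simps)
    then have "(1 / 4)\<^sup>2 \<le> (poly (cheb_F j) x0 / (real j)\<^sup>2)\<^sup>2" by (intro power_mono) auto
    then have "(u m x0)\<^sup>2 * v powr (lam + s) * (1 / 4)\<^sup>2 \<le> (poly Q x0)\<^sup>2"
      using Qx[of x0] x0 q(2) unfolding v_def by (auto intro!: mult_left_mono)
    with up have "(u m x0)\<^sup>2 * v powr (lam + s) \<le> 16 * (((5 + 4 * real h) * real m) * ((128 * v) powr s / (pi * c\<^sub>w)) * u m x0)"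
      by (simp add: power2_eq_square)
    also have "\<dots> = (B * real m) * u m x0 * v powr s"
      using v by (simp add: B_def powr_mult)
    \<comment> \<open>\<open>u m x0\<close> enters squared on the left, as the value of the extremal
      q at x0, but only once on the right, as its norm; one factor can be divided out.\<close>
    finally have "(u m x0 * v powr lam) * (u m x0 * v powr s) \<le> (B * real m) * (u m x0 * v powr s)"
      by (simp add: power2_eq_square powr_add mult_ac)
    moreover have "u m x0 * v powr s > 0 \<or> u m x0 = 0" using v u_nonneg[of m x0] by (auto simp: less_le)
    ultimately have "u m x0 * v powr lam \<le> B * real m"
      using B0 by (auto simp: mult_le_cancel_right_pos)
    then show ?thesis by (simp add: x0_def v_def)
  qed
  show ?thesis using B0 main by (intro exI[of _ B]) auto
qed

lemma C_le_C_1: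
  assumes "lam \<ge> 0" "x \<in> {0..1}"
  shows "\<bar>poly (C k) x\<bar> \<le> \<bar>poly (C k) 1\<bar>"
proof (cases "k = 0")
  case True
  then obtain c where "C k = [:c:]" using degree_C[of k] by (metis degree_eq_zeroE)
  then show ?thesis by simp
next
  case False
  then show ?thesis
    using sonin[OF assms(1) \<kappa>_pos[of k] assms(2) ode_at] by simp
qed

text \<open>The derivative satisfies the Gegenbauer equation for \<lambda> + 1 with eigenvalue
  \<open>\<kappa> k\<close> - (2 \<lambda> + 1) = (k - 1) (k + 1 + 2 \<lambda>), positive for k
  \<ge> 2, so \<open>sonin\<close> applies again.\<close>

lemma pderiv_C_le:
  assumes "lam \<ge> 0" "x \<in> {0..1}"
  shows "\<bar>poly (pderiv (C k)) x\<bar> \<le> \<bar>poly (pderiv (C k)) 1\<bar>"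
proof (cases "k \<le> 1")
  case True
  then have "degree (pderiv (C k)) = 0" by (simp add: degree_pderiv)
  then obtain c where "pderiv (C k) = [:c:]" by (metis degree_eq_zeroE)
  then show ?thesis by simp
next
  case False
  have "pderiv (D (C k)) = smult (- \<kappa> k) (pderiv (C k))"
    by (simp only: ode pderiv_smult)
  then have "poly (pderiv (D (C k))) y = - \<kappa> k * poly (pderiv (C k)) y" for y by simp
  then have o: "(1 - y\<^sup>2) * poly (pderiv (pderiv (pderiv (C k)))) y - (2 * (lam + 1) + 1) * y * poly (pderiv (pderiv (C k))) y
      = - (\<kappa> k - (2 * lam + 1)) * poly (pderiv (C k)) y" for y
    unfolding pderiv_D by (simp add: power2_eq_square algebra_simps)
  have "\<kappa> k - (2 * lam + 1) = (real k - 1) * (real k + 1 + 2 * lam)"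
    by (simp add: \<kappa>_def algebra_simps)
  also have "\<dots> > 0" using False assms(1) by (intro mult_pos_pos) auto
  finally have "\<kappa> k - (2 * lam + 1) > 0" .
  then show ?thesis using assms(1) by (intro sonin[OF _ _ assms(2) o]) auto
qed

text \<open>The derivative of \<open>C k\<close> is largest at 1, so \<open>C k\<close> loses at most half of its end point value on
  the cap \<open>arccos x \<le> 1 / m\<close>, which \<open>interior_bound\<close> does not reach.\<close>

lemma C_near_1:
  assumes "lam \<ge> 0" "m \<ge> 1" "k \<le> m"
  shows "\<bar>poly (C k) 1\<bar> \<le> 2 * \<bar>poly (C k) (cos (1 / real m))\<bar>"
proof -
  define x where "x = cos (1 / real m)"
  have m1: "1 / real m \<le> 1" using assms(2) by simp
  have x: "0 \<le> x" "x < 1"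
    unfolding x_def using cos_inverse_nat[OF assms(2)] by auto
  \<comment> \<open>At x = 1 the second derivative drops out of the differential equation.\<close>
  have d: "poly (pderiv (C k)) 1 * (2 * lam + 1) = \<kappa> k * poly (C k) 1"
    using ode_at[of 1 k] by (simp add: algebra_simps)
  have K0: "\<kappa> k \<ge> 0" unfolding \<kappa>_def using assms(1) by simp
  have K: "\<kappa> k \<le> (2 * lam + 1) * (real m)\<^sup>2"
  proof -
    have "\<kappa> k \<le> real m * (real m + 2 * lam)" unfolding \<kappa>_def using assms by (intro mult_mono) auto
    also have "\<dots> \<le> real m * (real m + 2 * lam * real m)"
      using assms mult_left_mono[of 1 "real m" "2 * lam"] by (intro mult_left_mono) auto
    finally show ?thesis by (simp add: power2_eq_square algebra_simps)
  qed
  obtain z where z: "x < z" "z < 1" "poly (C k) 1 - poly (C k) x = (1 - x) * poly (pderiv (C k)) z"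
    using poly_MVT[OF x(2), of "C k"] by blast
  have "\<bar>poly (pderiv (C k)) z\<bar> \<le> \<bar>poly (pderiv (C k)) 1\<bar>" using z x assms(1) by (intro pderiv_C_le) auto
  also have "\<dots> = \<kappa> k * \<bar>poly (C k) 1\<bar> / (2 * lam + 1)"
  proof -
    have "\<bar>poly (pderiv (C k)) 1\<bar> * (2 * lam + 1) = \<kappa> k * \<bar>poly (C k) 1\<bar>"
      using arg_cong[OF d, of abs] K0 assms(1) by (simp add: abs_mult)
    then show ?thesis using assms(1) by (simp add: field_simps)
  qed
  also have "\<dots> \<le> (2 * lam + 1) * (real m)\<^sup>2 * \<bar>poly (C k) 1\<bar> / (2 * lam + 1)"
    using K assms(1) by (intro divide_right_mono mult_right_mono) auto
  also have "\<dots> = (real m)\<^sup>2 * \<bar>poly (C k) 1\<bar>" using assms(1) by (simp add: field_simps)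
  finally have "\<bar>poly (pderiv (C k)) z\<bar> \<le> (real m)\<^sup>2 * \<bar>poly (C k) 1\<bar>" .
  \<comment> \<open>Against a slope of at most m^2 |C k (1)| this cap width yields the factor
    1/2.\<close>
  moreover have "1 - x \<le> 1 / (2 * (real m)\<^sup>2)"
    unfolding x_def using one_minus_cos_le[of "1 / real m"] by (simp add: power_divide)
  ultimately have "(1 - x) * \<bar>poly (pderiv (C k)) z\<bar> \<le> 1 / (2 * (real m)\<^sup>2) * ((real m)\<^sup>2 * \<bar>poly (C k) 1\<bar>)"
    using x by (intro mult_mono) auto
  also have "\<dots> = \<bar>poly (C k) 1\<bar> / 2" using assms(2) by simp
  finally have "\<bar>poly (C k) 1 - poly (C k) x\<bar> \<le> \<bar>poly (C k) 1\<bar> / 2"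
    unfolding z(3) using x by (simp add: abs_mult)
  then show ?thesis unfolding x_def[symmetric] by linarith
qed

text \<open>For \<lambda> \<ge> 0, points with arccos x < 1/m are compared with cos(1/m):
  \<open>u m\<close> grows at most by the factor 4 = 2^2, while (1 - x^2) powr \<lambda> only
  decreases. For \<lambda> < 0 the factor (1 - x^2) powr \<lambda> is at least 1, and the extremal
  polynomial is tested directly against the arcsine law.\<close>

lemma u_bound_right:
  "\<exists>B\<ge>0. \<forall>m\<ge>1. \<forall>x\<in>{0..<1}. u m x * (1 - x\<^sup>2) powr (max lam 0) \<le> B * real m"
proof (cases "lam \<ge> 0")
  case True
  obtain B where B: "B \<ge> 0" "\<forall>m\<ge>1. \<forall>t\<in>{1 / real m..pi / 2}. u m (cos t) * (1 - (cos t)\<^sup>2) powr lam \<le> B * real m"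
    using interior_bound[OF True] by blast
  have "u m x * (1 - x\<^sup>2) powr lam \<le> 4 * B * real m" if m: "m \<ge> 1" and x: "x \<in> {0..<1}" for m x
  proof (cases "1 / real m \<le> arccos x")
    case True
    have "arccos x \<le> pi / 2" using x arccos_le_pi2 by auto
    then have "u m x * (1 - x\<^sup>2) powr lam \<le> B * real m" using B(2)[rule_format, of m "arccos x"] m x True by simp
    moreover have "0 \<le> B * real m" using B by simp
    ultimately show ?thesis by linarith
  next
    case False
    define x1 where "x1 = cos (1 / real m)"
    have m1: "1 / real m \<le> 1" using m by simp
    have x1: "0 \<le> x1" "x1 < 1"
      unfolding x1_def using cos_inverse_nat[OF m] by auto
    have le: "x1 \<le> x"
    proof -
      have "cos (1 / real m) \<le> cos (arccos x)" using False m1 pi_gt3 x by (intro cos_monotone_0_pi_le arccos_lbound) auto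
      then show ?thesis using x by (simp add: x1_def)
    qed
    have "u m x \<le> (\<Sum>k\<le>m. (2 * \<bar>poly (C k) x1\<bar>)\<^sup>2)"
      unfolding u_def
    proof (rule sum_mono)
      fix k assume "k \<in> {..m}"
      then have "\<bar>poly (C k) x\<bar> \<le> 2 * \<bar>poly (C k) x1\<bar>"
        using C_le_C_1[OF \<open>lam \<ge> 0\<close>, of x k] C_near_1[OF \<open>lam \<ge> 0\<close> m, of k] x unfolding x1_def by fastforce
      then have "\<bar>poly (C k) x\<bar>\<^sup>2 \<le> (2 * \<bar>poly (C k) x1\<bar>)\<^sup>2" by (intro power_mono) auto
      then show "(poly (C k) x)\<^sup>2 \<le> (2 * \<bar>poly (C k) x1\<bar>)\<^sup>2" by simp
    qed
    also have "\<dots> = 4 * u m x1" by (simp add: u_def sum_distrib_left power_mult_distrib)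
    finally have "u m x * (1 - x\<^sup>2) powr lam \<le> (4 * u m x1) * (1 - x1\<^sup>2) powr lam"
      using le x x1 \<open>lam \<ge> 0\<close> by (intro mult_mono powr_mono2) (auto simp: abs_square_le_1 intro!: power_mono)
    also have "\<dots> = 4 * (u m x1 * (1 - x1\<^sup>2) powr lam)" by simp
    also have "1 / real m \<le> pi / 2" using m1 pi_gt3 by linarith
    then have "4 * (u m x1 * (1 - x1\<^sup>2) powr lam) \<le> 4 * (B * real m)"
      unfolding x1_def using m by (intro mult_left_mono B(2)[rule_format]) auto
    finally show ?thesis by simp
  qed
  then show ?thesis using B(1) \<open>lam \<ge> 0\<close> by (intro exI[of _ "4 * B"]) (auto simp: max_def)
next
  case False
  have "u m x * (1 - x\<^sup>2) powr (max lam 0) \<le> 3 / (pi * c\<^sub>w) * real m" if m: "m \<ge> 1" and x: "x \<in> {0..<1}" for m x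
  proof -
    obtain q where q: "degree q \<le> m" "poly q x = u m x" "L (q * q) = u m x" using christoffel_extremal by blast
    have "(poly q x)\<^sup>2 \<le> (1 + 2 * real m) * (1 / (pi * c\<^sub>w)) * L (q * q)"
    proof (rule arcsine_comparison[OF q(1)])
      fix y :: real assume y: "y \<in> {-1<..<1}"
      have "1 - y\<^sup>2 > 0" "1 - y\<^sup>2 \<le> 1" using y by (simp_all add: abs_square_less_1 abs_less_iff)
      then have "1 \<le> (1 - y\<^sup>2) powr lam" using False powr_mono2'[of lam "1 - y\<^sup>2" 1] by simp
      then show "(poly q y)\<^sup>2 \<le> 1 * (1 - y\<^sup>2) powr lam * (poly q y)\<^sup>2"
        using mult_right_mono[of 1 "(1 - y\<^sup>2) powr lam" "(poly q y)\<^sup>2"] by simp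
    qed (use x in auto)
    then have "u m x * u m x \<le> (1 + 2 * real m) / (pi * c\<^sub>w) * u m x"
      unfolding q by (simp add: power2_eq_square)
    then have "u m x \<le> (1 + 2 * real m) / (pi * c\<^sub>w) \<or> u m x = 0"
      using u_nonneg[of m x] by (metis less_le mult_le_cancel_right_pos)
    then have "u m x \<le> (1 + 2 * real m) / (pi * c\<^sub>w)" using c_pos by auto
    also have "\<dots> \<le> (3 * real m) / (pi * c\<^sub>w)" using m c_pos by (intro divide_right_mono) auto
    finally have "u m x \<le> 3 / (pi * c\<^sub>w) * real m" by simp
    moreover have "(1 - x\<^sup>2) powr (max lam 0) = 1" using False x by (simp add: max_def abs_square_eq_1 power2_eq_1_iff)
    ultimately show ?thesis by simp
  qed
  then show ?thesis using c_pos by (intro exI[of _ "3 / (pi * c\<^sub>w)"]) auto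
qed

text \<open>The measure is symmetric, so reflection yields another orthonormal family for it, and
  the bounds proved on [0, 1) carry over to negative x.\<close>

lemma reflected: "gegenbauer lam (\<lambda>k. pcompose (C k) [:0, -1:])"
proof (unfold_locales, unfold normalized_gegenbauer_def, intro conjI allI)
  fix i j
  show "degree (pcompose (C i) [:0, -1:]) = i" by (simp add: degree_pcompose)
  have "(\<integral>x. poly (C i) (- x) * poly (C j) (- x) \<partial>\<mu>) = (\<integral>x. poly (C i) x * poly (C j) x \<partial>\<mu>)"
    by (rule integral_reflect) measurable
  then show "(\<integral>x. poly (pcompose (C i) [:0, -1:]) x * poly (pcompose (C j) [:0, -1:]) x \<partial>\<mu>) = (if i = j then 1 else 0)"
    using ortho[of i j] by (simp add: poly_pcompose L_def)
qed

lemma u_bound: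
  "\<exists>B\<ge>0. \<forall>m\<ge>1. \<forall>x\<in>{-1<..<1}. u m x * (1 - x\<^sup>2) powr (max lam 0) \<le> B * real m"
proof -
  interpret r: gegenbauer lam "\<lambda>k. pcompose (C k) [:0, -1:]" by (rule reflected)
  have ru: "r.u m x = u m (- x)" for m x by (simp add: r.u_def u_def poly_pcompose)
  obtain B where B: "B \<ge> 0" "\<forall>m\<ge>1. \<forall>x\<in>{0..<1}. u m x * (1 - x\<^sup>2) powr (max lam 0) \<le> B * real m"
    using u_bound_right by blast
  obtain B' where B': "B' \<ge> 0" "\<forall>m\<ge>1. \<forall>x\<in>{0..<1}. u m (- x) * (1 - x\<^sup>2) powr (max lam 0) \<le> B' * real m"
    using r.u_bound_right unfolding ru by blast
  have "u m x * (1 - x\<^sup>2) powr (max lam 0) \<le> (B + B') * real m" if m: "m \<ge> 1" and x: "x \<in> {-1<..<1}" for m x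
  proof (cases "x \<ge> 0")
    case True
    then have "u m x * (1 - x\<^sup>2) powr (max lam 0) \<le> B * real m" using B(2) m x by auto
    also have "\<dots> \<le> (B + B') * real m" using B'(1) by (intro mult_right_mono) auto
    finally show ?thesis .
  next
    case False
    then have "u m x * (1 - x\<^sup>2) powr (max lam 0) \<le> B' * real m" using B'(2)[rule_format, of m "- x"] m x by simp
    also have "\<dots> \<le> (B + B') * real m" using B(1) by (intro mult_right_mono) auto
    finally show ?thesis .
  qed
  then show ?thesis using B(1) B'(1) by (intro exI[of _ "B + B'"]) auto
qed

lemma ex_kernel_u_bound:
  "\<exists>A\<ge>0. \<forall>m\<ge>1. \<forall>y\<in>{-1..1::real}. (\<integral>\<^sup>+x. ennreal (\<Gamma> x y * u m x) \<partial>\<mu>) \<le> ennreal (A * real m)"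
proof -
  obtain B where B: "B \<ge> 0" "\<forall>m\<ge>1. \<forall>x\<in>{-1<..<1}. u m x * (1 - x\<^sup>2) powr (max lam 0) \<le> B * real m"
    using u_bound by blast
  obtain A where A: "A \<ge> 0" "\<forall>y\<in>{-1..1::real}. \<forall>B\<ge>0. \<forall>f\<in>borel_measurable borel.
      (\<forall>x\<in>{-1<..<1}. 0 \<le> f x \<and> f x * (1 - x\<^sup>2) powr (max lam 0) \<le> B) \<longrightarrow>
      (\<integral>\<^sup>+x. ennreal (\<Gamma> x y * f x) \<partial>\<mu>) \<le> ennreal (A * B)"
    using mu_kernel_bound by blast
  have "(\<integral>\<^sup>+x. ennreal (\<Gamma> x y * u m x) \<partial>\<mu>) \<le> ennreal (A * (B * real m))"
    if "m \<ge> 1" "y \<in> {-1..1}" for m and y :: real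
    using B that by (intro A(2)[rule_format]) auto
  then show ?thesis using A(1) B(1) by (intro exI[of _ "A * B"]) (auto simp: mult.assoc)
qed

text \<open>A constant depending only on the locale parameters; the tolerances chosen later are
  divided by it before m enters.\<close>

definition A\<^sub>u :: real where
  "A\<^sub>u = (SOME A. A \<ge> 0 \<and> (\<forall>m\<ge>1. \<forall>y\<in>{-1..1}.
     (\<integral>\<^sup>+x. ennreal (\<Gamma> x y * u m x) \<partial>\<mu>) \<le> ennreal (A * real m)))"

lemma kernel_u_bound:
  "A\<^sub>u \<ge> 0" "m \<ge> 1 \<Longrightarrow> y \<in> {-1..1} \<Longrightarrow> (\<integral>\<^sup>+x. ennreal (\<Gamma> x y * u m x) \<partial>\<mu>) \<le> ennreal (A\<^sub>u * real m)"
  using someI_ex[OF ex_kernel_u_bound, folded A\<^sub>u_def] by auto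

end

subsection \<open>Asymptotics of the logarithmic energy\<close>

lemma integrable_of_nn_integral_le:
  fixes f :: "'a \<Rightarrow> real"
  assumes "f \<in> borel_measurable M" "\<And>z. 0 \<le> f z" "c \<ge> 0"
    and le: "(\<integral>\<^sup>+z. ennreal (f z) \<partial>M) \<le> ennreal c"
  shows "integrable M f" "(\<integral>z. f z \<partial>M) \<le> c"
proof -
  show i: "integrable M f" using assms by (intro integrableI_nonneg) (auto intro: le_less_trans)
  have "ennreal (\<integral>z. f z \<partial>M) \<le> ennreal c"
    using le assms(2) by (subst nn_integral_eq_integral[symmetric, OF i]) auto
  then show "(\<integral>z. f z \<partial>M) \<le> c" using assms(3) by (simp add: ennreal_le_iff)
qed

lemma integral_abs_bound_AE:
  fixes f g :: "'a \<Rightarrow> real"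
  assumes "integrable M f" "integrable M g" "AE x in M. \<bar>f x\<bar> \<le> g x"
  shows "\<bar>\<integral>x. f x \<partial>M\<bar> \<le> (\<integral>x. g x \<partial>M)"
  using assms by (intro order_trans[OF integral_abs_bound] integral_mono_AE) auto

context gegenbauer
begin

abbreviation "K \<equiv> gegenbauer_kernel C"

text \<open>The logarithmic potential of \<open>u m\<close> d\<mu>, without the customary minus
  sign.\<close>

definition \<Phi> :: "nat \<Rightarrow> real \<Rightarrow> real" where
  "\<Phi> m y = (\<integral>x. ln \<bar>x - y\<bar> * u m x \<partial>\<mu>)"

lemma K_diag: "K m x x = u m x"
  by (simp add: gegenbauer_kernel_def u_def power2_eq_square)

lemma K_sym: "K m x y = K m y x"
  by (simp add: gegenbauer_kernel_def mult.commute)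

lemma K_Suc: "K (Suc m) x y = K m x y + poly (C (Suc m)) x * poly (C (Suc m)) y"
  by (simp add: gegenbauer_kernel_def)

lemma u_Suc: "u (Suc m) x = u m x + (poly (C (Suc m)) x)\<^sup>2"
  by (simp add: u_def)

lemma K_measurable [measurable]: "case_prod (K m) \<in> borel_measurable (borel \<Otimes>\<^sub>M borel)"
  unfolding gegenbauer_kernel_def by measurable

lemma K_measurable' [measurable]: "(\<lambda>z. K m (fst z) (snd z)) \<in> borel_measurable (borel \<Otimes>\<^sub>M borel)"
  using K_measurable[of m] by (simp add: case_prod_beta')

lemma K_square_le: "(K m x y)\<^sup>2 \<le> u m x * u m y"
  unfolding gegenbauer_kernel_def u_def by (rule Cauchy_Schwarz_ineq_sum)

lemma u_integrable [simp, intro]: "integrable \<mu> (u m)"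
proof -
  have "u m = poly (\<Sum>k\<le>m. C k * C k)"
    by (rule ext) (simp add: u_def poly_sum power2_eq_square)
  then show ?thesis by simp
qed

lemma u_integral: "(\<integral>x. poly q x * u m x \<partial>\<mu>) = (\<Sum>k\<le>m. L (q * (C k * C k)))"
proof -
  have "(\<integral>x. poly q x * u m x \<partial>\<mu>) = L (q * (\<Sum>k\<le>m. C k * C k))"
    unfolding L_def by (intro Bochner_Integration.integral_cong)
      (auto simp: u_def poly_sum power2_eq_square)
  then show ?thesis by (simp add: sum_distrib_left L_sum)
qed

lemma u_integral_1: "(\<integral>x. u m x \<partial>\<mu>) = real m + 1"
  using u_integral[of 1 m] by (simp add: ortho)

lemma AE_pair: "AE z in \<nu>. fst z \<in> {-1..1} \<and> snd z \<in> {-1..1} \<and> fst z \<noteq> snd z"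
proof (rule mu2.AE_pair_measure)
  show "{z \<in> space \<nu>. fst z \<in> {-1..1} \<and> snd z \<in> {-1..1} \<and> fst z \<noteq> snd z} \<in> sets \<nu>"
    by measurable
  show "AE x in \<mu>. AE y in \<mu>. fst (x, y) \<in> {-1..1} \<and> snd (x, y) \<in> {-1..1} \<and> fst (x, y) \<noteq> snd (x, y)"
    using AE_Icc
  proof eventually_elim
    case (elim x)
    from AE_Icc AE_neq[of x] show ?case by eventually_elim (use elim in auto)
  qed
qed

lemma abs_ln_le:
  assumes "x \<in> {-1..1}" "y \<in> {-1..1}" "x \<noteq> y"
  shows "\<bar>ln \<bar>x - y\<bar>\<bar> \<le> 2 / e\<^sub>w * \<Gamma> x y"
  using assms b_e by (intro ln_abs_le_powr) auto

lemma kernel_u_integral: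
  assumes "m \<ge> 1" "y \<in> {-1..1}"
  shows "integrable \<mu> (\<lambda>x. \<Gamma> x y * u m x)" "(\<integral>x. \<Gamma> x y * u m x \<partial>\<mu>) \<le> A\<^sub>u * real m"
  by (rule integrable_of_nn_integral_le[OF _ _ _ kernel_u_bound(2)[OF assms]]; use kernel_u_bound(1) in simp)+

lemma log_integrable:
  assumes m: "m \<ge> 1" and y: "y \<in> {-1..1}" and [measurable]: "f \<in> borel_measurable borel"
    and le: "\<And>x. x \<in> {-1..1} \<Longrightarrow> \<bar>f x\<bar> \<le> B * u m x"
  shows "integrable \<mu> (\<lambda>x. ln \<bar>x - y\<bar> * f x)"
proof (rule Bochner_Integration.integrable_bound)
  show "integrable \<mu> (\<lambda>x. 2 / e\<^sub>w * B * (\<Gamma> x y * u m x))"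
    by (intro integrable_mult_right kernel_u_integral[OF m y])
  show "AE x in \<mu>. norm (ln \<bar>x - y\<bar> * f x) \<le> norm (2 / e\<^sub>w * B * (\<Gamma> x y * u m x))"
    using AE_Icc AE_neq[of y]
  proof eventually_elim
    case (elim x)
    have "\<bar>ln \<bar>x - y\<bar>\<bar> * \<bar>f x\<bar> \<le> (2 / e\<^sub>w * \<Gamma> x y) * (B * u m x)"
      using abs_ln_le[of x y] le[of x] elim y b_e by (intro mult_mono) auto
    then have "norm (ln \<bar>x - y\<bar> * f x) \<le> 2 / e\<^sub>w * B * (\<Gamma> x y * u m x)"
      by (simp add: abs_mult mult_ac)
    then show ?case using abs_ge_self order_trans unfolding real_norm_def by blast
  qed
qed measurable

text \<open>By Tonelli the integral over the variable of \<open>u m\<close> is at most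
  \<open>A\<^sub>u * real m\<close> uniformly in the other one, leaving the mass of g. Both
  placements of \<open>u m\<close> occur in the symmetric bound for \<open>J2\<close>.\<close>

lemma kernel_pair_integral:
  assumes m: "m \<ge> 1" and gi: "integrable \<mu> g" and g0: "\<And>x. 0 \<le> g x"
  shows "integrable \<nu> (\<lambda>z. \<Gamma> (fst z) (snd z) * (u m (fst z) * g (snd z)))"
    "(\<integral>z. \<Gamma> (fst z) (snd z) * (u m (fst z) * g (snd z)) \<partial>\<nu>) \<le> A\<^sub>u * real m * (\<integral>x. g x \<partial>\<mu>)"
    "integrable \<nu> (\<lambda>z. \<Gamma> (fst z) (snd z) * (g (fst z) * u m (snd z)))"
    "(\<integral>z. \<Gamma> (fst z) (snd z) * (g (fst z) * u m (snd z)) \<partial>\<nu>) \<le> A\<^sub>u * real m * (\<integral>x. g x \<partial>\<mu>)"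
proof -
  have [measurable]: "g \<in> borel_measurable borel" using gi borel_measurable_integrable by fastforce
  have c0: "0 \<le> A\<^sub>u * real m * (\<integral>x. g x \<partial>\<mu>)"
    using g0 kernel_u_bound(1) by (intro mult_nonneg_nonneg integral_nonneg_AE) auto
  have inner: "(\<integral>\<^sup>+x. ennreal (\<Gamma> x y * (u m x * g y)) \<partial>\<mu>) \<le> ennreal (A\<^sub>u * real m) * ennreal (g y)"
    if y: "y \<in> {-1..1}" for y
  proof -
    have "(\<integral>\<^sup>+x. ennreal (\<Gamma> x y * (u m x * g y)) \<partial>\<mu>)
        = (\<integral>\<^sup>+x. ennreal (\<Gamma> x y * u m x) * ennreal (g y) \<partial>\<mu>)"
      using g0 by (intro nn_integral_cong) (simp add: ennreal_mult'[symmetric] mult.assoc)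
    also have "\<dots> = (\<integral>\<^sup>+x. ennreal (\<Gamma> x y * u m x) \<partial>\<mu>) * ennreal (g y)"
      by (rule nn_integral_multc) measurable
    also have "\<dots> \<le> ennreal (A\<^sub>u * real m) * ennreal (g y)"
      using kernel_u_bound(2)[OF m y] by (rule mult_right_mono) simp
    finally show ?thesis .
  qed
  have outer: "(\<integral>\<^sup>+y. (\<integral>\<^sup>+x. ennreal (\<Gamma> x y * (u m x * g y)) \<partial>\<mu>) \<partial>\<mu>) \<le> ennreal (A\<^sub>u * real m * (\<integral>x. g x \<partial>\<mu>))"
  proof -
    have "(\<integral>\<^sup>+y. (\<integral>\<^sup>+x. ennreal (\<Gamma> x y * (u m x * g y)) \<partial>\<mu>) \<partial>\<mu>) \<le> (\<integral>\<^sup>+y. ennreal (A\<^sub>u * real m) * ennreal (g y) \<partial>\<mu>)"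
    proof (rule nn_integral_mono_AE)
      show "AE y in \<mu>. (\<integral>\<^sup>+x. ennreal (\<Gamma> x y * (u m x * g y)) \<partial>\<mu>) \<le> ennreal (A\<^sub>u * real m) * ennreal (g y)"
        using AE_Icc by eventually_elim (rule inner)
    qed
    also have "\<dots> = ennreal (A\<^sub>u * real m) * (\<integral>\<^sup>+y. ennreal (g y) \<partial>\<mu>)"
      by (rule nn_integral_cmult) measurable
    also have "(\<integral>\<^sup>+y. ennreal (g y) \<partial>\<mu>) = ennreal (\<integral>x. g x \<partial>\<mu>)"
      using gi g0 by (intro nn_integral_eq_integral) auto
    finally show ?thesis using kernel_u_bound(1) by (simp add: ennreal_mult'[symmetric])
  qed
  have n1: "(\<integral>\<^sup>+z. ennreal (\<Gamma> (fst z) (snd z) * (u m (fst z) * g (snd z))) \<partial>\<nu>) \<le> ennreal (A\<^sub>u * real m * (\<integral>x. g x \<partial>\<mu>))"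
    using outer by (subst mu2.nn_integral_snd[symmetric]) auto
  have n2: "(\<integral>\<^sup>+z. ennreal (\<Gamma> (fst z) (snd z) * (g (fst z) * u m (snd z))) \<partial>\<nu>) \<le> ennreal (A\<^sub>u * real m * (\<integral>x. g x \<partial>\<mu>))"
    using outer by (subst nn_integral_fst[symmetric]) (auto simp: abs_minus_commute mult.commute)
  show "integrable \<nu> (\<lambda>z. \<Gamma> (fst z) (snd z) * (u m (fst z) * g (snd z)))"
    "(\<integral>z. \<Gamma> (fst z) (snd z) * (u m (fst z) * g (snd z)) \<partial>\<nu>) \<le> A\<^sub>u * real m * (\<integral>x. g x \<partial>\<mu>)"
    by (rule integrable_of_nn_integral_le[OF _ _ c0 n1]; use g0 in simp)+
  show "integrable \<nu> (\<lambda>z. \<Gamma> (fst z) (snd z) * (g (fst z) * u m (snd z)))"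
    "(\<integral>z. \<Gamma> (fst z) (snd z) * (g (fst z) * u m (snd z)) \<partial>\<nu>) \<le> A\<^sub>u * real m * (\<integral>x. g x \<partial>\<mu>)"
    by (rule integrable_of_nn_integral_le[OF _ _ c0 n2]; use g0 in simp)+
qed

lemma log_pair_integrable:
  assumes m: "m \<ge> 1" and [measurable]: "f \<in> borel_measurable (borel \<Otimes>\<^sub>M borel)"
    and gi: "integrable \<mu> g" and g0: "\<And>x. 0 \<le> g x"
    and le: "\<And>x y. \<bar>f (x, y)\<bar> \<le> u m x * g y"
  shows "integrable \<nu> (\<lambda>z. \<Lambda> z * f z)"
proof (rule Bochner_Integration.integrable_bound)
  show "integrable \<nu> (\<lambda>z. 2 / e\<^sub>w * (\<Gamma> (fst z) (snd z) * (u m (fst z) * g (snd z))))"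
    by (intro integrable_mult_right kernel_pair_integral(1)[OF m gi g0])
  show "AE z in \<nu>. norm (\<Lambda> z * f z) \<le> norm (2 / e\<^sub>w * (\<Gamma> (fst z) (snd z) * (u m (fst z) * g (snd z))))"
    using AE_pair
  proof eventually_elim
    case (elim z)
    have "\<bar>ln \<bar>fst z - snd z\<bar>\<bar> * \<bar>f z\<bar> \<le> (2 / e\<^sub>w * \<Gamma> (fst z) (snd z)) * (u m (fst z) * g (snd z))"
      using abs_ln_le[of "fst z" "snd z"] le[of "fst z" "snd z"] elim b_e by (intro mult_mono) auto
    then show ?case using g0 b_e by (simp add: abs_mult mult_ac)
  qed
qed measurable

text \<open>With r and J fixed by the tolerance, the Chebyshev part is a combination of finitely
  many moments bounded in m, which gives D; the remainder is integrated against
  \<open>kernel_u_bound\<close>.\<close>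

lemma potential_asymptotics:
  assumes eps: "\<epsilon> > 0"
  shows "\<exists>D\<ge>0. \<forall>m\<ge>1. \<forall>y\<in>{-1..1}. \<bar>\<Phi> m y + (real m + 1) * ln 2\<bar> \<le> D + \<epsilon> * real m"
proof -
  \<comment> \<open>The +1 keeps the quotient meaningful if \<open>A\<^sub>u\<close> is
    zero.\<close>
  define \<epsilon>' where "\<epsilon>' = \<epsilon> / (A\<^sub>u + 1)"
  have e': "\<epsilon>' > 0" "\<epsilon>' * A\<^sub>u \<le> \<epsilon>" using eps kernel_u_bound(1) by (auto simp: \<epsilon>'_def field_simps)
  obtain r J where r: "0 < r" "r < 1" and approx: "\<forall>x\<in>{-1..1}. \<forall>y\<in>{-1..1}. x \<noteq> y \<longrightarrow>
    \<bar>ln \<bar>x - y\<bar> + ln 2 + abel r J x y\<bar> \<le> \<epsilon>' * \<Gamma> x y"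
    using log_kernel_approx[OF b_e(2,4) e'(1), of 0] by blast
  have "\<forall>j. \<exists>B. j \<ge> 1 \<longrightarrow> B \<ge> 0 \<and> (\<forall>m. \<bar>\<Sum>k\<le>m. L (cheb_T j * (C k * C k))\<bar> \<le> B)"
    using cheb_moment_sum_bounded by blast
  then obtain B where B: "\<And>j. j \<ge> 1 \<Longrightarrow> B j \<ge> 0" "\<And>j m. j \<ge> 1 \<Longrightarrow> \<bar>\<Sum>k\<le>m. L (cheb_T j * (C k * C k))\<bar> \<le> B j"
    by metis
  define D where "D = (\<Sum>j=1..J. 2 / real j * B j)"
  have D0: "D \<ge> 0" unfolding D_def using B(1) by (intro sum_nonneg) auto
  have "\<bar>\<Phi> m y + (real m + 1) * ln 2\<bar> \<le> D + \<epsilon> * real m" if m: "m \<ge> 1" and y: "y \<in> {-1..1}" for m y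
  proof -
    define S where "S = (\<Sum>j=1..J. smult (2 / real j * r ^ j * T j y) (cheb_T j))"
    have Sx: "poly S x = abel r J x y" for x
      by (simp add: S_def poly_sum mult_ac)
    have i1: "integrable \<mu> (\<lambda>x. ln \<bar>x - y\<bar> * u m x)"
      using log_integrable[OF m y, of "u m" 1] by simp
    have i2: "integrable \<mu> (\<lambda>x. poly S x * u m x)"
    proof -
      have "(\<lambda>x. poly S x * u m x) = poly (S * (\<Sum>k\<le>m. C k * C k))"
        by (rule ext) (simp add: u_def poly_sum power2_eq_square)
      then show ?thesis by simp
    qed
    have "\<Phi> m y + (real m + 1) * ln 2 + (\<integral>x. poly S x * u m x \<partial>\<mu>)
        = (\<integral>x. (ln \<bar>x - y\<bar> + ln 2 + poly S x) * u m x \<partial>\<mu>)"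
      unfolding \<Phi>_def distrib_right using i1 i2 by (simp add: u_integral_1 algebra_simps)
    also have "\<bar>\<dots>\<bar> \<le> (\<integral>x. \<epsilon>' * (\<Gamma> x y * u m x) \<partial>\<mu>)"
    proof (rule integral_abs_bound_AE)
      show "integrable \<mu> (\<lambda>x. (ln \<bar>x - y\<bar> + ln 2 + poly S x) * u m x)"
        unfolding distrib_right using i1 i2 by simp
    next
      show "integrable \<mu> (\<lambda>x. \<epsilon>' * (\<Gamma> x y * u m x))" by (intro integrable_mult_right kernel_u_integral[OF m y])
    next
      show "AE x in \<mu>. \<bar>(ln \<bar>x - y\<bar> + ln 2 + poly S x) * u m x\<bar> \<le> \<epsilon>' * (\<Gamma> x y * u m x)"
        using AE_Icc AE_neq[of y]
      proof eventually_elim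
        case (elim x)
        then have "\<bar>ln \<bar>x - y\<bar> + ln 2 + poly S x\<bar> \<le> \<epsilon>' * \<Gamma> x y" unfolding Sx using approx y by blast
        then have "\<bar>ln \<bar>x - y\<bar> + ln 2 + poly S x\<bar> * u m x \<le> \<epsilon>' * \<Gamma> x y * u m x" by (rule mult_right_mono) simp
        then show ?case by (simp add: abs_mult mult.assoc)
      qed
    qed
    also have "\<dots> = \<epsilon>' * (\<integral>x. \<Gamma> x y * u m x \<partial>\<mu>)" by (rule integral_mult_right_zero)
    also have "\<dots> \<le> \<epsilon>' * (A\<^sub>u * real m)" using kernel_u_integral(2)[OF m y] e'(1) by (intro mult_left_mono) auto
    also have "\<dots> \<le> \<epsilon> * real m" using mult_right_mono[OF e'(2), of "real m"] by (simp add: mult.assoc)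
    finally have 1: "\<bar>\<Phi> m y + (real m + 1) * ln 2 + (\<integral>x. poly S x * u m x \<partial>\<mu>)\<bar> \<le> \<epsilon> * real m" .
    have "(\<integral>x. poly S x * u m x \<partial>\<mu>) = (\<Sum>k\<le>m. \<Sum>j=1..J. 2 / real j * r ^ j * T j y * L (cheb_T j * (C k * C k)))"
      unfolding u_integral by (intro sum.cong refl) (simp add: S_def sum_distrib_right L_sum L_smult)
    also have "\<dots> = (\<Sum>j=1..J. 2 / real j * r ^ j * T j y * (\<Sum>k\<le>m. L (cheb_T j * (C k * C k))))"
      by (subst sum.swap) (simp add: sum_distrib_left)
    also have "\<bar>\<dots>\<bar> \<le> (\<Sum>j=1..J. \<bar>2 / real j * r ^ j * T j y * (\<Sum>k\<le>m. L (cheb_T j * (C k * C k)))\<bar>)"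
      by (rule sum_abs)
    also have "\<dots> \<le> D" unfolding D_def
    proof (rule sum_mono)
      fix j assume "j \<in> {1..J}"
      then have j: "j \<ge> 1" by simp
      have "\<bar>2 / real j * r ^ j * T j y * (\<Sum>k\<le>m. L (cheb_T j * (C k * C k)))\<bar>
        = 2 / real j * r ^ j * \<bar>T j y\<bar> * \<bar>\<Sum>k\<le>m. L (cheb_T j * (C k * C k))\<bar>"
        using r by (simp add: abs_mult)
      also have "\<dots> \<le> 2 / real j * 1 * 1 * B j"
        using r abs_cheb_T_le[OF y, of j] B(2)[OF j, of m] by (intro mult_mono power_le_one) auto
      finally show "\<bar>2 / real j * r ^ j * T j y * (\<Sum>k\<le>m. L (cheb_T j * (C k * C k)))\<bar> \<le> 2 / real j * B j" by simp
    qed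
    finally have "\<bar>\<integral>x. poly S x * u m x \<partial>\<mu>\<bar> \<le> D" .
    with 1 show ?thesis by linarith
  qed
  then show ?thesis using D0 by blast
qed

section \<open>Energy increments when one polynomial is added to the kernel\<close>

definition J1 :: "nat \<Rightarrow> real" where
  "J1 m = (\<integral>z. \<Lambda> z * (u m (fst z) * (poly (C (Suc m)) (snd z))\<^sup>2) \<partial>\<nu>)"

definition J2 :: "nat \<Rightarrow> real" where
  "J2 m = (\<integral>z. \<Lambda> z * (K m (fst z) (snd z) * (poly (C (Suc m)) (fst z) * poly (C (Suc m)) (snd z))) \<partial>\<nu>)"

text \<open>Minus the expected logarithmic energy of the process with m + 1 points.\<close>

definition I2 :: "nat \<Rightarrow> real" where
  "I2 m = (\<integral>z. \<Lambda> z * (u m (fst z) * u m (snd z) - (K m (fst z) (snd z))\<^sup>2) \<partial>\<nu>)"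

lemma square_integrable [simp, intro]: "integrable \<mu> (\<lambda>x. (poly p x)\<^sup>2)"
proof -
  have "(\<lambda>x. (poly p x)\<^sup>2) = poly (p * p)" by (rule ext) (simp add: power2_eq_square)
  then show ?thesis by simp
qed

lemma square_integral: "(\<integral>x. (poly (C k) x)\<^sup>2 \<partial>\<mu>) = 1"
proof -
  have "(\<lambda>x. (poly (C k) x)\<^sup>2) = poly (C k * C k)" by (rule ext) (simp add: power2_eq_square)
  then show ?thesis using ortho[of k k] unfolding L_def by (simp only:) simp
qed

lemma rho_bounds:
  "0 \<le> u m x * u m y - (K m x y)\<^sup>2" "\<bar>u m x * u m y - (K m x y)\<^sup>2\<bar> \<le> u m x * u m y"
  using K_square_le[of m x y] by (auto simp: abs_le_iff)

text \<open>Cauchy-Schwarz for K, then the inequality of the means with the factors paired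
  crosswise, so that each term is \<open>u m\<close> in one variable times a probability density in
  the other. Its kernel integral is linear in m; the cruder \<open>KCC_bound'\<close> would give m^2
  and serves integrability only.\<close>

lemma KCC_bound:
  "\<bar>K m x y * (poly (C (Suc m)) x * poly (C (Suc m)) y)\<bar>
    \<le> (u m x * (poly (C (Suc m)) y)\<^sup>2 + (poly (C (Suc m)) x)\<^sup>2 * u m y) / 2"
proof -
  let ?a = "poly (C (Suc m)) x" and ?b = "poly (C (Suc m)) y"
  have "\<bar>K m x y\<bar> \<le> sqrt (u m x) * sqrt (u m y)"
    using real_sqrt_le_mono[OF K_square_le[of m x y]] by (simp add: real_sqrt_mult)
  then have "\<bar>K m x y * (?a * ?b)\<bar> \<le> (sqrt (u m x) * sqrt (u m y)) * (\<bar>?a\<bar> * \<bar>?b\<bar>)"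
    unfolding abs_mult by (intro mult_right_mono) auto
  also have "\<dots> = (sqrt (u m x) * \<bar>?b\<bar>) * (\<bar>?a\<bar> * sqrt (u m y))" by simp
  also have "\<dots> \<le> ((sqrt (u m x) * \<bar>?b\<bar>)\<^sup>2 + (\<bar>?a\<bar> * sqrt (u m y))\<^sup>2) / 2"
    using sum_squares_bound[of "sqrt (u m x) * \<bar>?b\<bar>" "\<bar>?a\<bar> * sqrt (u m y)"] by simp
  also have "\<dots> = (u m x * ?b\<^sup>2 + ?a\<^sup>2 * u m y) / 2"
    by (simp add: power_mult_distrib)
  finally show ?thesis .
qed

lemma KCC_bound':
  "\<bar>K m x y * (poly (C (Suc m)) x * poly (C (Suc m)) y)\<bar> \<le> u (Suc m) x * u (Suc m) y"
proof -
  have "u m x * (poly (C (Suc m)) y)\<^sup>2 \<le> u (Suc m) x * u (Suc m) y"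
    "(poly (C (Suc m)) x)\<^sup>2 * u m y \<le> u (Suc m) x * u (Suc m) y"
    by (intro mult_mono; simp add: u_Suc)+
  then show ?thesis by (intro order_trans[OF KCC_bound]) simp
qed

lemma pair_integrals:
  assumes m: "m \<ge> 1"
  shows "integrable \<nu> (\<lambda>z. \<Lambda> z * (u m (fst z) * (poly (C (Suc m)) (snd z))\<^sup>2))"
    "integrable \<nu> (\<lambda>z. \<Lambda> z * ((poly (C (Suc m)) (fst z))\<^sup>2 * u m (snd z)))"
    "integrable \<nu> (\<lambda>z. \<Lambda> z * (K m (fst z) (snd z) * (poly (C (Suc m)) (fst z) * poly (C (Suc m)) (snd z))))"
    "integrable \<nu> (\<lambda>z. \<Lambda> z * (u m (fst z) * u m (snd z) - (K m (fst z) (snd z))\<^sup>2))"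
proof -
  show "integrable \<nu> (\<lambda>z. \<Lambda> z * (u m (fst z) * (poly (C (Suc m)) (snd z))\<^sup>2))"
    by (rule log_pair_integrable[OF m, where g = "\<lambda>y. (poly (C (Suc m)) y)\<^sup>2"]) (auto simp: abs_mult)
  show "integrable \<nu> (\<lambda>z. \<Lambda> z * ((poly (C (Suc m)) (fst z))\<^sup>2 * u m (snd z)))"
    by (rule log_pair_integrable[of "Suc m", where g = "u m"]) (auto simp: abs_mult u_Suc intro!: mult_right_mono)
  show "integrable \<nu> (\<lambda>z. \<Lambda> z * (K m (fst z) (snd z) * (poly (C (Suc m)) (fst z) * poly (C (Suc m)) (snd z))))"
    by (rule log_pair_integrable[of "Suc m", where g = "u (Suc m)"]) (auto simp: KCC_bound')
  show "integrable \<nu> (\<lambda>z. \<Lambda> z * (u m (fst z) * u m (snd z) - (K m (fst z) (snd z))\<^sup>2))"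
    by (rule log_pair_integrable[OF m, where g = "u m"]) (auto simp: rho_bounds)
qed

lemma J1_eq:
  assumes m: "m \<ge> 1"
  shows "J1 m = (\<integral>y. \<Phi> m y * (poly (C (Suc m)) y)\<^sup>2 \<partial>\<mu>)"
    "integrable \<mu> (\<lambda>y. \<Phi> m y * (poly (C (Suc m)) y)\<^sup>2)"
    "(\<integral>z. \<Lambda> z * ((poly (C (Suc m)) (fst z))\<^sup>2 * u m (snd z)) \<partial>\<nu>) = J1 m"
proof -
  have in1: "(\<integral>x. ln \<bar>x - y\<bar> * (u m x * (poly (C (Suc m)) y)\<^sup>2) \<partial>\<mu>) = \<Phi> m y * (poly (C (Suc m)) y)\<^sup>2" for y
    unfolding \<Phi>_def by (simp add: mult.assoc[symmetric])
  have in2: "(\<integral>y. ln \<bar>x - y\<bar> * ((poly (C (Suc m)) x)\<^sup>2 * u m y) \<partial>\<mu>) = \<Phi> m x * (poly (C (Suc m)) x)\<^sup>2" for x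
  proof -
    have "(\<integral>y. ln \<bar>x - y\<bar> * ((poly (C (Suc m)) x)\<^sup>2 * u m y) \<partial>\<mu>) = (\<integral>y. ln \<bar>y - x\<bar> * u m y * (poly (C (Suc m)) x)\<^sup>2 \<partial>\<mu>)"
      by (intro Bochner_Integration.integral_cong) (auto simp: abs_minus_commute mult_ac)
    then show ?thesis unfolding \<Phi>_def by simp
  qed
  let ?f = "\<lambda>x y. ln \<bar>x - y\<bar> * (u m x * (poly (C (Suc m)) y)\<^sup>2)"
  have i1: "integrable \<nu> (case_prod ?f)"
    using pair_integrals(1)[OF m] by (simp add: case_prod_beta')
  show 1: "J1 m = (\<integral>y. \<Phi> m y * (poly (C (Suc m)) y)\<^sup>2 \<partial>\<mu>)"
    using mu2.integral_snd[OF i1] unfolding in1 J1_def by (simp add: case_prod_beta')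
  show "integrable \<mu> (\<lambda>y. \<Phi> m y * (poly (C (Suc m)) y)\<^sup>2)"
    using mu2.integrable_snd[OF i1] unfolding in1 by simp
  let ?g = "\<lambda>x y. ln \<bar>x - y\<bar> * ((poly (C (Suc m)) x)\<^sup>2 * u m y)"
  have i2: "integrable \<nu> (case_prod ?g)"
    using pair_integrals(2)[OF m] by (simp add: case_prod_beta')
  show "(\<integral>z. \<Lambda> z * ((poly (C (Suc m)) (fst z))\<^sup>2 * u m (snd z)) \<partial>\<nu>) = J1 m"
    using mu2.integral_fst[OF i2] unfolding in2 1 by (simp add: case_prod_beta')
qed

lemma I2_Suc:
  assumes m: "m \<ge> 1"
  shows "I2 (Suc m) = I2 m + 2 * J1 m - 2 * J2 m"
proof -
  let ?p = "poly (C (Suc m))"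
  have eq: "u (Suc m) x * u (Suc m) y - (K (Suc m) x y)\<^sup>2
    = (u m x * u m y - (K m x y)\<^sup>2) + u m x * (?p y)\<^sup>2 + (?p x)\<^sup>2 * u m y - 2 * (K m x y * (?p x * ?p y))" for x y
    by (simp add: u_Suc K_Suc power2_eq_square algebra_simps)
  have "I2 (Suc m) = (\<integral>z. \<Lambda> z * (u m (fst z) * u m (snd z) - (K m (fst z) (snd z))\<^sup>2)
     + \<Lambda> z * (u m (fst z) * (?p (snd z))\<^sup>2)
     + \<Lambda> z * ((?p (fst z))\<^sup>2 * u m (snd z))
     - 2 * (\<Lambda> z * (K m (fst z) (snd z) * (?p (fst z) * ?p (snd z)))) \<partial>\<nu>)"
    unfolding I2_def eq by (intro Bochner_Integration.integral_cong refl) (simp add: algebra_simps)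
  also have "\<dots> = I2 m + J1 m + J1 m - 2 * J2 m"
    using pair_integrals[OF m] J1_eq(3)[OF m] by (simp add: I2_def J1_def J2_def)
  finally show ?thesis by simp
qed

text \<open>\<open>J1 m\<close> averages \<open>\<Phi> m\<close> against the probability density of
  the next polynomial squared, so the uniform estimate for the potential passes through
  unchanged.\<close>

lemma J1_asymptotics:
  assumes eps: "\<epsilon> > 0"
  shows "\<exists>D\<ge>0. \<forall>m\<ge>1. \<bar>J1 m + (real m + 1) * ln 2\<bar> \<le> D + \<epsilon> * real m"
proof -
  obtain D where D: "D \<ge> 0" "\<forall>m\<ge>1. \<forall>y\<in>{-1..1}. \<bar>\<Phi> m y + (real m + 1) * ln 2\<bar> \<le> D + \<epsilon> * real m"
    using potential_asymptotics[OF eps] by blast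
  have "\<bar>J1 m + (real m + 1) * ln 2\<bar> \<le> D + \<epsilon> * real m" if m: "m \<ge> 1" for m
  proof -
    let ?q = "\<lambda>y. (poly (C (Suc m)) y)\<^sup>2"
    have "J1 m + (real m + 1) * ln 2 = (\<integral>y. (\<Phi> m y + (real m + 1) * ln 2) * ?q y \<partial>\<mu>)"
      unfolding distrib_right using J1_eq(1,2)[OF m] by (simp add: square_integral)
    also have "\<bar>\<dots>\<bar> \<le> (\<integral>y. (D + \<epsilon> * real m) * ?q y \<partial>\<mu>)"
    proof (rule integral_abs_bound_AE)
      show "integrable \<mu> (\<lambda>y. (\<Phi> m y + (real m + 1) * ln 2) * ?q y)"
        unfolding distrib_right using J1_eq(2)[OF m] by simp
      show "integrable \<mu> (\<lambda>y. (D + \<epsilon> * real m) * ?q y)" by simp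
      show "AE y in \<mu>. \<bar>(\<Phi> m y + (real m + 1) * ln 2) * ?q y\<bar> \<le> (D + \<epsilon> * real m) * ?q y"
        using AE_Icc
      proof eventually_elim
        case (elim y)
        then have "\<bar>\<Phi> m y + (real m + 1) * ln 2\<bar> * ?q y \<le> (D + \<epsilon> * real m) * ?q y"
          using D(2) m by (intro mult_right_mono) auto
        then show ?case by (simp add: abs_mult)
      qed
    qed
    also have "\<dots> = D + \<epsilon> * real m" by (simp add: square_integral)
    finally show ?thesis .
  qed
  then show ?thesis using D(1) by blast
qed

lemma integral_pair_product:
  assumes f: "integrable \<mu> f" and g: "integrable \<mu> g"
  shows "integrable \<nu> (\<lambda>z. f (fst z) * g (snd z) :: real)"
    "(\<integral>z. f (fst z) * g (snd z) \<partial>\<nu>) = (\<integral>x. f x \<partial>\<mu>) * (\<integral>x. g x \<partial>\<mu>)"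
proof -
  have [measurable]: "f \<in> borel_measurable borel" "g \<in> borel_measurable borel"
    using f g borel_measurable_integrable by fastforce+
  have "integrable \<nu> (\<lambda>(x, y). f x * g y)"
  proof (rule mu2.Fubini_integrable)
    show "integrable \<mu> (\<lambda>x. \<integral>y. norm ((\<lambda>(x, y). f x * g y) (x, y)) \<partial>\<mu>)"
      using f by (simp add: abs_mult)
    show "AE x in \<mu>. integrable \<mu> (\<lambda>y. (\<lambda>(x, y). f x * g y) (x, y))" using g by simp
  qed measurable
  then show i: "integrable \<nu> (\<lambda>z. f (fst z) * g (snd z))" by (simp add: case_prod_beta')
  show "(\<integral>z. f (fst z) * g (snd z) \<partial>\<nu>) = (\<integral>x. f x \<partial>\<mu>) * (\<integral>x. g x \<partial>\<mu>)"
    using mu2.integral_fst'[OF i] by simp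
qed

text \<open>The integrand is a sum of products f(x) f(y), so the double integral is a sum of
  squares. It is used with q = 1, where orthogonality gives 0, and with q = T_j, where it is a
  Bessel sum.\<close>

lemma poly_K_integral:
  "integrable \<nu> (\<lambda>z. poly q (fst z) * poly q (snd z) * (K m (fst z) (snd z) * (poly (C k) (fst z) * poly (C k) (snd z))))"
  "(\<integral>z. poly q (fst z) * poly q (snd z) * (K m (fst z) (snd z) * (poly (C k) (fst z) * poly (C k) (snd z))) \<partial>\<nu>)
     = (\<Sum>i\<le>m. (L (q * C k * C i))\<^sup>2)"
proof -
  have e: "poly q x * poly q y * (K m x y * (poly (C k) x * poly (C k) y))
     = (\<Sum>i\<le>m. poly (q * C k * C i) x * poly (q * C k * C i) y)" for x y
    unfolding gegenbauer_kernel_def sum_distrib_left sum_distrib_right by (intro sum.cong) (auto simp: mult_ac)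
  show "integrable \<nu> (\<lambda>z. poly q (fst z) * poly q (snd z) * (K m (fst z) (snd z) * (poly (C k) (fst z) * poly (C k) (snd z))))"
    unfolding e by (intro Bochner_Integration.integrable_sum integral_pair_product(1) integrable_poly)
  have "(\<integral>z. (\<Sum>i\<le>m. poly (q * C k * C i) (fst z) * poly (q * C k * C i) (snd z)) \<partial>\<nu>)
      = (\<Sum>i\<le>m. (\<integral>z. poly (q * C k * C i) (fst z) * poly (q * C k * C i) (snd z) \<partial>\<nu>))"
    by (intro Bochner_Integration.integral_sum integral_pair_product(1) integrable_poly)
  also have "\<dots> = (\<Sum>i\<le>m. L (q * C k * C i) * L (q * C k * C i))"
    unfolding L_def by (intro sum.cong refl integral_pair_product(2) integrable_poly)
  finally show "(\<integral>z. poly q (fst z) * poly q (snd z) * (K m (fst z) (snd z) * (poly (C k) (fst z) * poly (C k) (snd z))) \<partial>\<nu>)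
     = (\<Sum>i\<le>m. (L (q * C k * C i))\<^sup>2)"
    unfolding e by (simp add: power2_eq_square)
qed

lemma J2_asymptotics:
  assumes eps: "\<epsilon> > 0"
  shows "\<exists>D\<ge>0. \<forall>m\<ge>1. \<bar>J2 m\<bar> \<le> D + \<epsilon> * real m"
proof -
  define \<epsilon>' where "\<epsilon>' = \<epsilon> / (A\<^sub>u + 1)"
  have e': "\<epsilon>' > 0" "\<epsilon>' * A\<^sub>u \<le> \<epsilon>" using eps kernel_u_bound(1) by (auto simp: \<epsilon>'_def field_simps)
  obtain r J where r: "0 < r" "r < 1" and approx: "\<forall>x\<in>{-1..1}. \<forall>y\<in>{-1..1}. x \<noteq> y \<longrightarrow>
    \<bar>ln \<bar>x - y\<bar> + ln 2 + abel r J x y\<bar> \<le> \<epsilon>' * \<Gamma> x y"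
    using log_kernel_approx[OF b_e(2,4) e'(1), of 0] by blast
  define D where "D = (\<Sum>j=1..J. 2 / real j)"
  have D0: "D \<ge> 0" unfolding D_def by (intro sum_nonneg) auto
  have "\<bar>J2 m\<bar> \<le> D + \<epsilon> * real m" if m: "m \<ge> 1" for m
  proof -
    let ?p = "poly (C (Suc m))"
    let ?P = "\<lambda>z. K m (fst z) (snd z) * (?p (fst z) * ?p (snd z))"
    let ?T = "\<lambda>j z. T j (fst z) * T j (snd z) * ?P z"
    \<comment> \<open>The constant -ln 2 of the expansion contributes nothing, which is why
      \<open>J2\<close> lacks the linear term of \<open>J1\<close>.\<close>
    have P1: "integrable \<nu> ?P" "(\<integral>z. ?P z \<partial>\<nu>) = 0"
    proof -
      show "integrable \<nu> ?P" using poly_K_integral(1)[of 1 m "Suc m"] by simp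
      have "(\<integral>z. ?P z \<partial>\<nu>) = (\<Sum>i\<le>m. (L (C (Suc m) * C i))\<^sup>2)"
        using poly_K_integral(2)[of 1 m "Suc m"] by simp
      also have "\<dots> = 0" by (intro sum.neutral) (auto simp: ortho)
      finally show "(\<integral>z. ?P z \<partial>\<nu>) = 0" .
    qed
    have Ti: "integrable \<nu> (?T j)" for j by (rule poly_K_integral(1))
    have Tb: "\<bar>\<integral>z. ?T j z \<partial>\<nu>\<bar> \<le> 1" for j
    proof -
      have "(\<integral>z. ?T j z \<partial>\<nu>) = (\<Sum>i\<le>m. (L (cheb_T j * C (Suc m) * C i))\<^sup>2)" by (rule poly_K_integral(2))
      moreover have "\<dots> \<le> L (cheb_T j * C (Suc m) * (cheb_T j * C (Suc m)))" by (rule bessel)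
      moreover have "cheb_T j * C (Suc m) * (cheb_T j * C (Suc m)) = (cheb_T j * cheb_T j) * (C (Suc m) * C (Suc m))"
        by (simp only: mult_ac)
      moreover have "\<bar>L ((cheb_T j * cheb_T j) * (C (Suc m) * C (Suc m)))\<bar> \<le> 1"
        by (intro L_square_bound) (simp add: power2_eq_square[symmetric] abs_square_le_1 abs_cheb_T_le)
      moreover have "0 \<le> (\<Sum>i\<le>m. (L (cheb_T j * C (Suc m) * C i))\<^sup>2)" by (intro sum_nonneg) auto
      ultimately show ?thesis by (simp only: abs_le_iff) linarith
    qed
    define S where "S = (\<lambda>z. \<Sum>j=1..J. 2 / real j * r ^ j * ?T j z)"
    have Si: "integrable \<nu> S" unfolding S_def using Ti by (intro Bochner_Integration.integrable_sum integrable_mult_right)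
    have SI: "\<bar>\<integral>z. S z \<partial>\<nu>\<bar> \<le> D"
    proof -
      define t where "t = (\<lambda>j. \<integral>z. ?T j z \<partial>\<nu>)"
      have tb: "\<bar>t j\<bar> \<le> 1" for j unfolding t_def by (rule Tb)
      have "(\<integral>z. S z \<partial>\<nu>) = (\<Sum>j=1..J. (\<integral>z. 2 / real j * r ^ j * ?T j z \<partial>\<nu>))"
        unfolding S_def using Ti by (intro Bochner_Integration.integral_sum integrable_mult_right)
      also have "\<dots> = (\<Sum>j=1..J. 2 / real j * r ^ j * t j)"
        unfolding t_def by (intro sum.cong refl integral_mult_right_zero)
      finally have SE: "(\<integral>z. S z \<partial>\<nu>) = (\<Sum>j=1..J. 2 / real j * r ^ j * t j)" .
      have "\<bar>\<integral>z. S z \<partial>\<nu>\<bar> \<le> (\<Sum>j=1..J. \<bar>2 / real j * r ^ j * t j\<bar>)"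
        unfolding SE by (rule sum_abs)
      also have "\<dots> \<le> D" unfolding D_def
      proof (rule sum_mono)
        fix j
        have "\<bar>2 / real j * r ^ j * t j\<bar> = 2 / real j * r ^ j * \<bar>t j\<bar>"
          using r by (simp add: abs_mult)
        also have "\<dots> \<le> 2 / real j * 1 * 1" using r tb[of j] by (intro mult_mono power_le_one) auto
        finally show "\<bar>2 / real j * r ^ j * t j\<bar> \<le> 2 / real j" by simp
      qed
      finally show ?thesis .
    qed
    let ?W = "\<lambda>z. \<Gamma> (fst z) (snd z) * (u m (fst z) * (?p (snd z))\<^sup>2)"
    let ?W' = "\<lambda>z. \<Gamma> (fst z) (snd z) * ((?p (fst z))\<^sup>2 * u m (snd z))"
    have W: "integrable \<nu> ?W" "(\<integral>z. ?W z \<partial>\<nu>) \<le> A\<^sub>u * real m"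
      "integrable \<nu> ?W'" "(\<integral>z. ?W' z \<partial>\<nu>) \<le> A\<^sub>u * real m"
      using kernel_pair_integral[OF m, of "\<lambda>y. (?p y)\<^sup>2"] by (simp_all add: square_integral)
    have e1: "J2 m + (\<integral>z. S z \<partial>\<nu>) = (\<integral>z. \<Lambda> z * ?P z + ln 2 * ?P z + S z \<partial>\<nu>)"
      unfolding J2_def using P1 Si pair_integrals(3)[OF m] by simp
    have b1: "\<bar>\<integral>z. \<Lambda> z * ?P z + ln 2 * ?P z + S z \<partial>\<nu>\<bar>
        \<le> (\<integral>z. \<epsilon>' / 2 * (?W z + ?W' z) \<partial>\<nu>)"
    proof (rule integral_abs_bound_AE)
      show "integrable \<nu> (\<lambda>z. \<Lambda> z * ?P z + ln 2 * ?P z + S z)"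
        using P1 Si pair_integrals(3)[OF m] by simp
      show "integrable \<nu> (\<lambda>z. \<epsilon>' / 2 * (?W z + ?W' z))" using W by simp
      show "AE z in \<nu>. \<bar>\<Lambda> z * ?P z + ln 2 * ?P z + S z\<bar> \<le> \<epsilon>' / 2 * (?W z + ?W' z)"
        using AE_pair
      proof eventually_elim
        case (elim z)
        have "\<Lambda> z * ?P z + ln 2 * ?P z + S z =
          (ln \<bar>fst z - snd z\<bar> + ln 2 + abel r J (fst z) (snd z)) * ?P z"
          unfolding S_def distrib_right sum_distrib_right by (simp only: mult.assoc)
        also have "\<bar>\<dots>\<bar> \<le> (\<epsilon>' * \<Gamma> (fst z) (snd z)) * ((u m (fst z) * (?p (snd z))\<^sup>2 + (?p (fst z))\<^sup>2 * u m (snd z)) / 2)"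
          unfolding abs_mult[of _ "?P z"] using approx elim KCC_bound[of m "fst z" "snd z"] e'(1)
          by (intro mult_mono) auto
        also have "\<dots> = \<epsilon>' / 2 * (?W z + ?W' z)" by (simp add: algebra_simps)
        finally show ?case .
      qed
    qed
    have e2: "(\<integral>z. \<epsilon>' / 2 * (?W z + ?W' z) \<partial>\<nu>) = \<epsilon>' / 2 * ((\<integral>z. ?W z \<partial>\<nu>) + (\<integral>z. ?W' z \<partial>\<nu>))"
      by (simp only: integral_mult_right_zero Bochner_Integration.integral_add[OF W(1,3)])
    have b2: "\<epsilon>' / 2 * ((\<integral>z. ?W z \<partial>\<nu>) + (\<integral>z. ?W' z \<partial>\<nu>)) \<le> \<epsilon>' / 2 * (A\<^sub>u * real m + A\<^sub>u * real m)"
      using W e'(1) by (intro mult_left_mono add_mono) auto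
    have b3: "\<epsilon>' / 2 * (A\<^sub>u * real m + A\<^sub>u * real m) \<le> \<epsilon> * real m"
      using mult_right_mono[OF e'(2), of "real m"] by (simp add: mult_ac)
    have "\<bar>J2 m + (\<integral>z. S z \<partial>\<nu>)\<bar> \<le> \<epsilon> * real m"
      unfolding e1 by (rule order_trans[OF b1[unfolded e2] order_trans[OF b2 b3]])
    then show ?thesis using SI by linarith
  qed
  then show ?thesis using D0 by blast
qed

text \<open>E1 - E2 in closed form. The kernel index is one less than the number of points, so n + 3
  points correspond to \<open>I2 (n + 2)\<close>.\<close>

definition energy_diff :: "nat \<Rightarrow> real" where
  "energy_diff n = - I2 (n + 2) - (- I2 n - 2 * (\<Phi> n 1 + \<Phi> n (- 1)) - 2 * ln 2)"

lemma energy_diff_eq: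
  assumes "n \<ge> 1"
  shows "energy_diff n = - 2 * J1 n + 2 * J2 n - 2 * J1 (Suc n) + 2 * J2 (Suc n) + 2 * (\<Phi> n 1 + \<Phi> n (- 1)) + 2 * ln 2"
  using I2_Suc[of n] I2_Suc[of "Suc n"] assms by (simp add: energy_diff_def)

lemma energy_diff_smallo: "energy_diff \<in> o(\<lambda>n. real n)"
proof (rule landau_o.smallI)
  fix c :: real assume c: "c > 0"
  \<comment> \<open>Twelve error terms of size \<epsilon> n add up to c n / 2; the other half
    absorbs the constant D.\<close>
  define \<epsilon> where "\<epsilon> = c / 24"
  have eps: "\<epsilon> > 0" using c by (simp add: \<epsilon>_def)
  obtain D1 where D1: "D1 \<ge> 0" "\<forall>m\<ge>1. \<forall>y\<in>{-1..1}. \<bar>\<Phi> m y + (real m + 1) * ln 2\<bar> \<le> D1 + \<epsilon> * real m"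
    using potential_asymptotics[OF eps] by blast
  obtain D2 where D2: "D2 \<ge> 0" "\<forall>m\<ge>1. \<bar>J1 m + (real m + 1) * ln 2\<bar> \<le> D2 + \<epsilon> * real m"
    using J1_asymptotics[OF eps] by blast
  obtain D3 where D3: "D3 \<ge> 0" "\<forall>m\<ge>1. \<bar>J2 m\<bar> \<le> D3 + \<epsilon> * real m"
    using J2_asymptotics[OF eps] by blast
  define D where "D = 4 * D1 + 4 * D2 + 4 * D3 + 4 * \<epsilon> + 4 * ln 2"
  have bound: "\<bar>energy_diff n\<bar> \<le> D + c / 2 * real n" if n: "n \<ge> 1" for n
  proof -
    have a: "\<bar>\<Phi> n 1 + (real n + 1) * ln 2\<bar> \<le> D1 + \<epsilon> * real n" "\<bar>\<Phi> n (- 1) + (real n + 1) * ln 2\<bar> \<le> D1 + \<epsilon> * real n"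
      using D1(2) n by auto
    have b: "\<bar>J1 n + (real n + 1) * ln 2\<bar> \<le> D2 + \<epsilon> * real n" "\<bar>J1 (Suc n) + (real n + 2) * ln 2\<bar> \<le> D2 + \<epsilon> * real n + \<epsilon>"
      using D2(2)[rule_format, of n] D2(2)[rule_format, of "Suc n"] n by (auto simp: algebra_simps)
    have d: "\<bar>J2 n\<bar> \<le> D3 + \<epsilon> * real n" "\<bar>J2 (Suc n)\<bar> \<le> D3 + \<epsilon> * real n + \<epsilon>"
      using D3(2)[rule_format, of n] D3(2)[rule_format, of "Suc n"] n by (auto simp: algebra_simps)
    \<comment> \<open>After centring every term at its asymptotic value the multiples of n ln 2
      cancel and 4 ln 2 remains.\<close>
    have ed: "energy_diff n = - 2 * (J1 n + (real n + 1) * ln 2) + 2 * J2 n - 2 * (J1 (Suc n) + (real n + 2) * ln 2) + 2 * J2 (Suc n)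
      + 2 * (\<Phi> n 1 + (real n + 1) * ln 2) + 2 * (\<Phi> n (- 1) + (real n + 1) * ln 2) + 4 * ln 2"
      unfolding energy_diff_eq[OF n] by (simp add: algebra_simps)
    have c2: "c / 2 * real n = 12 * (\<epsilon> * real n)" by (simp add: \<epsilon>_def)
    have l2: "0 \<le> ln (2::real)" by simp
    have tri: "\<bar>e\<bar> \<le> 4 * B\<^sub>1 + 4 * B\<^sub>2 + 4 * B\<^sub>3 + 4 * s + 4 * l"
      if "e = - 2 * p + 2 * q - 2 * p' + 2 * q' + 2 * v + 2 * v' + 4 * l" "0 \<le> l"
        "\<bar>v\<bar> \<le> B\<^sub>1" "\<bar>v'\<bar> \<le> B\<^sub>1" "\<bar>p\<bar> \<le> B\<^sub>2" "\<bar>p'\<bar> \<le> B\<^sub>2 + s" "\<bar>q\<bar> \<le> B\<^sub>3" "\<bar>q'\<bar> \<le> B\<^sub>3 + s"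
      for e p p' q q' v v' l B\<^sub>1 B\<^sub>2 B\<^sub>3 s :: real
      using that unfolding abs_le_iff by - (elim conjE, (intro conjI; linarith))
    have "\<bar>energy_diff n\<bar> \<le> 4 * (D1 + \<epsilon> * real n) + 4 * (D2 + \<epsilon> * real n) + 4 * (D3 + \<epsilon> * real n) + 4 * \<epsilon> + 4 * ln 2"
      using tri[OF ed l2 a b d] .
    then show ?thesis unfolding D_def c2 by simp
  qed
  have "eventually (\<lambda>n. D \<le> c / 2 * real n) sequentially"
  proof -
    have "filterlim (\<lambda>n. c / 2 * real n) at_top sequentially"
      using c by (intro filterlim_tendsto_pos_mult_at_top[OF tendsto_const] filterlim_real_sequentially) auto
    then show ?thesis by (auto simp: filterlim_at_top)
  qed
  then show "eventually (\<lambda>n. norm (energy_diff n) \<le> c * norm (real n)) sequentially"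
    using eventually_ge_at_top[of 1]
  proof eventually_elim
    case (elim n)
    then show ?case using bound[of n] by simp
  qed
qed

end

subsection \<open>Expected energies and the Chebyshev case\<close>

lemma log_energy_eq: "log_energy S = - (\<Sum>z\<in>{z\<in>S \<times> S. fst z \<noteq> snd z}. ln \<bar>fst z - snd z\<bar>)"
proof -
  have "{(x, y). x \<in> S \<and> y \<in> S \<and> x \<noteq> y} = {z\<in>S \<times> S. fst z \<noteq> snd z}" by auto
  then show ?thesis unfolding log_energy_def by (simp add: case_prod_beta')
qed

lemma log_energy_insert:
  assumes "finite S" "a \<notin> S"
  shows "log_energy (insert a S) = log_energy S - 2 * (\<Sum>x\<in>S. ln \<bar>x - a\<bar>)"
proof -
  let ?D = "{z\<in>S \<times> S. fst z \<noteq> snd z}"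
  let ?f = "\<lambda>z :: real \<times> real. ln \<bar>fst z - snd z\<bar>"
  have eq: "{z\<in>insert a S \<times> insert a S. fst z \<noteq> snd z} = ?D \<union> ((\<lambda>x. (x, a)) ` S \<union> (\<lambda>x. (a, x)) ` S)"
    using assms by auto
  have fin: "finite ?D" using assms by simp
  have "(\<Sum>z\<in>?D \<union> ((\<lambda>x. (x, a)) ` S \<union> (\<lambda>x. (a, x)) ` S). ?f z)
    = (\<Sum>z\<in>?D. ?f z) + (\<Sum>z\<in>(\<lambda>x. (x, a)) ` S \<union> (\<lambda>x. (a, x)) ` S. ?f z)"
    using assms by (intro sum.union_disjoint fin) auto
  also have "(\<Sum>z\<in>(\<lambda>x. (x, a)) ` S \<union> (\<lambda>x. (a, x)) ` S. ?f z)
    = (\<Sum>z\<in>(\<lambda>x. (x, a)) ` S. ?f z) + (\<Sum>z\<in>(\<lambda>x. (a, x)) ` S. ?f z)"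
    using assms by (intro sum.union_disjoint) auto
  also have "(\<Sum>z\<in>(\<lambda>x. (x, a)) ` S. ?f z) = (\<Sum>x\<in>S. ln \<bar>x - a\<bar>)"
    by (subst sum.reindex) (auto simp: inj_on_def)
  also have "(\<Sum>z\<in>(\<lambda>x. (a, x)) ` S. ?f z) = (\<Sum>x\<in>S. ln \<bar>x - a\<bar>)"
    by (subst sum.reindex) (auto simp: inj_on_def abs_minus_commute)
  finally show ?thesis unfolding log_energy_eq eq by simp
qed

context gegenbauer
begin

lemma dpp_gegenbauer:
  assumes "gegenbauer_dpp lam C n M X"
  shows "dpp M {-1..1} \<mu> (K n) X"
proof
  show "determinantal_point_process M {-1..1} \<mu> (K n) X" using assms by (simp add: gegenbauer_dpp_def)
  have "rho2 (K n) z = u n (fst z) * u n (snd z) - (K n (fst z) (snd z))\<^sup>2" for z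
    by (simp add: rho2_def K_diag power2_eq_square K_sym[of n "snd z"])
  then have "(\<integral>\<^sup>+z. ennreal (rho2 (K n) z) \<partial>\<nu>) \<le> (\<integral>\<^sup>+z. ennreal (u n (fst z) * u n (snd z)) \<partial>\<nu>)"
    by (intro nn_integral_mono ennreal_leI) simp
  also have "\<dots> < \<infinity>"
    using integral_pair_product(1)[OF u_integrable u_integrable, of n n] by (simp add: nn_integral_eq_integral)
  finally show "(\<integral>\<^sup>+z. ennreal (rho2 (K n) z) \<partial>\<nu>) < \<infinity>" .
qed (simp_all add: sigma_finite_measure_axioms)

lemma expected_energies:
  assumes dpp: "gegenbauer_dpp lam C n M X" and n: "n \<ge> 1"
  shows "expected_log_energy M X = - I2 n"
    "expected_log_energy M (\<lambda>\<omega>. X \<omega> \<union> {1, -1}) = - I2 n - 2 * (\<Phi> n 1 + \<Phi> n (- 1)) - 2 * ln 2"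
proof -
  interpret P: dpp M "{-1..1}" \<mu> "K n" X by (rule dpp_gegenbauer[OF dpp])
  have rho: "rho2 (K n) z = u n (fst z) * u n (snd z) - (K n (fst z) (snd z))\<^sup>2" for z
    by (simp add: rho2_def K_diag power2_eq_square K_sym[of n "snd z"])
  let ?Z = "\<lambda>\<omega>. {z\<in>X \<omega> \<times> X \<omega>. fst z \<noteq> snd z}"
  let ?s = "\<lambda>\<omega>. \<Sum>z\<in>?Z \<omega>. ln \<bar>fst z - snd z\<bar>"
  have s: "integrable M ?s" "(\<integral>\<omega>. ?s \<omega> \<partial>M) = I2 n"
  proof -
    have i: "integrable \<nu> (\<lambda>z. \<Lambda> z * rho2 (K n) z)"
      unfolding rho by (rule pair_integrals(4)[OF n])
    have r0: "rho2 (K n) z \<ge> 0" for z unfolding rho by (rule rho_bounds)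
    have m: "(\<lambda>z. ln \<bar>fst z - snd z\<bar>) \<in> borel_measurable \<nu>" "rho2 (K n) \<in> borel_measurable \<nu>"
      by measurable
    show "integrable M ?s"
      by (rule campbell_real(1)[OF P.campbell2 m(2) r0 m(1) i])
    have "(\<integral>\<omega>. ?s \<omega> \<partial>M) = (\<integral>z. \<Lambda> z * rho2 (K n) z \<partial>\<nu>)"
      by (rule campbell_real(2)[OF P.campbell2 m(2) r0 m(1) i])
    then show "(\<integral>\<omega>. ?s \<omega> \<partial>M) = I2 n" unfolding rho I2_def .
  qed
  have l: "integrable M (\<lambda>\<omega>. \<Sum>x\<in>X \<omega>. ln \<bar>x - a\<bar>)" "(\<integral>\<omega>. (\<Sum>x\<in>X \<omega>. ln \<bar>x - a\<bar>) \<partial>M) = \<Phi> n a"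
    if a: "a \<in> {-1..1}" for a
  proof -
    have i: "integrable \<mu> (\<lambda>x. ln \<bar>x - a\<bar> * K n x x)"
      unfolding K_diag using log_integrable[OF n a, of "u n" 1] by simp
    have c: "(\<lambda>\<omega>. \<Sum>x\<in>X \<omega>. g x) \<in> borel_measurable M \<and>
        (\<integral>\<^sup>+\<omega>. (\<Sum>x\<in>X \<omega>. g x) \<partial>M) = (\<integral>\<^sup>+x. g x * ennreal (K n x x) \<partial>\<mu>)" if "g \<in> borel_measurable \<mu>" for g
      using that by (rule P.campbell1)
    have m: "(\<lambda>x. ln \<bar>x - a\<bar>) \<in> borel_measurable \<mu>" "(\<lambda>x. K n x x) \<in> borel_measurable \<mu>"
      unfolding K_diag by measurable
    have r0: "K n x x \<ge> 0" for x unfolding K_diag by simp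
    show "integrable M (\<lambda>\<omega>. \<Sum>x\<in>X \<omega>. ln \<bar>x - a\<bar>)"
      by (rule campbell_real(1)[OF c m(2) r0 m(1) i])
    have "(\<integral>\<omega>. (\<Sum>x\<in>X \<omega>. ln \<bar>x - a\<bar>) \<partial>M) = (\<integral>x. ln \<bar>x - a\<bar> * K n x x \<partial>\<mu>)"
      by (rule campbell_real(2)[OF c m(2) r0 m(1) i])
    then show "(\<integral>\<omega>. (\<Sum>x\<in>X \<omega>. ln \<bar>x - a\<bar>) \<partial>M) = \<Phi> n a" unfolding K_diag \<Phi>_def .
  qed
  \<comment> \<open>Single points are null sets for \<mu>, so the expected number of process points
    at a is zero.\<close>
  have notin: "AE \<omega> in M. a \<notin> X \<omega>" for a
  proof -
    have "(\<integral>\<^sup>+\<omega>. of_nat (card (X \<omega> \<inter> {a})) \<partial>M) = (\<integral>\<^sup>+x. ennreal (K n x x) * indicator {a} x \<partial>\<mu>)"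
      by (rule P.intensity1) simp
    also have "\<dots> = (\<integral>\<^sup>+x. 0 \<partial>\<mu>)"
      using AE_neq[of a] by (intro nn_integral_cong_AE) (auto elim!: eventually_mono)
    finally have z: "(\<integral>\<^sup>+\<omega>. of_nat (card (X \<omega> \<inter> {a})) \<partial>M) = 0" by simp
    have [measurable]: "(\<lambda>\<omega>. card (X \<omega> \<inter> {a})) \<in> measurable M (count_space UNIV)"
      by (rule P.card_measurable) simp
    have "AE \<omega> in M. of_nat (card (X \<omega> \<inter> {a})) = (0::ennreal)"
      using z by (subst (asm) nn_integral_0_iff_AE) auto
    then show ?thesis by (rule AE_mp) (auto intro!: AE_I2)
  qed
  show 1: "expected_log_energy M X = - I2 n"
    unfolding expected_log_energy_def log_energy_eq using s by simp
  let ?l = "\<lambda>a \<omega>. \<Sum>x\<in>X \<omega>. ln \<bar>x - a\<bar>"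
  let ?c = "\<lambda>a \<omega>. if card (X \<omega> \<inter> {a}) = 0 then 1 else 0 :: real"
  let ?g = "\<lambda>\<omega>. - ?s \<omega> - 2 * ?l (- 1) \<omega> - 2 * (ln 2 + ?l 1 \<omega>)"
  \<comment> \<open>\<open>?h\<close> is exact for every configuration, including those that contain
    an end point, and is built from counts, whose measurability is given. It agrees almost surely
    with \<open>?g\<close>.\<close>
  let ?h = "\<lambda>\<omega>. - ?s \<omega> - ?c (- 1) \<omega> * (2 * ?l (- 1) \<omega>) - ?c 1 \<omega> * (2 * (?c (- 1) \<omega> * ln 2 + ?l 1 \<omega>))"
  have "expected_log_energy M (\<lambda>\<omega>. X \<omega> \<union> {1, -1}) = (\<integral>\<omega>. ?h \<omega> \<partial>M)"
    unfolding expected_log_energy_def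
  proof (rule Bochner_Integration.integral_cong[OF refl])
    fix \<omega> assume "\<omega> \<in> space M"
    then have fin: "finite (X \<omega>)" by (rule P.X_finite)
    have eq: "X \<omega> \<union> {1, -1} = insert 1 (insert (- 1) (X \<omega>))" by auto
    have c: "?c a \<omega> = (if a \<in> X \<omega> then 0 else 1)" for a using fin by auto
    have ins: "log_energy (insert a S) = log_energy S - (if a \<in> S then 0 else 2 * (\<Sum>x\<in>S. ln \<bar>x - a\<bar>))"
      if "finite S" for a S using log_energy_insert[OF that] by (auto simp: insert_absorb)
    have "(\<Sum>x\<in>insert (- 1) (X \<omega>). ln \<bar>x - 1\<bar>) = (if - 1 \<in> X \<omega> then 0 else ln 2) + ?l 1 \<omega>"
      using fin by (auto simp: insert_absorb)
    then show "log_energy (X \<omega> \<union> {1, -1}) = ?h \<omega>"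
      unfolding eq c using fin by (simp add: ins log_energy_eq[of "X \<omega>"])
  qed
  also have "\<dots> = (\<integral>\<omega>. ?g \<omega> \<partial>M)"
  proof (rule integral_cong_AE)
    have [measurable]: "(\<lambda>\<omega>. card (X \<omega> \<inter> {a})) \<in> measurable M (count_space UNIV)" for a
      by (rule P.card_measurable) simp
    have [measurable]: "?s \<in> borel_measurable M" using s(1) by (rule borel_measurable_integrable)
    have [measurable]: "?l 1 \<in> borel_measurable M" "?l (- 1) \<in> borel_measurable M"
      using l(1)[of 1] l(1)[of "- 1"] by (auto intro: borel_measurable_integrable)
    show "?h \<in> borel_measurable M" "?g \<in> borel_measurable M" by measurable
    show "AE \<omega> in M. ?h \<omega> = ?g \<omega>"
      using notin[of 1] notin[of "- 1"] by eventually_elim simp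
  qed
  also have "\<dots> = - I2 n - 2 * \<Phi> n (- 1) - 2 * (ln 2 + \<Phi> n 1)"
    using s l[of 1] l[of "- 1"] P.prob_space by simp
  finally show "expected_log_energy M (\<lambda>\<omega>. X \<omega> \<union> {1, -1}) = - I2 n - 2 * (\<Phi> n 1 + \<Phi> n (- 1)) - 2 * ln 2" by simp
qed

text \<open>Splitting K leaves inner integrals of ln |x-y| against a single polynomial; in the
  Chebyshev case these are explicit.\<close>

lemma J2_sum:
  assumes m: "m \<ge> 1"
  shows "J2 m = (\<Sum>k\<le>m. \<integral>y. (\<integral>x. ln \<bar>x - y\<bar> * poly (C k * C (Suc m)) x \<partial>\<mu>) * poly (C k * C (Suc m)) y \<partial>\<mu>)"
proof -
  let ?f = "\<lambda>k. poly (C k * C (Suc m))"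
  have fu: "\<bar>?f k x\<bar> \<le> u (Suc m) x" if "k \<le> m" for k x
  proof -
    have ku: "(poly (C k) x)\<^sup>2 \<le> u m x" unfolding u_def using that by (intro member_le_sum) auto
    have le: "\<bar>?f k x\<bar> \<le> ((poly (C k) x)\<^sup>2 + (poly (C (Suc m)) x)\<^sup>2) / 2"
      using sum_squares_bound[of "\<bar>poly (C k) x\<bar>" "\<bar>poly (C (Suc m)) x\<bar>"] by (simp add: abs_mult)
    have "(a + b) / 2 \<le> v + b" if "a \<le> v" "0 \<le> a" "0 \<le> b" for a b v :: real
      using that by simp
    from this[OF ku] have "((poly (C k) x)\<^sup>2 + (poly (C (Suc m)) x)\<^sup>2) / 2 \<le> u (Suc m) x"
      unfolding u_Suc by simp
    then show ?thesis by (rule order_trans[OF le])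
  qed
  have i: "integrable \<nu> (\<lambda>z. \<Lambda> z * (?f k (fst z) * ?f k (snd z)))" if "k \<le> m" for k
    by (rule log_pair_integrable[of "Suc m", where g = "u (Suc m)"])
       (auto simp: abs_mult[of "?f k _"] simp del: poly_mult intro!: mult_mono fu that)
  have "J2 m = (\<integral>z. (\<Sum>k\<le>m. \<Lambda> z * (?f k (fst z) * ?f k (snd z))) \<partial>\<nu>)"
    unfolding J2_def gegenbauer_kernel_def sum_distrib_right sum_distrib_left
    by (intro Bochner_Integration.integral_cong refl sum.cong) (simp add: mult_ac)
  also have "\<dots> = (\<Sum>k\<le>m. \<integral>z. \<Lambda> z * (?f k (fst z) * ?f k (snd z)) \<partial>\<nu>)"
    using i by (intro Bochner_Integration.integral_sum) auto
  also have "\<dots> = (\<Sum>k\<le>m. \<integral>y. (\<integral>x. ln \<bar>x - y\<bar> * ?f k x \<partial>\<mu>) * ?f k y \<partial>\<mu>)"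
  proof (intro sum.cong refl)
    fix k assume "k \<in> {..m}"
    then have k: "integrable \<nu> (\<lambda>(x, y). ln \<bar>x - y\<bar> * (?f k x * ?f k y))"
      using i[of k] by (simp add: case_prod_beta')
    have "(\<integral>y. (\<integral>x. ln \<bar>x - y\<bar> * ?f k x \<partial>\<mu>) * ?f k y \<partial>\<mu>) = (\<integral>y. (\<integral>x. ln \<bar>x - y\<bar> * (?f k x * ?f k y) \<partial>\<mu>) \<partial>\<mu>)"
      by (simp only: mult.assoc[symmetric] integral_mult_left_zero)
    also have "\<dots> = (\<integral>z. \<Lambda> z * (?f k (fst z) * ?f k (snd z)) \<partial>\<nu>)"
      using mu2.integral_snd[OF k] by (simp only: case_prod_beta')
    finally show "(\<integral>z. \<Lambda> z * (?f k (fst z) * ?f k (snd z)) \<partial>\<nu>) = (\<integral>y. (\<integral>x. ln \<bar>x - y\<bar> * ?f k x \<partial>\<mu>) * ?f k y \<partial>\<mu>)" ..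
  qed
  finally show ?thesis .
qed

end

section \<open>Exact values for the arcsine law\<close>

locale chebyshev = gegenbauer 0 C for C
begin

text \<open>Orthonormal polynomials are determined up to sign only, so the square of the factor is
  what can be recorded.\<close>

lemma C_eq: "\<exists>s. C k = smult s (cheb_T k) \<and> s\<^sup>2 = (if k = 0 then 1 else 2)"
proof -
  define t where "t = (\<lambda>k. smult (if k = 0 then 1 else sqrt 2) (cheb_T k))"
  have tt: "L (t i * t j) = (if i = j then 1 else 0)" for i j using cheb.ortho[of i j] by (simp only: t_def)
  obtain a where a: "C k = (\<Sum>i\<le>k. smult (a i) (t i))"
    using cheb.C_span[of "C k" k] unfolding t_def by auto
  have "L (t i * C k) = a i" if "i \<le> k" for i
    using that by (subst a) (simp add: sum_distrib_left L_sum L_smult tt if_distrib cong: if_cong)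
  moreover have "L (t i * C k) = 0" if "i < k" for i
    using that degree_cheb_T[of i] by (intro L_orthogonal) (simp add: t_def)
  ultimately have "a i = 0" if "i < k" for i using that by (metis less_imp_le)
  then have "(\<Sum>i\<le>k. smult (a i) (t i)) = (\<Sum>i\<in>{k}. smult (a i) (t i))"
    by (intro sum.mono_neutral_right) auto
  then have C: "C k = smult (a k) (t k)" using a by simp
  then have "L (C k * C k) = (a k)\<^sup>2 * L (t k * t k)"
    by (simp only: mult_smult_left mult_smult_right L_smult power2_eq_square mult.assoc)
  then have "(a k)\<^sup>2 = 1" using ortho[of k k] tt[of k k] by simp
  then show ?thesis using C unfolding t_def
    by (intro exI[of _ "a k * (if k = 0 then 1 else sqrt 2)"]) (auto simp: power_mult_distrib)
qed

lemma T_integral [simp]: "(\<integral>x. T i x \<partial>\<mu>) = (if i = 0 then 1 else 0)"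
  using cheb_T_integral[of 0 i] by simp

lemma L_T: "L (cheb_T i) = (if i = 0 then 1 else 0)"
  by (simp add: L_def)

lemma L_TT: "L (cheb_T i * cheb_T j) = (if i = j then if i = 0 then 1 else 1 / 2 else 0)"
  using cheb_T_integral[of i j] by (simp add: L_def)

text \<open>The T_j are eigenfunctions of the logarithmic kernel on the arcsine law. Orthogonality
  reduces the Abel mean to its j-th term, and r is then sent to 1.\<close>

lemma log_cheb:
  assumes y: "y \<in> {-1..1}"
  shows "integrable \<mu> (\<lambda>x. ln \<bar>x - y\<bar> * T j x)"
    "(\<integral>x. ln \<bar>x - y\<bar> * T j x \<partial>\<mu>) = (if j = 0 then - ln 2 else - T j y / real j)"
proof -
  \<comment> \<open>Since |T_j| \<le> 1 \<le> \<open>u 1\<close>, the bounds for m = 1 dominate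
    every T_j.\<close>
  have u1: "1 \<le> u 1 x" for x
  proof -
    obtain s where "C 0 = smult s (cheb_T 0)" "s\<^sup>2 = 1" using C_eq[of 0] by auto
    then show ?thesis by (simp add: u_def)
  qed
  have T1: "\<bar>T j x\<bar> \<le> 1 * u 1 x" if "x \<in> {-1..1}" for x j
    using abs_cheb_T_le[OF that, of j] u1[of x] by simp
  show i: "integrable \<mu> (\<lambda>x. ln \<bar>x - y\<bar> * T j x)"
    using T1 by (intro log_integrable[where m = 1 and B = 1, OF _ y]) auto
  have A: "A\<^sub>u \<ge> 0" "integrable \<mu> (\<lambda>x. \<Gamma> x y * u 1 x)" "(\<integral>x. \<Gamma> x y * u 1 x \<partial>\<mu>) \<le> A\<^sub>u"
    using kernel_u_bound(1) kernel_u_integral[OF order_refl y] by simp_all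
  define I where "I = (\<integral>x. ln \<bar>x - y\<bar> * T j x \<partial>\<mu>)"
  define R where "R = (if j = 0 then - ln 2 else - T j y / real j)"
  have "\<bar>I - R\<bar> \<le> (A\<^sub>u + 1) * \<epsilon>" if eps: "0 < \<epsilon>" "\<epsilon> < 1" for \<epsilon>
  proof -
    obtain r J where r: "1 - \<epsilon> < r" "0 < r" "r < 1" "j \<le> J" and approx: "\<forall>x\<in>{-1..1}. \<forall>y\<in>{-1..1}. x \<noteq> y \<longrightarrow>
      \<bar>ln \<bar>x - y\<bar> + ln 2 + abel r J x y\<bar> \<le> \<epsilon> * \<Gamma> x y"
      using log_kernel_approx[OF b_e(2,4) eps(1), of j] by blast
    define S where "S = (\<Sum>i=1..J. smult (2 / real i * r ^ i * T i y) (cheb_T i))"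
    have Sx: "poly S x = abel r J x y" for x
      by (simp add: S_def poly_sum mult_ac)
    have i2: "integrable \<mu> (\<lambda>x. poly S x * T j x)"
      using integrable_poly[of "S * cheb_T j"] by (simp only: poly_mult[abs_def])
    have "I + ln 2 * (if j = 0 then 1 else 0) + (\<integral>x. poly S x * T j x \<partial>\<mu>)
        = (\<integral>x. (ln \<bar>x - y\<bar> + ln 2 + poly S x) * T j x \<partial>\<mu>)"
      unfolding I_def distrib_right using i i2 by simp
    also have "\<bar>\<dots>\<bar> \<le> (\<integral>x. \<epsilon> * (\<Gamma> x y * u 1 x) \<partial>\<mu>)"
    proof (rule integral_abs_bound_AE)
      show "integrable \<mu> (\<lambda>x. (ln \<bar>x - y\<bar> + ln 2 + poly S x) * T j x)"
        unfolding distrib_right using i i2 by simp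
      show "integrable \<mu> (\<lambda>x. \<epsilon> * (\<Gamma> x y * u 1 x))" using A(2) by (rule integrable_mult_right)
      show "AE x in \<mu>. \<bar>(ln \<bar>x - y\<bar> + ln 2 + poly S x) * T j x\<bar> \<le> \<epsilon> * (\<Gamma> x y * u 1 x)"
        using AE_Icc AE_neq[of y]
      proof eventually_elim
        case (elim x)
        then have "\<bar>ln \<bar>x - y\<bar> + ln 2 + poly S x\<bar> \<le> \<epsilon> * \<Gamma> x y" unfolding Sx using approx y by blast
        then have "\<bar>ln \<bar>x - y\<bar> + ln 2 + poly S x\<bar> * \<bar>T j x\<bar> \<le> \<epsilon> * \<Gamma> x y * u 1 x"
          using T1[OF elim(1), of j] eps by (intro mult_mono) auto
        then show ?case by (simp add: abs_mult mult.assoc)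
      qed
    qed
    also have "\<dots> = \<epsilon> * (\<integral>x. \<Gamma> x y * u 1 x \<partial>\<mu>)" by (rule integral_mult_right_zero)
    also have "\<dots> \<le> \<epsilon> * A\<^sub>u" using A(3) eps by (intro mult_left_mono) auto
    finally have 1: "\<bar>I + ln 2 * (if j = 0 then 1 else 0) + (\<integral>x. poly S x * T j x \<partial>\<mu>)\<bar> \<le> \<epsilon> * A\<^sub>u" .
    have "(\<integral>x. poly S x * T j x \<partial>\<mu>) = L (S * cheb_T j)" by (simp add: L_def)
    also have "\<dots> = (\<Sum>i=1..J. 2 / real i * r ^ i * T i y * L (cheb_T i * cheb_T j))"
      by (simp add: S_def sum_distrib_right L_sum L_smult)
    also have "\<dots> = (\<Sum>i=1..J. if i = j then r ^ j * T j y / real j else 0)"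
      by (intro sum.cong refl) (auto simp: L_def cheb_T_integral)
    also have "\<dots> = (if j = 0 then 0 else r ^ j * T j y / real j)"
      using r(4) by (auto simp: sum.delta)
    finally have 2: "(\<integral>x. poly S x * T j x \<partial>\<mu>) = (if j = 0 then 0 else r ^ j * T j y / real j)" .
    show ?thesis
    proof (cases "j = 0")
      case True
      then show ?thesis using 1 2 eps by (simp add: R_def algebra_simps)
    next
      case False
      \<comment> \<open>Bernoulli's inequality turns 1 - \<epsilon> < r into an error of at most
        \<epsilon> for r^j / j.\<close>
      have "1 - real j * \<epsilon> \<le> (1 - \<epsilon>) ^ j" using Bernoulli_inequality[of "- \<epsilon>" j] eps by simp
      also have "\<dots> \<le> r ^ j" using r eps by (intro power_mono) auto
      finally have rj: "1 - r ^ j \<le> real j * \<epsilon>" by simp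
      have rj0: "0 \<le> 1 - r ^ j" using r by (simp add: power_le_one)
      have "\<bar>T j y / real j - r ^ j * T j y / real j\<bar> = (1 - r ^ j) * \<bar>T j y\<bar> / real j"
      proof -
        have "T j y / real j - r ^ j * T j y / real j = (1 - r ^ j) * T j y / real j"
          by (simp add: left_diff_distrib diff_divide_distrib)
        then show ?thesis using rj0 by (simp add: abs_mult)
      qed
      also have "\<dots> \<le> (real j * \<epsilon>) * 1 / real j"
        using rj rj0 abs_cheb_T_le[OF y, of j] by (intro divide_right_mono mult_mono) auto
      also have "\<dots> = \<epsilon>" using False by simp
      finally have "\<bar>T j y / real j - r ^ j * T j y / real j\<bar> \<le> \<epsilon>" .
      then show ?thesis using 1 2 False by (simp add: R_def algebra_simps abs_le_iff)
    qed
  qed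
  then have *: "\<bar>I - R\<bar> \<le> (A\<^sub>u + 1) * \<epsilon>" if "0 < \<epsilon>" "\<epsilon> < 1" for \<epsilon> using that by blast
  have "\<bar>I - R\<bar> \<le> 0 + \<delta>" if d: "\<delta> > 0" for \<delta>
  proof -
    define \<epsilon> where "\<epsilon> = min (1 / 2) (\<delta> / (A\<^sub>u + 1))"
    have e: "0 < \<epsilon>" "\<epsilon> < 1" "\<epsilon> \<le> \<delta> / (A\<^sub>u + 1)" using d A(1) by (auto simp: \<epsilon>_def)
    have "\<bar>I - R\<bar> \<le> (A\<^sub>u + 1) * \<epsilon>" using *[OF e(1,2)] .
    also have "\<dots> \<le> (A\<^sub>u + 1) * (\<delta> / (A\<^sub>u + 1))" using e(3) A(1) by (intro mult_left_mono) auto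
    also have "\<dots> = \<delta>" using A(1) by simp
    finally show ?thesis by simp
  qed
  then have "\<bar>I - R\<bar> \<le> 0" by (rule field_le_epsilon)
  then show "(\<integral>x. ln \<bar>x - y\<bar> * T j x \<partial>\<mu>) = (if j = 0 then - ln 2 else - T j y / real j)"
    by (simp add: I_def R_def)
qed

lemma u_eq:
  assumes x: "x \<in> {-1..1}"
  shows "u m x = real m + 1 + (\<Sum>k=1..m. T (2 * k) x)"
proof -
  have sq: "(poly (C k) x)\<^sup>2 = (if k = 0 then 1 else 1 + T (2 * k) x)" for k
  proof -
    obtain s where s: "C k = smult s (cheb_T k)" "s\<^sup>2 = (if k = 0 then 1 else 2)" using C_eq[of k] by auto
    have "(T k x)\<^sup>2 = (1 + T (2 * k) x) / 2"
      using cheb_T_mult[OF x order_refl, of k] by (simp add: power2_eq_square mult_2[symmetric])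
    then show ?thesis using s by (simp add: power_mult_distrib)
  qed
  show ?thesis unfolding u_def by (induction m) (simp_all add: sq)
qed

lemma \<Phi>_eq:
  assumes y: "y \<in> {-1..1}"
  shows "\<Phi> m y = - (real m + 1) * ln 2 - (\<Sum>k=1..m. T (2 * k) y / (2 * real k))"
proof -
  have "\<Phi> m y = (\<integral>x. (real m + 1) * (ln \<bar>x - y\<bar> * T 0 x) + (\<Sum>k=1..m. ln \<bar>x - y\<bar> * T (2 * k) x) \<partial>\<mu>)"
    unfolding \<Phi>_def
  proof (rule integral_cong_AE)
    show "AE x in \<mu>. ln \<bar>x - y\<bar> * u m x = (real m + 1) * (ln \<bar>x - y\<bar> * T 0 x) + (\<Sum>k=1..m. ln \<bar>x - y\<bar> * T (2 * k) x)"
      using AE_Icc by eventually_elim (simp add: u_eq sum_distrib_left distrib_left mult.commute)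
  qed measurable
  also have "\<dots> = (real m + 1) * (\<integral>x. ln \<bar>x - y\<bar> * T 0 x \<partial>\<mu>) + (\<Sum>k=1..m. \<integral>x. ln \<bar>x - y\<bar> * T (2 * k) x \<partial>\<mu>)"
    using log_cheb(1)[OF y] log_cheb(1)[OF y, of 0] by (subst Bochner_Integration.integral_add) (auto intro!: Bochner_Integration.integrable_sum integrable_mult_right Bochner_Integration.integral_sum)
  also have "\<dots> = - (real m + 1) * ln 2 - (\<Sum>k=1..m. T (2 * k) y / (2 * real k))"
    using log_cheb(2)[OF y, of 0] by (simp add: log_cheb(2)[OF y] sum_negf algebra_simps)
  finally show ?thesis .
qed

text \<open>Only even Chebyshev degrees occur in \<open>u m\<close>, and they equal 1 at both end
  points, where the corrections therefore add up to a harmonic number.\<close>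

lemma \<Phi>_endpoints: "\<Phi> m 1 = - (real m + 1) * ln 2 - harm m / 2" "\<Phi> m (- 1) = - (real m + 1) * ln 2 - harm m / 2"
proof -
  have "T n 1 = 1" for n using poly_cheb_T_cos[of n 0] by simp
  moreover have "T (2 * k) (- 1) = 1" for k
    using poly_cheb_T_cos[of "2 * k" pi] cos_npi[of "2 * k"] by simp
  moreover have "(\<Sum>k=1..m. 1 / (2 * real k)) = harm m / 2"
    by (simp add: harm_def sum_divide_distrib inverse_eq_divide mult.commute)
  ultimately show "\<Phi> m 1 = - (real m + 1) * ln 2 - harm m / 2" "\<Phi> m (- 1) = - (real m + 1) * ln 2 - harm m / 2"
    by (simp_all add: \<Phi>_eq)
qed

text \<open>\<open>\<Phi> m\<close> has Chebyshev modes up to 2 m, while the squared polynomial is 1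
  + T_(2m+2) on [-1, 1]; orthogonality leaves the constant term only.\<close>

lemma J1_exact:
  assumes "m \<ge> 1"
  shows "J1 m = - (real m + 1) * ln 2"
proof -
  obtain s where s: "C (Suc m) = smult s (cheb_T (Suc m))" "s\<^sup>2 = 2" using C_eq[of "Suc m"] by auto
  define N where "N = 2 * Suc m"
  have N: "N \<noteq> 0" "\<And>k. k \<le> m \<Longrightarrow> 2 * k \<noteq> N" by (auto simp: N_def)
  let ?P = "smult (- (real m + 1) * ln 2) 1 - (\<Sum>k=1..m. smult (1 / (2 * real k)) (cheb_T (2 * k)))"
  have "J1 m = L (?P * (1 + cheb_T N))"
    unfolding J1_eq(1)[OF assms] L_def
  proof (rule integral_cong_AE)
    show "(\<lambda>y. \<Phi> m y * (poly (C (Suc m)) y)\<^sup>2) \<in> borel_measurable \<mu>"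
      using J1_eq(2)[OF assms] by (rule borel_measurable_integrable)
    show "AE y in \<mu>. \<Phi> m y * (poly (C (Suc m)) y)\<^sup>2 = poly (?P * (1 + cheb_T N)) y"
      using AE_Icc
    proof eventually_elim
      case (elim y)
      have "(T (Suc m) y)\<^sup>2 = (1 + T N y) / 2"
        using cheb_T_mult[OF elim order_refl, of "Suc m"] unfolding N_def mult_2 power2_eq_square by (simp del: cheb_T.simps(3))
      then have "(poly (C (Suc m)) y)\<^sup>2 = 1 + T N y" using s by (simp add: power_mult_distrib del: cheb_T.simps(3))
      moreover have "\<Phi> m y = poly ?P y" using elim by (simp add: \<Phi>_eq poly_sum)
      ultimately show ?case by (simp only: poly_mult poly_add poly_1)
    qed
  qed measurable
  also have "\<dots> = (- (real m + 1) * ln 2) * (L 1 + L (1 * cheb_T N)) - (\<Sum>k=1..m. 1 / (2 * real k) * (L (cheb_T (2 * k)) + L (cheb_T (2 * k) * cheb_T N)))"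
    by (simp only: left_diff_distrib distrib_left L_add L_diff L_smult mult_smult_left sum_distrib_right L_sum mult_1_right mult_1_left sum.distrib) 
  also have "(\<Sum>k=1..m. 1 / (2 * real k) * (L (cheb_T (2 * k)) + L (cheb_T (2 * k) * cheb_T N))) = 0"
    using N by (intro sum.neutral) (auto simp: L_T L_TT)
  also have "(- (real m + 1) * ln 2) * (L 1 + L (1 * cheb_T N)) - 0 = - (real m + 1) * ln 2"
    using L_T[of 0] N by (simp add: L_T)
  finally show ?thesis .
qed

lemma J2_exact:
  assumes "m \<ge> 1"
  shows "J2 m = - (\<Sum>k\<le>m. 1 / (real m + 1 + real k) + 1 / (real m + 1 - real k)) / 2"
proof -
  let ?N = "Suc m"
  have "(\<integral>y. (\<integral>x. ln \<bar>x - y\<bar> * poly (C k * C ?N) x \<partial>\<mu>) * poly (C k * C ?N) y \<partial>\<mu>)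
     = - (1 / (real m + 1 + real k) + 1 / (real m + 1 - real k)) / 2" if k: "k \<le> m" for k
  proof -
    obtain s where s: "C k = smult s (cheb_T k)" "s\<^sup>2 = (if k = 0 then 1 else 2)" using C_eq[of k] by auto
    obtain t where t: "C ?N = smult t (cheb_T ?N)" "t\<^sup>2 = 2" using C_eq[of ?N] by auto
    define a b where "a = ?N + k" and "b = ?N - k"
    have ab: "a \<ge> 1" "b \<ge> 1" "real a = real m + 1 + real k" "real b = real m + 1 - real k" using k by (auto simp: a_def b_def of_nat_diff)
    have f: "poly (C k * C ?N) x = s * t / 2 * (T a x + T b x)" if "x \<in> {-1..1}" for x
    proof -
      have "poly (C k * C ?N) x = s * t * (T k x * T ?N x)" using s t by (simp del: cheb_T.simps)
      also have "T k x * T ?N x = (T a x + T b x) / 2"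
        unfolding a_def b_def using k by (intro cheb_T_mult that) simp
      finally show ?thesis by simp
    qed
    have inner: "(\<integral>x. ln \<bar>x - y\<bar> * poly (C k * C ?N) x \<partial>\<mu>) = - (s * t / 2) * (T a y / real a + T b y / real b)"
      if y: "y \<in> {-1..1}" for y
    proof -
      have "(\<integral>x. ln \<bar>x - y\<bar> * poly (C k * C ?N) x \<partial>\<mu>)
        = (\<integral>x. s * t / 2 * (ln \<bar>x - y\<bar> * T a x + ln \<bar>x - y\<bar> * T b x) \<partial>\<mu>)"
      proof (rule integral_cong_AE)
        show "AE x in \<mu>. ln \<bar>x - y\<bar> * poly (C k * C ?N) x = s * t / 2 * (ln \<bar>x - y\<bar> * T a x + ln \<bar>x - y\<bar> * T b x)"
          using AE_Icc by eventually_elim (simp only: f, simp add: algebra_simps)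
      qed measurable
      also have "\<dots> = s * t / 2 * ((\<integral>x. ln \<bar>x - y\<bar> * T a x \<partial>\<mu>) + (\<integral>x. ln \<bar>x - y\<bar> * T b x \<partial>\<mu>))"
        using log_cheb(1)[OF y] by simp
      also have "(\<integral>x. ln \<bar>x - y\<bar> * T a x \<partial>\<mu>) = - (T a y / real a)"
        using log_cheb(2)[OF y, of a] ab(1) by simp
      also have "(\<integral>x. ln \<bar>x - y\<bar> * T b x \<partial>\<mu>) = - (T b y / real b)"
        using log_cheb(2)[OF y, of b] ab(2) by simp
      finally show ?thesis by (simp add: algebra_simps)
    qed
    let ?Q = "(smult (1 / real a) (cheb_T a) + smult (1 / real b) (cheb_T b)) * (cheb_T a + cheb_T b)"
    have "(\<integral>y. (\<integral>x. ln \<bar>x - y\<bar> * poly (C k * C ?N) x \<partial>\<mu>) * poly (C k * C ?N) y \<partial>\<mu>)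
      = L (smult (- (s * t / 2) * (s * t / 2)) ?Q)"
      unfolding L_def
    proof (rule integral_cong_AE)
      show "AE y in \<mu>. (\<integral>x. ln \<bar>x - y\<bar> * poly (C k * C ?N) x \<partial>\<mu>) * poly (C k * C ?N) y = poly (smult (- (s * t / 2) * (s * t / 2)) ?Q) y"
        using AE_Icc by eventually_elim (simp only: f inner poly_smult poly_mult[of _ "cheb_T a + cheb_T b"] poly_add, simp add: algebra_simps)
    qed measurable
    also have "\<dots> = - (s\<^sup>2 * t\<^sup>2 / 4) * L ?Q" by (simp only: L_smult) (simp add: power2_eq_square)
    also have "L ?Q = 1 / real a * (L (cheb_T a * cheb_T a) + L (cheb_T a * cheb_T b)) + 1 / real b * (L (cheb_T b * cheb_T a) + L (cheb_T b * cheb_T b))"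
      by (simp only: distrib_left distrib_right L_add L_smult mult_smult_left)
    finally have "(\<integral>y. (\<integral>x. ln \<bar>x - y\<bar> * poly (C k * C ?N) x \<partial>\<mu>) * poly (C k * C ?N) y \<partial>\<mu>)
      = - (s\<^sup>2 * t\<^sup>2 / 4) * (1 / real a * (1 / 2 + (if a = b then 1 / 2 else 0)) + 1 / real b * ((if a = b then 1 / 2 else 0) + 1 / 2))"
      using ab(1,2) by (auto simp: L_TT)
    \<comment> \<open>For k = 0 the smaller normalisation of \<open>C 0\<close> is offset by the
      cross terms, since then a = b; both cases give the same value.\<close>
    also have "\<dots> = - (1 / real a + 1 / real b) / 2"
    proof (cases "k = 0")
      case True
      then have "a = b" by (simp add: a_def b_def)
      then show ?thesis using s(2) t(2) True by simp
    next
      case False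
      then have "a \<noteq> b" using k by (simp add: a_def b_def)
      then show ?thesis using s(2) t(2) False by simp
    qed
    finally show ?thesis unfolding ab(3,4) .
  qed
  then have "J2 m = (\<Sum>k\<le>m. - (1 / (real m + 1 + real k) + 1 / (real m + 1 - real k)) / 2)"
    unfolding J2_sum[OF assms] by (intro sum.cong refl) auto
  then show ?thesis by (simp only: sum_negf sum_divide_distrib[symmetric])
qed

end

section \<open>Harmonic numbers and the logarithmic order\<close>

lemma harm_upper: "n \<ge> 1 \<Longrightarrow> harm n \<le> 1 + ln (real n)"
  using decseqD[OF decseq_harm_diff_ln, of 0 "n - 1"] by (simp add: harm_def)

text \<open>Read backwards, the terms 1/(m+1-k) sum to the harmonic number of m + 1; the m + 1 terms
  1/(m+1+k) contribute between 0 and 1.\<close>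

lemma reciprocal_sum_bounds:
  fixes m :: nat
  defines "S \<equiv> (\<Sum>k\<le>m. 1 / (real m + 1 + real k) + 1 / (real m + 1 - real k))"
  shows "harm (Suc m) \<le> S" "S \<le> 1 + harm (Suc m)"
proof -
  have "(\<Sum>k\<le>m. 1 / (real m + 1 - real k)) = (\<Sum>k<Suc m. inverse (real (Suc (Suc m - Suc k))))"
    unfolding lessThan_Suc_atMost by (intro sum.cong) (auto simp: of_nat_diff inverse_eq_divide)
  also have "\<dots> = harm (Suc m)"
    unfolding harm_altdef by (rule sum.nat_diff_reindex)
  finally have S: "S = (\<Sum>k\<le>m. 1 / (real m + 1 + real k)) + harm (Suc m)"
    by (simp add: S_def sum.distrib)
  have "0 \<le> (\<Sum>k\<le>m. 1 / (real m + 1 + real k))" by (intro sum_nonneg) auto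
  then show "harm (Suc m) \<le> S" by (simp add: S)
  have "(\<Sum>k\<le>m. 1 / (real m + 1 + real k)) \<le> (\<Sum>k\<le>m. 1 / (real m + 1))"
    by (intro sum_mono divide_left_mono) auto
  then show "S \<le> 1 + harm (Suc m)" by (simp add: S add.commute)
qed

context chebyshev
begin

lemma energy_diff_bounds:
  assumes n: "n \<ge> 1"
  shows "2 * harm n < - energy_diff n" "- energy_diff n \<le> 4 * harm n + 5"
proof -
  define S where "S = (\<lambda>m. \<Sum>k\<le>m. 1 / (real m + 1 + real k) + 1 / (real m + 1 - real k))"
  have step: "harm (Suc k) \<le> harm k + (1::real)" for k
    unfolding harm_Suc by (intro add_left_mono) (simp add: inverse_eq_divide)
  have "energy_diff n = 4 * ln 2 - 2 * harm n - S n - S (Suc n)"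
  proof -
    have J: "J2 n = - S n / 2" "J2 (Suc n) = - S (Suc n) / 2"
      unfolding S_def by (rule J2_exact, use n in simp)+
    have "J1 (Suc n) = - (real (Suc n) + 1) * ln 2" by (rule J1_exact) simp
    then show ?thesis
      unfolding energy_diff_eq[OF n] J1_exact[OF n] J \<Phi>_endpoints by (simp add: algebra_simps)
  qed
  moreover have "harm (Suc n) \<le> S n" "S n \<le> 1 + harm (Suc n)" 
    "harm (Suc (Suc n)) \<le> S (Suc n)" "S (Suc n) \<le> 1 + harm (Suc (Suc n))"
    unfolding S_def by (rule reciprocal_sum_bounds)+
  moreover have "harm (Suc n) \<le> harm n + (1::real)" "harm (Suc (Suc n)) \<le> harm n + (2::real)"
    using step[of n] step[of "Suc n"] by linarith+
  \<comment> \<open>Already at n = 1 these two lower bounds sum to 3, which exceeds 4 ln 2; this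
    gives the strict inequality for every n.\<close>
  moreover have "(3 / 2 :: real) \<le> harm (Suc n)" "(3 / 2 :: real) \<le> harm (Suc (Suc n))"
    using harm_mono[of 2 "Suc n", where 'a = real] harm_mono[of 2 "Suc (Suc n)", where 'a = real] n
    by (simp_all add: harm_expand)
  moreover have "ln (2::real) < 3 / 4" using ln2_le_25_over_36 by simp
  moreover have "0 \<le> ln (2::real)" by simp
  ultimately show "2 * harm n < - energy_diff n" "- energy_diff n \<le> 4 * harm n + 5" by linarith+
qed

lemma energy_diff_neg: "n \<ge> 1 \<Longrightarrow> energy_diff n < 0"
  using energy_diff_bounds(1)[of n] harm_nonneg[of n, where 'a = real] by linarith

lemma energy_diff_bigtheta: "(\<lambda>n. - energy_diff n) \<in> \<Theta>(\<lambda>n. ln (real n))"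
proof (rule bigthetaI)
  have ln1: "1 \<le> ln (real n)" if "n \<ge> 3" for n
  proof -
    have "exp 1 \<le> real n" using exp_le that by linarith
    then show ?thesis using that by (simp add: ln_ge_iff)
  qed
  \<comment> \<open>For n \<ge> 3 one has ln n \<ge> 1, so 4 (1 + ln n) + 5 \<le> 13 ln n.\<close>
  have up: "norm (- energy_diff n) \<le> 13 * norm (ln (real n))" if "n \<ge> 3" for n
    using energy_diff_bounds(2)[of n] energy_diff_neg[of n] harm_upper[of n] ln1[OF that] that by simp
  then show "(\<lambda>n. - energy_diff n) \<in> O(\<lambda>n. ln (real n))"
    by (intro landau_o.bigI[of 13] eventually_sequentiallyI[of 3]) auto
  have lo: "1 * norm (ln (real n)) \<le> norm (- energy_diff n)" if "n \<ge> 3" for n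
  proof -
    have "ln (real n) \<le> ln (real n + 1)" using that by simp
    moreover have "2 * harm n < - energy_diff n" using that by (intro energy_diff_bounds(1)) simp
    ultimately have "ln (real n) \<le> - energy_diff n"
      using ln_le_harm[of n] harm_nonneg[of n, where 'a = real] by linarith
    then show ?thesis using ln1[OF that] by simp
  qed
  then show "(\<lambda>n. - energy_diff n) \<in> \<Omega>(\<lambda>n. ln (real n))"
    by (intro landau_omega.bigI[of 1] eventually_sequentiallyI[of 3]) auto
qed

end

theorem corollary3:
  fixes lam :: real
    and C :: "nat \<Rightarrow> real poly"
    and M\<^sub>1 :: "nat \<Rightarrow> 'a measure" and X\<^sub>1 :: "nat \<Rightarrow> 'a \<Rightarrow> real set"
    and M\<^sub>2 :: "nat \<Rightarrow> 'b measure" and X\<^sub>2 :: "nat \<Rightarrow> 'b \<Rightarrow> real set"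
    and E\<^sub>1 E\<^sub>2 :: "nat \<Rightarrow> real"
  assumes "lam > - 1 / 2"
    and "normalized_gegenbauer lam C"
    and "\<And>n. n \<ge> 1 \<Longrightarrow> gegenbauer_dpp lam C (n + 2) (M\<^sub>1 n) (X\<^sub>1 n)"
    and "\<And>n. n \<ge> 1 \<Longrightarrow> gegenbauer_dpp lam C n (M\<^sub>2 n) (X\<^sub>2 n)"
    and "\<And>n. n \<ge> 1 \<Longrightarrow> E\<^sub>1 n = expected_log_energy (M\<^sub>1 n) (X\<^sub>1 n)"
    and "\<And>n. n \<ge> 1 \<Longrightarrow> E\<^sub>2 n = expected_log_energy (M\<^sub>2 n) (\<lambda>\<omega>. X\<^sub>2 n \<omega> \<union> {1, -1})"
  shows "(\<lambda>n. E\<^sub>1 n - E\<^sub>2 n) \<in> o(\<lambda>n. real n) \<and>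
    (lam = 0 \<longrightarrow>
       (\<forall>n\<ge>1. E\<^sub>1 n < E\<^sub>2 n) \<and>
       (\<lambda>n. E\<^sub>2 n - E\<^sub>1 n) \<in> \<Theta>(\<lambda>n. ln (real n)))"
proof -
  interpret gegenbauer lam C by standard (use assms in auto)
  have diff: "E\<^sub>1 n - E\<^sub>2 n = energy_diff n" if n: "n \<ge> 1" for n
    using expected_energies(1)[OF assms(3)[OF n]] expected_energies(2)[OF assms(4)[OF n] n] assms(5,6)[OF n]
    by (simp add: energy_diff_def)
  have "(\<lambda>n. E\<^sub>1 n - E\<^sub>2 n) \<in> o(\<lambda>n. real n)"
    using energy_diff_smallo
    by (subst landau_o.small.in_cong[of _ energy_diff]) (auto intro!: eventually_sequentiallyI[of 1] diff)
  moreover have "(\<forall>n\<ge>1. E\<^sub>1 n < E\<^sub>2 n) \<and> (\<lambda>n. E\<^sub>2 n - E\<^sub>1 n) \<in> \<Theta>(\<lambda>n. ln (real n))" if lam: "lam = 0"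
  proof
    interpret c: chebyshev C
      unfolding chebyshev_def using gegenbauer_axioms lam by simp
    have ed: "energy_diff = c.energy_diff" using lam by simp
    show "\<forall>n\<ge>1. E\<^sub>1 n < E\<^sub>2 n"
      using diff c.energy_diff_neg ed by (metis less_iff_diff_less_0)
    have "E\<^sub>2 n - E\<^sub>1 n = - c.energy_diff n" if "n \<ge> 1" for n using diff[OF that] ed by simp
    then show "(\<lambda>n. E\<^sub>2 n - E\<^sub>1 n) \<in> \<Theta>(\<lambda>n. ln (real n))"
      using c.energy_diff_bigtheta
      by (subst landau_theta.in_cong[of _ "\<lambda>n. - c.energy_diff n"]) (auto intro!: eventually_sequentiallyI[of 1])
  qed
  ultimately show ?thesis by blast
qed

end
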